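(* Let $\mathcal{L}'=\{\mathcal{B},\ \mathcal{SD},\ \mathcal{P},\ \mathcal{PN},\ \mathcal{SDP},\ \langle\langle\mathcal{M}\rangle_\omega\cup\mathcal{H}_{\mathrm{ferro}}\rangle_\omega,\ \langle\mathcal{M}\rangle_\omega,\ \mathcal{H}_{\mathrm{ferro}},\ \langle\mathcal{M}\rangle_\omega\cap\mathcal{H}_{\mathrm{ferro}},\ \mathcal{I}_{\mathrm{ferro}}\}$. Then: (a) Every element of $\mathcal{L}'$ is an $\omega$-clone, and $\mathcal{L}'$ is a sublattice of the lattice $\mathcal{L}_\omega$ of all $\omega$-clones (ordered by inclusion, with join $\mathcal{F}\vee\mathcal{G}=\langle\mathcal{F}\cup\mathcal{G}\rangle_\omega$ and meet $\mathcal{F}\wedge\mathcal{G}=\mathcal{F}\cap\mathcal{G}$). (b) All ten elements of $\mathcal{L}'$ are pairwise distinct, except that possibly $\mathcal{SDP}=\langle\langle\mathcal{M}\rangle_\omega\cup\mathcal{H}_{\mathrm{ferro}}\rangle_\omega$ and possibly $\langle\mathcal{M}\rangle_\omega\cap\mathcal{H}_{\mathrm{ferro}}=\mathcal{I}_{\mathrm{ferro}}$. (c) The order and the lattice operations are as follows: $\mathcal{SD},\mathcal{P},\mathcal{PN}$ are pairwise incomparable subsets of $\mathcal{B}$; the join of any two of them is $\mathcal{B}$ and the meet of any two of them is $\mathcal{SDP}$; $\langle\langle\mathcal{M}\rangle_\omega\cup\mathcal{H}_{\mathrm{ferro}}\rangle_\omega\subseteq\mathcal{SDP}$; $\langle\mathcal{M}\rangle_\omega$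 and $\mathcal{H}_{\mathrm{ferro}}$ are incomparable, both contained in $\langle\langle\mathcal{M}\rangle_\omega\cup\mathcal{H}_{\mathrm{ferro}}\rangle_\omega$ (which is their join) and both containing $\langle\mathcal{M}\rangle_\omega\cap\mathcal{H}_{\mathrm{ferro}}$ (their meet); and $\mathcal{I}_{\mathrm{ferro}}\subseteq\langle\mathcal{M}\rangle_\omega\cap\mathcal{H}_{\mathrm{ferro}}$. (d) Moreover: (i) $\mathcal{SD}=\mathcal{I}_{\mathrm{anti}}$; (ii) $\mathcal{I}_{\mathrm{ferro}}=\langle\mathcal{E}\rangle_\omega$; (iii) each of $\mathcal{SD}$, $\mathcal{P}$, $\mathcal{PN}$ is maximal in $\mathcal{B}$; (iv) $\mathcal{SDP}$ is maximal in $\mathcal{SD}$.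
   Context: For $k\ge 0$, $\mathcal{B}_k$ is the set of all functions $\{0,1\}^k\to\mathbb{R}_{\ge0}$ and $\mathcal{B}=\bigcup_{k\ge0}\mathcal{B}_k$ (nullary functions in $\mathcal{B}_0$ are identified with non-negative reals). $\mathrm{EQ}\in\mathcal{B}_2$ is the equality function ($\mathrm{EQ}(0,0)=\mathrm{EQ}(1,1)=1$, $\mathrm{EQ}(0,1)=\mathrm{EQ}(1,0)=0$). For $\mathcal{F}\subseteq\mathcal{B}$, the functional clone $\langle\mathcal{F}\rangle$ is the closure of $\mathcal{F}\cup\{\mathrm{EQ}\}$ under: introducing a fictitious argument ($g(x_1,\dots,x_{k+1})=f(x_1,\dots,x_k)$), permuting arguments, pointwise product of two functions of equal arity, and summation over the last argument ($g(x_1,\dots,x_{k-1})=\sum_{x_k\in\{0,1\}}f(x_1,\dots,x_k)$). A $k$-ary $f$ is a limit of $\mathcal{F}$ if there is a finite $S\subseteq\mathcal{F}$ such that for every $\epsilon>0$ there is a $k$-ary $f_\epsilon\in\langle S\rangle$ with $\max_{\mathbf{x}}|f(\mathbf{x})-f_\epsilon(\mathbf{x})|<\epsilon$. The $\omega$-clone $\langle\mathcal{F}\rangle_\omega$ is the closure of $\mathcal{F}\cup\{\mathrm{EQ}\}$ under the four operations above and under adding limits. An $\omega$-clone is a set $\mathcal{F}$ with $\langle\mathcal{F}\rangle_\omega=\mathcal{F}$. An $\omega$-clone $\mathcal{F}$ is maximal in an $\omega$-clone $\mathcal{G}$ if $\mathcal{F}\subseteq\mathcal{G}$ and there is no $\omega$-clone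 $\mathcal{C}$ with $\mathcal{F}\subsetneq\mathcal{C}\subsetneq\mathcal{G}$. Notation: $|\mathbf{x}|$ is Hamming weight, $\overline{\mathbf{x}}$ bitwise complement, $\mathbf{0},\mathbf{1}$ the all-0/all-1 tuples. The Fourier transform of $f\in\mathcal{B}_k$ is $\widehat f(\mathbf{x})=2^{-k}\sum_{\mathbf{w}\in\{0,1\}^k}(-1)^{|\mathbf{w}\wedge\mathbf{x}|}f(\mathbf{w})$. For $\lambda\ge0$, $k\ge0$, the hypergraph Ising function $\mathrm{Ising}_k^\lambda\in\mathcal{B}_k$ is $1$ on $\mathbf{0},\mathbf{1}$ and $\lambda$ elsewhere. An arity-$k$ match-circuit is an undirected graph with vertices $u_1,\dots,u_k$ (external, each of degree 1; the incident edges $y_1,\dots,y_k$ are terminals of weight 1) and internal vertices $v_1,\dots,v_n$ ($n\ge k$), every non-terminal edge $e$ having weight $w_e>0$; it implements the function $f(y_1,\dots,y_k)$ equal to the sum, over all edge sets $H$ which contain exactly the terminals $y_i$ with value 1 and in which every internal vertex is incident to exactly one edge of $H$, of $\prod_{e\in H}w_e$. An arity-$k$ even-circuit is defined the same way except that non-terminal weights lie in $(0,1]$ and the sum is over edge sets $H$ (with terminals as prescribed) in which every internal vertex has even degree. Sets: $\mathcal{SD}=\{f\in\mathcal{B}: f(\mathbf{x})=f(\overline{\mathbf{x}})\ \forall\mathbf{x}\}$; $\mathcal{P}=\{f\in\mathcal{B}:\widehat f(\mathbf{x})\ge0\ \forall\mathbf{x}\}$; $\mathcal{PN}=\{f\in\mathcal{B}:\widehat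 f(\mathbf{x})\ge0$ when $|\mathbf{x}|$ even, $\widehat f(\mathbf{x})\le0$ when $|\mathbf{x}|$ odd$\}$; $\mathcal{SDP}=\mathcal{SD}\cap\mathcal{P}\cap\mathcal{PN}$; $\mathcal{M}=\{f\in\mathcal{B}:\widehat f$ is implemented by a match-circuit$\}$; $\mathcal{E}$ is the set of functions $c\cdot f\in\mathcal{B}$ with $c\ge0$ real and $\widehat f$ implemented by an even-circuit. $\mathcal{I}_{\mathrm{ferro}}=\langle\{\mathrm{Ising}_2^\lambda:0\le\lambda\le1\}\cup\mathcal{B}_0\rangle_\omega$, $\mathcal{I}_{\mathrm{anti}}=\langle\{\mathrm{Ising}_2^\lambda:\lambda\ge1\}\cup\mathcal{B}_0\rangle_\omega$, $\mathcal{H}_{\mathrm{ferro}}=\langle\{\mathrm{Ising}_k^\lambda:k\ge2,0\le\lambda\le1\}\cup\mathcal{B}_0\rangle_\omega$. *)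

theory Defs
  imports Complex_Main "HOL-Library.FuncSet" "HOL-Combinatorics.Permutations"
begin

section \<open>Boolean functions with non-negative real values\<close>

text \<open>A tuple in \<open>{0,1}\<^sup>k\<close> is a Boolean list of length \<open>k\<close> (\<open>True\<close> is 1).  A \<open>k\<close>-ary function is
  stored together with its arity, and it is extensional on the tuples of length \<open>k\<close>, so that
  equality of pairs is equality of functions of equal arity.\<close>

type_synonym bfun = "nat \<times> (bool list \<Rightarrow> real)"

definition tuples :: "nat \<Rightarrow> bool list set" where
  "tuples k = {x. length x = k}"

definition \<B>\<^sub>a :: "nat \<Rightarrow> (bool list \<Rightarrow> real) set" where
  "\<B>\<^sub>a k = (tuples k \<rightarrow>\<^sub>E {0..})"

definition \<B> :: "bfun set" where
  "\<B> = (SIGMA k:UNIV. \<B>\<^sub>a k)"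

definition nullary :: "bfun set" where
  "nullary = {0} \<times> \<B>\<^sub>a 0"

definition EQ :: bfun where
  "EQ = (2, \<lambda>x\<in>tuples 2. if x ! 0 = x ! 1 then 1 else 0)"


section \<open>Functional clones and omega-clones\<close>

fun add_fictitious :: "bfun \<Rightarrow> bfun" where
  "add_fictitious (k, f) = (Suc k, \<lambda>x\<in>tuples (Suc k). f (butlast x))"

fun permute_args :: "(nat \<Rightarrow> nat) \<Rightarrow> bfun \<Rightarrow> bfun" where
  "permute_args \<pi> (k, f) = (k, \<lambda>x\<in>tuples k. f (permute_list \<pi> x))"

definition sum_last :: "nat \<Rightarrow> (bool list \<Rightarrow> real) \<Rightarrow> bfun" where
  "sum_last k f = (k, \<lambda>x\<in>tuples k. \<Sum>b\<in>UNIV. f (x @ [b]))"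

definition closed_under_ops :: "bfun set \<Rightarrow> bool" where
  "closed_under_ops C \<longleftrightarrow>
     (\<forall>g\<in>C. add_fictitious g \<in> C) \<and>
     (\<forall>k f \<pi>. (k, f) \<in> C \<and> \<pi> permutes {..<k} \<longrightarrow> permute_args \<pi> (k, f) \<in> C) \<and>
     (\<forall>k f g. (k, f) \<in> C \<and> (k, g) \<in> C \<longrightarrow> (k, \<lambda>x\<in>tuples k. f x * g x) \<in> C) \<and>
     (\<forall>k f. (Suc k, f) \<in> C \<longrightarrow> sum_last k f \<in> C)"

definition functional_clone :: "bfun set \<Rightarrow> bfun set" where
  "functional_clone F = closed_under_ops hull (insert EQ F)"

definition is_limit :: "bfun set \<Rightarrow> nat \<Rightarrow> (bool list \<Rightarrow> real) \<Rightarrow> bool" where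
  "is_limit F k f \<longleftrightarrow>
     (\<exists>S. finite S \<and> S \<subseteq> F \<and>
       (\<forall>\<epsilon>>0. \<exists>g. (k, g) \<in> functional_clone S \<and> (MAX x\<in>tuples k. \<bar>f x - g x\<bar>) < \<epsilon>))"

text \<open>A pointwise limit of functions in \<open>\<B>\<close> is non-negative, so quantifying over \<open>\<B>\<^sub>a k\<close> only
  fixes the value outside the tuples of length \<open>k\<close>.\<close>

definition closed_under_limits :: "bfun set \<Rightarrow> bool" where
  "closed_under_limits C \<longleftrightarrow> (\<forall>k. \<forall>f\<in>\<B>\<^sub>a k. is_limit C k f \<longrightarrow> (k, f) \<in> C)"

definition omega_closure :: "bfun set \<Rightarrow> bfun set" where
  "omega_closure F = (\<lambda>C. closed_under_ops C \<and> closed_under_limits C) hull (insert EQ F)"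

definition omega_clone :: "bfun set \<Rightarrow> bool" where
  "omega_clone F \<longleftrightarrow> F \<subseteq> \<B> \<and> omega_closure F = F"

definition maximal_in :: "bfun set \<Rightarrow> bfun set \<Rightarrow> bool" where
  "maximal_in F G \<longleftrightarrow> omega_clone F \<and> omega_clone G \<and> F \<subseteq> G \<and>
     \<not> (\<exists>C. omega_clone C \<and> F \<subset> C \<and> C \<subset> G)"

text \<open>The join and meet of the lattice of all omega-clones; that they are the least upper bound
  and the greatest lower bound is shown at the end of this theory.\<close>

definition omega_join :: "bfun set \<Rightarrow> bfun set \<Rightarrow> bfun set" where
  "omega_join F G = omega_closure (F \<union> G)"

definition omega_meet :: "bfun set \<Rightarrow> bfun set \<Rightarrow> bfun set" where
  "omega_meet F G = F \<inter> G"

definition omega_sublattice :: "bfun set set \<Rightarrow> bool" where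
  "omega_sublattice L \<longleftrightarrow> L \<noteq> {} \<and> (\<forall>F\<in>L. omega_clone F) \<and>
     (\<forall>F\<in>L. \<forall>G\<in>L. omega_join F G \<in> L \<and> omega_meet F G \<in> L)"

definition incomparable :: "bfun set \<Rightarrow> bfun set \<Rightarrow> bool" where
  "incomparable F G \<longleftrightarrow> \<not> F \<subseteq> G \<and> \<not> G \<subseteq> F"


section \<open>Fourier transform and hypergraph Ising functions\<close>

definition hweight :: "bool list \<Rightarrow> nat" where
  "hweight x = count_list x True"

definition fourier :: "nat \<Rightarrow> (bool list \<Rightarrow> real) \<Rightarrow> bool list \<Rightarrow> real" where
  "fourier k f x = (1 / 2 ^ k) * (\<Sum>w\<in>tuples k. (- 1) ^ hweight (map2 (\<and>) w x) * f w)"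

definition ising :: "nat \<Rightarrow> real \<Rightarrow> bfun" where
  "ising k lam =
     (k, \<lambda>x\<in>tuples k. if x = replicate k False \<or> x = replicate k True then 1 else lam)"


section \<open>Match-circuits and even-circuits\<close>

datatype cvertex = External nat | Internal nat

text \<open>Graphs are simple: an edge is a set of two distinct vertices, and \<open>E\<close> is the set of edges.
  An edge joining two external vertices is not excluded; it is the terminal of both, and
  subdividing it by two internal vertices, with weight 1 on the new edge between them, does not
  change the function that is implemented.\<close>

definition circuit_vertices :: "nat \<Rightarrow> nat \<Rightarrow> cvertex set" where
  "circuit_vertices k n = External ` {..<k} \<union> Internal ` {..<n}"

definition circuit_graph :: "nat \<Rightarrow> nat \<Rightarrow> cvertex set set \<Rightarrow> bool" where
  "circuit_graph k n E \<longleftrightarrow> k \<le> n \<and>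
     (\<forall>e\<in>E. e \<subseteq> circuit_vertices k n \<and> card e = 2) \<and>
     (\<forall>i<k. card {e \<in> E. External i \<in> e} = 1)"

definition terminal :: "cvertex set set \<Rightarrow> nat \<Rightarrow> cvertex set" where
  "terminal E i = (THE e. e \<in> E \<and> External i \<in> e)"

definition terminals :: "nat \<Rightarrow> cvertex set set \<Rightarrow> cvertex set set" where
  "terminals k E = terminal E ` {..<k}"

text \<open>The function implemented by a circuit, for a condition \<open>deg\<close> on the degrees of the internal
  vertices in the edge set \<open>H\<close>.\<close>

definition circuit_value ::
  "(nat \<Rightarrow> bool) \<Rightarrow> nat \<Rightarrow> nat \<Rightarrow> cvertex set set \<Rightarrow> (cvertex set \<Rightarrow> real) \<Rightarrow> bool list \<Rightarrow> real" where
  "circuit_value deg k n E w y =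
     (\<Sum>H | H \<subseteq> E \<and> (\<forall>i<k. terminal E i \<in> H \<longleftrightarrow> y ! i) \<and>
            (\<forall>j<n. deg (card {e \<in> H. Internal j \<in> e})).
        \<Prod>e\<in>H. w e)"

definition match_circuit ::
  "nat \<Rightarrow> nat \<Rightarrow> cvertex set set \<Rightarrow> (cvertex set \<Rightarrow> real) \<Rightarrow> bool" where
  "match_circuit k n E w \<longleftrightarrow> circuit_graph k n E \<and>
     (\<forall>e\<in>terminals k E. w e = 1) \<and> (\<forall>e\<in>E - terminals k E. 0 < w e)"

definition even_circuit ::
  "nat \<Rightarrow> nat \<Rightarrow> cvertex set set \<Rightarrow> (cvertex set \<Rightarrow> real) \<Rightarrow> bool" where
  "even_circuit k n E w \<longleftrightarrow> circuit_graph k n E \<and>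
     (\<forall>e\<in>terminals k E. w e = 1) \<and> (\<forall>e\<in>E - terminals k E. 0 < w e \<and> w e \<le> 1)"

definition match_implemented :: "nat \<Rightarrow> (bool list \<Rightarrow> real) \<Rightarrow> bool" where
  "match_implemented k h \<longleftrightarrow>
     (\<exists>n E w. match_circuit k n E w \<and>
        (\<forall>y\<in>tuples k. h y = circuit_value (\<lambda>d. d = 1) k n E w y))"

definition even_implemented :: "nat \<Rightarrow> (bool list \<Rightarrow> real) \<Rightarrow> bool" where
  "even_implemented k h \<longleftrightarrow>
     (\<exists>n E w. even_circuit k n E w \<and>
        (\<forall>y\<in>tuples k. h y = circuit_value even k n E w y))"


section \<open>The sets of functions\<close>

definition \<S>\<D> :: "bfun set" where
  "\<S>\<D> = {(k, f) \<in> \<B>. \<forall>x\<in>tuples k. f x = f (map Not x)}"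

definition \<P> :: "bfun set" where
  "\<P> = {(k, f) \<in> \<B>. \<forall>x\<in>tuples k. 0 \<le> fourier k f x}"

definition \<P>\<N> :: "bfun set" where
  "\<P>\<N> = {(k, f) \<in> \<B>. \<forall>x\<in>tuples k.
      (even (hweight x) \<longrightarrow> 0 \<le> fourier k f x) \<and> (odd (hweight x) \<longrightarrow> fourier k f x \<le> 0)}"

definition \<S>\<D>\<P> :: "bfun set" where
  "\<S>\<D>\<P> = \<S>\<D> \<inter> \<P> \<inter> \<P>\<N>"

definition \<M> :: "bfun set" where
  "\<M> = {(k, f) \<in> \<B>. match_implemented k (fourier k f)}"

definition \<E> :: "bfun set" where
  "\<E> = {(k, \<lambda>x\<in>tuples k. c * f x) | k c f. 0 \<le> c \<and> (k, f) \<in> \<B> \<and> even_implemented k (fourier k f)}"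

definition \<I>_ferro :: "bfun set" where
  "\<I>_ferro = omega_closure ({ising 2 lam | lam. 0 \<le> lam \<and> lam \<le> 1} \<union> nullary)"

definition \<I>_anti :: "bfun set" where
  "\<I>_anti = omega_closure ({ising 2 lam | lam. 1 \<le> lam} \<union> nullary)"

definition \<H>_ferro :: "bfun set" where
  "\<H>_ferro = omega_closure ({ising k lam | k lam. 2 \<le> k \<and> 0 \<le> lam \<and> lam \<le> 1} \<union> nullary)"

abbreviation \<M>_omega :: "bfun set" where
  "\<M>_omega \<equiv> omega_closure \<M>"


section \<open>The lattice of omega-clones\<close>

lemma finite_tuples [simp]: "finite (tuples k)"
  using finite_lists_length_eq [of "UNIV :: bool set" k] by (simp add: tuples_def)

lemma closed_under_ops_Inter:
  assumes "\<And>C. C \<in> \<C> \<Longrightarrow> closed_under_ops C"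
  shows "closed_under_ops (\<Inter>\<C>)"
  using assms unfolding closed_under_ops_def by blast

lemma is_limit_mono: "is_limit F k f \<Longrightarrow> F \<subseteq> G \<Longrightarrow> is_limit G k f"
  unfolding is_limit_def by (meson order_trans)

lemma closed_under_limits_Inter:
  assumes "\<And>C. C \<in> \<C> \<Longrightarrow> closed_under_limits C"
  shows "closed_under_limits (\<Inter>\<C>)"
  using assms unfolding closed_under_limits_def
  by (meson InterI Inter_lower is_limit_mono)

lemma closed_under_ops_B: "closed_under_ops \<B>"
  unfolding closed_under_ops_def
proof (intro conjI ballI allI impI)
  fix g assume "g \<in> \<B>"
  then show "add_fictitious g \<in> \<B>"
    by (cases g) (auto simp: \<B>_def \<B>\<^sub>a_def tuples_def PiE_iff extensional_def)
next
  fix k f \<pi> assume "(k, f) \<in> \<B> \<and> \<pi> permutes {..<k}"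
  then show "permute_args \<pi> (k, f) \<in> \<B>"
    by (auto simp: \<B>_def \<B>\<^sub>a_def tuples_def PiE_iff extensional_def)
next
  fix k f g assume "(k, f) \<in> \<B> \<and> (k, g) \<in> \<B>"
  then show "(k, \<lambda>x\<in>tuples k. f x * g x) \<in> \<B>"
    by (auto simp: \<B>_def \<B>\<^sub>a_def tuples_def PiE_iff extensional_def)
next
  fix k f assume "(Suc k, f) \<in> \<B>"
  then show "sum_last k f \<in> \<B>"
    by (auto simp: sum_last_def UNIV_bool \<B>_def \<B>\<^sub>a_def tuples_def PiE_iff extensional_def)
qed

lemma closed_under_limits_B: "closed_under_limits \<B>"
  by (auto simp: closed_under_limits_def \<B>_def)

lemma EQ_in_B: "EQ \<in> \<B>"
  by (auto simp: EQ_def \<B>_def \<B>\<^sub>a_def tuples_def PiE_iff)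

lemma omega_closure_closed:
  "closed_under_ops (omega_closure F) \<and> closed_under_limits (omega_closure F)"
  unfolding omega_closure_def
  by (rule hull_in) (auto intro: closed_under_ops_Inter closed_under_limits_Inter)

lemma omega_closure_subset_B: "F \<subseteq> \<B> \<Longrightarrow> omega_closure F \<subseteq> \<B>"
  unfolding omega_closure_def
  by (rule hull_minimal) (auto simp: EQ_in_B closed_under_ops_B closed_under_limits_B)

lemma subset_omega_closure: "insert EQ F \<subseteq> omega_closure F"
  unfolding omega_closure_def by (rule hull_subset)

lemma omega_closure_minimal:
  "EQ \<in> G \<Longrightarrow> F \<subseteq> G \<Longrightarrow> closed_under_ops G \<Longrightarrow> closed_under_limits G \<Longrightarrow> omega_closure F \<subseteq> G"
  unfolding omega_closure_def by (rule hull_minimal) auto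

lemma omega_clone_iff:
  "omega_clone F \<longleftrightarrow> F \<subseteq> \<B> \<and> EQ \<in> F \<and> closed_under_ops F \<and> closed_under_limits F"
proof
  assume F: "omega_clone F"
  then have "omega_closure F = F" by (simp add: omega_clone_def)
  then show "F \<subseteq> \<B> \<and> EQ \<in> F \<and> closed_under_ops F \<and> closed_under_limits F"
    using F omega_closure_closed [of F] subset_omega_closure [of F] by (auto simp: omega_clone_def)
next
  assume "F \<subseteq> \<B> \<and> EQ \<in> F \<and> closed_under_ops F \<and> closed_under_limits F"
  then show "omega_clone F"
    using omega_closure_minimal [of F F] subset_omega_closure [of F] by (auto simp: omega_clone_def)
qed

lemma omega_clone_omega_closure: "F \<subseteq> \<B> \<Longrightarrow> omega_clone (omega_closure F)"
  using omega_closure_closed [of F] subset_omega_closure [of F] omega_closure_subset_B [of F]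
  by (auto simp: omega_clone_iff)

lemma omega_join_lub:
  assumes "omega_clone F" "omega_clone G"
  shows "omega_clone (omega_join F G)" "F \<subseteq> omega_join F G" "G \<subseteq> omega_join F G"
    and "omega_clone C \<Longrightarrow> F \<subseteq> C \<Longrightarrow> G \<subseteq> C \<Longrightarrow> omega_join F G \<subseteq> C"
  using assms omega_clone_omega_closure [of "F \<union> G"] subset_omega_closure [of "F \<union> G"]
    omega_closure_minimal [of C "F \<union> G"]
  by (auto simp: omega_join_def omega_clone_iff)

lemma omega_meet_glb:
  assumes "omega_clone F" "omega_clone G"
  shows "omega_clone (omega_meet F G)" "omega_meet F G \<subseteq> F" "omega_meet F G \<subseteq> G"
    and "C \<subseteq> F \<Longrightarrow> C \<subseteq> G \<Longrightarrow> C \<subseteq> omega_meet F G"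
  using assms closed_under_ops_Inter [of "{F, G}"] closed_under_limits_Inter [of "{F, G}"]
  by (auto simp: omega_meet_def omega_clone_iff)

end

theory Submission
  imports Defs "HOL-Library.Complex_Order"
begin

text \<open>A \<open>k\<close>-ary function is handled as a function of assignments \<open>nat \<Rightarrow> bool\<close> that depends only on
  the first \<open>k\<close> values.  Functions with non-negative Fourier coefficients are the cone spanned by the
  characters, which is closed under products and under summing out a variable; this gives that
  \<open>\<P>\<close> and \<open>\<P>\<N>\<close> are omega-clones.  The two non-inclusions between \<open>\<M>_omega\<close> and \<open>\<H>_ferro\<close> come from two
  further omega-clones.  Log-supermodular functions contain \<open>\<H>_ferro\<close> but not the match-circuit
  function \<open>2 + (s\<^sub>0 + s\<^sub>1) s\<^sub>2\<close>.  For the other direction, \<open>f(s) f(s')\<close> is viewed as a function on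
  \<open>(\<int>/4)\<^sup>k\<close> by the Gray code \<open>(s\<^sub>i, s\<^sub>i') \<mapsto> (s\<^sub>i + \<i> s\<^sub>i') exp (- \<i> \<pi> / 4) / \<surd>2\<close> of pairs of spins,
  as in Ginibre's inequality for the plane rotator; all match-circuit functions have non-negative
  Fourier coefficients there, but the 4-ary hypergraph Ising function with \<open>\<lambda> = 1/2\<close> violates the
  Lebowitz inequality, which is one of these sign conditions.  Limits are only needed in the form
  \<open>h\<^sup>m \<longlonglongrightarrow> [h = 1]\<close> for \<open>0 \<le> h \<le> 1\<close>: this produces hard constraints from soft ones, in particular
  disequality, and with it the generation of \<open>\<S>\<D>\<close> and the maximality statements.\<close>

section \<open>Functions of assignments\<close>

text \<open>A limit is taken inside the clone of finitely many functions, so it cannot draw on ever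
  new Ising parameters. The powers of one function do stay in the clone which that function
  generates; hence every hard constraint is obtained from a single function normalised to maximum 1.
  For the invariants the finiteness is harmless: they are equations and non-strict inequalities,
  preserved by every pointwise limit.

  Maximality follows one pattern. A function outside the smaller clone has a witness: complementary
  tuples with different values, or a negative Fourier sum. Coupling it to one or two new variables
  and summing out the rest turns the witness into a bias of these variables, whose powers pin them.
  An arbitrary target function is then the restriction of a member of the smaller clone to the
  pinned setting; where Fourier signs matter, the other settings carry large point masses.

  A match-circuit asks for degree exactly one, which is not a parity condition. One spin per vertex,
  which encodes parity, is therefore replaced by one spin per half-edge: every vertex contributes a
  linear form and every edge a ferromagnetic factor, and on pairs of spins both lie in the
  cone.\<close>

definition asg :: "nat \<Rightarrow> (bool list \<Rightarrow> real) \<Rightarrow> (nat \<Rightarrow> bool) \<Rightarrow> real" where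
  "asg k f s = f (map s [0..<k])"

lemma map_upt_in_tuples [simp]: "map s [0..<k] \<in> tuples k"
  by (simp add: tuples_def)

lemma map_nth_tuples: "x \<in> tuples k \<Longrightarrow> map ((!) x) [0..<k] = x"
  by (simp add: tuples_def list_eq_iff_nth_eq)

lemma asg_nth: "x \<in> tuples k \<Longrightarrow> asg k f ((!) x) = f x"
  by (simp add: asg_def map_nth_tuples)

lemma asg_cong: "(\<And>i. i < k \<Longrightarrow> s i = t i) \<Longrightarrow> asg k f s = asg k f t"
  unfolding asg_def by (rule arg_cong [where f = f]) simp

lemma asg_restrict: "asg k (\<lambda>x\<in>tuples k. f x) = asg k f"
  by (simp add: asg_def fun_eq_iff)

lemma asg_fictitious: "asg (Suc k) (\<lambda>x\<in>tuples (Suc k). f (butlast x)) = asg k f"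
  by (simp only: asg_restrict) (simp add: asg_def fun_eq_iff)

lemma permute_list_map_upt:
  assumes "\<pi> permutes {..<k}"
  shows "permute_list \<pi> (map s [0..<k]) = map (s \<circ> \<pi>) [0..<k]"
  using assms permutes_in_image [OF assms] by (auto simp: list_eq_iff_nth_eq permute_list_nth)

lemma asg_permute:
  "\<pi> permutes {..<k} \<Longrightarrow> asg k (\<lambda>x\<in>tuples k. f (permute_list \<pi> x)) = (\<lambda>s. asg k f (s \<circ> \<pi>))"
  by (simp only: asg_restrict) (simp add: asg_def fun_eq_iff permute_list_map_upt)

lemma asg_mult: "asg k (\<lambda>x\<in>tuples k. f x * g x) = (\<lambda>s. asg k f s * asg k g s)"
  by (simp only: asg_restrict) (simp add: asg_def fun_eq_iff)

lemma map_upd_upt: "map (s(k := b)) [0..<Suc k] = map s [0..<k] @ [b]"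
  by (simp add: list_eq_iff_nth_eq nth_append)

lemma asg_sum_last:
  "asg k (snd (sum_last k f)) = (\<lambda>s. \<Sum>b\<in>UNIV. asg (Suc k) f (s(k := b)))"
  by (simp only: sum_last_def snd_conv asg_restrict) (simp add: asg_def fun_eq_iff map_upd_upt del: upt_Suc)

lemma asg_EQ: "asg 2 (snd EQ) s = of_bool (s 0 = s 1)"
  by (simp add: EQ_def asg_restrict) (simp add: asg_def numeral_2_eq_2)

lemma asg_inj:
  assumes "f \<in> \<B>\<^sub>a k" "g \<in> \<B>\<^sub>a k" "asg k f = asg k g"
  shows "f = g"
proof
  fix x show "f x = g x"
  proof (cases "x \<in> tuples k")
    case True
    with assms(3) show ?thesis by (metis asg_nth)
  next
    case False
    with assms(1,2) show ?thesis by (simp add: \<B>\<^sub>a_def PiE_iff extensional_def)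
  qed
qed

lemma asg_nonneg: "f \<in> \<B>\<^sub>a k \<Longrightarrow> 0 \<le> asg k f s"
  by (auto simp: asg_def \<B>\<^sub>a_def PiE_iff)

lemma tuples_nonempty [simp]: "tuples k \<noteq> {}"
  using map_upt_in_tuples by blast

section \<open>Criteria for omega-clones\<close>

lemma functional_clone_subset:
  "closed_under_ops C \<Longrightarrow> EQ \<in> C \<Longrightarrow> S \<subseteq> C \<Longrightarrow> functional_clone S \<subseteq> C"
  unfolding functional_clone_def by (rule hull_minimal) auto

text \<open>An approximation from the clone of a finite subset is in particular a member of
  \<open>C\<close>. The finite set can thus be forgotten, and sequences of arbitrary members are all
  that an invariant has to handle.\<close>

lemma closed_under_limitsI:
  assumes ops: "closed_under_ops C" and eq: "EQ \<in> C"
    and lim: "\<And>k f g. f \<in> \<B>\<^sub>a k \<Longrightarrow> (\<And>n. (k, g n) \<in> C) \<Longrightarrow>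
      (\<And>x. x \<in> tuples k \<Longrightarrow> (\<lambda>n. g n x) \<longlonglongrightarrow> f x) \<Longrightarrow> (k, f) \<in> C"
  shows "closed_under_limits C"
  unfolding closed_under_limits_def
proof (intro allI ballI impI)
  fix k f assume f: "f \<in> \<B>\<^sub>a k" and "is_limit C k f"
  then obtain S where S: "S \<subseteq> C"
    and ap: "\<forall>\<epsilon>>0. \<exists>g. (k, g) \<in> functional_clone S \<and> (MAX x\<in>tuples k. \<bar>f x - g x\<bar>) < \<epsilon>"
    unfolding is_limit_def by blast
  have "\<forall>n. \<exists>g. (k, g) \<in> functional_clone S \<and> (MAX x\<in>tuples k. \<bar>f x - g x\<bar>) < 1 / real (Suc n)"
    using ap by simp
  then obtain g where g: "\<And>n. (k, g n) \<in> functional_clone S"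
    and le: "\<And>n. (MAX x\<in>tuples k. \<bar>f x - g n x\<bar>) < 1 / real (Suc n)"
    by metis
  show "(k, f) \<in> C"
  proof (rule lim [OF f])
    show "(k, g n) \<in> C" for n using g functional_clone_subset [OF ops eq S] by blast
    fix x assume x: "x \<in> tuples k"
    have "\<bar>f x - g n x\<bar> < 1 / real (Suc n)" for n
      using le [of n] x by (subst (asm) Max_less_iff) auto
    then have "norm (g n x - f x) \<le> norm (1 / real (Suc n)) * 1" for n
      by (simp add: abs_minus_commute less_imp_le del: of_nat_Suc)
    then have "(\<lambda>n. g n x - f x) \<longlonglongrightarrow> 0"
      by (intro tendsto_0_le [OF LIMSEQ_Suc [OF lim_1_over_n]] eventuallyI)
    then show "(\<lambda>n. g n x) \<longlonglongrightarrow> f x" by (simp add: LIM_zero_iff)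
  qed
qed

text \<open>For generation the finite set \<open>S\<close> must be fixed before the approximations,
  as \<open>is_limit\<close> demands. Finiteness of the set of tuples turns pointwise into uniform
  convergence.\<close>

lemma in_omega_clone_limit:
  assumes "omega_clone C" "finite S" "S \<subseteq> C" "\<And>n. (k, g n) \<in> functional_clone S"
    and f: "f \<in> \<B>\<^sub>a k" and lim: "\<And>x. x \<in> tuples k \<Longrightarrow> (\<lambda>n. g n x) \<longlonglongrightarrow> f x"
  shows "(k, f) \<in> C"
proof -
  have "is_limit C k f"
    unfolding is_limit_def
  proof (intro exI [of _ S] conjI allI impI)
    fix \<epsilon> :: real assume "0 < \<epsilon>"
    have "\<forall>x\<in>tuples k. \<forall>\<^sub>F n in sequentially. \<bar>f x - g n x\<bar> < \<epsilon>"
    proof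
      fix x assume "x \<in> tuples k"
      from tendstoD [OF lim [OF this] \<open>0 < \<epsilon>\<close>]
      show "\<forall>\<^sub>F n in sequentially. \<bar>f x - g n x\<bar> < \<epsilon>"
        by (simp add: dist_real_def abs_minus_commute)
    qed
    then have "\<forall>\<^sub>F n in sequentially. \<forall>x\<in>tuples k. \<bar>f x - g n x\<bar> < \<epsilon>"
      by (simp add: eventually_ball_finite)
    then obtain n where "\<forall>x\<in>tuples k. \<bar>f x - g n x\<bar> < \<epsilon>"
      using eventually_happens'[OF sequentially_bot] by blast
    then have "(MAX x\<in>tuples k. \<bar>f x - g n x\<bar>) < \<epsilon>"
      by (subst Max_less_iff) auto
    with assms(4) show "\<exists>g. (k, g) \<in> functional_clone S \<and> (MAX x\<in>tuples k. \<bar>f x - g x\<bar>) < \<epsilon>"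
      by blast
  qed (use assms in auto)
  with assms(1) f show ?thesis
    unfolding omega_clone_iff closed_under_limits_def by blast
qed

text \<open>On functions of assignments a fictitious argument changes nothing but the bound
  \<open>k\<close>; this is what makes the closure conditions below short.\<close>

definition asg_class :: "(nat \<Rightarrow> ((nat \<Rightarrow> bool) \<Rightarrow> real) \<Rightarrow> bool) \<Rightarrow> bfun set" where
  "asg_class Q = {(k, f) \<in> \<B>. Q k (asg k f)}"

lemma omega_clone_asg_class:
  assumes fict: "\<And>k F. Q k F \<Longrightarrow> Q (Suc k) F"
    and perm: "\<And>k F \<pi>. Q k F \<Longrightarrow> \<pi> permutes {..<k} \<Longrightarrow> Q k (\<lambda>s. F (s \<circ> \<pi>))"
    and mult: "\<And>k F G. Q k F \<Longrightarrow> Q k G \<Longrightarrow> (\<And>s. 0 \<le> F s) \<Longrightarrow> (\<And>s. 0 \<le> G s) \<Longrightarrow> Q k (\<lambda>s. F s * G s)"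
    and sum: "\<And>k F. Q (Suc k) F \<Longrightarrow> (\<And>s. 0 \<le> F s) \<Longrightarrow> Q k (\<lambda>s. \<Sum>b\<in>UNIV. F (s(k := b)))"
    and eq: "Q 2 (\<lambda>s. of_bool (s 0 = s 1))"
    and lim: "\<And>k F G. (\<And>n. Q k (F n)) \<Longrightarrow> (\<And>s. (\<lambda>n. F n s) \<longlonglongrightarrow> G s) \<Longrightarrow> Q k G"
  shows "omega_clone (asg_class Q)"
proof -
  have B: "(k, f) \<in> \<B> \<longleftrightarrow> f \<in> \<B>\<^sub>a k" for k f by (simp add: \<B>_def)
  have EQ: "EQ \<in> asg_class Q"
  proof -
    have "EQ = (2, snd EQ)" by (simp add: EQ_def)
    moreover have "asg 2 (snd EQ) = (\<lambda>s. of_bool (s 0 = s 1))" by (simp add: fun_eq_iff asg_EQ)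
    ultimately show ?thesis using EQ_in_B eq unfolding asg_class_def by (metis (mono_tags, lifting) case_prodI mem_Collect_eq)
  qed
  have ops: "closed_under_ops (asg_class Q)"
    unfolding closed_under_ops_def
  proof (intro conjI ballI allI impI)
    fix g assume g: "g \<in> asg_class Q"
    obtain k f where kf: "g = (k, f)" by (cases g)
    have "add_fictitious g \<in> \<B>"
      using closed_under_ops_B g by (auto simp: asg_class_def closed_under_ops_def)
    with g show "add_fictitious g \<in> asg_class Q"
      by (auto simp: asg_class_def kf asg_fictitious intro: fict)
  next
    fix k f \<pi> assume a: "(k, f) \<in> asg_class Q \<and> \<pi> permutes {..<k}"
    then have "permute_args \<pi> (k, f) \<in> \<B>"
      using closed_under_ops_B unfolding asg_class_def closed_under_ops_def by blast
    with a show "permute_args \<pi> (k, f) \<in> asg_class Q"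
      by (auto simp: asg_class_def asg_permute intro: perm)
  next
    fix k f g assume a: "(k, f) \<in> asg_class Q \<and> (k, g) \<in> asg_class Q"
    then have "(k, \<lambda>x\<in>tuples k. f x * g x) \<in> \<B>"
      using closed_under_ops_B unfolding asg_class_def closed_under_ops_def by blast
    with a show "(k, \<lambda>x\<in>tuples k. f x * g x) \<in> asg_class Q"
      by (auto simp: asg_class_def asg_mult B asg_nonneg intro: mult)
  next
    fix k f assume a: "(Suc k, f) \<in> asg_class Q"
    then have "sum_last k f \<in> \<B>"
      using closed_under_ops_B unfolding asg_class_def closed_under_ops_def by blast
    moreover have "Q k (asg k (snd (sum_last k f)))"
      using a by (auto simp: asg_class_def asg_sum_last B asg_nonneg intro: sum)
    ultimately show "sum_last k f \<in> asg_class Q"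
      by (auto simp: asg_class_def sum_last_def)
  qed
  have "closed_under_limits (asg_class Q)"
  proof (rule closed_under_limitsI [OF ops EQ])
    fix k f g
    assume f: "f \<in> \<B>\<^sub>a k" and g: "\<And>n. (k, g n) \<in> asg_class Q"
      and l: "\<And>x. x \<in> tuples k \<Longrightarrow> (\<lambda>n. g n x) \<longlonglongrightarrow> f x"
    have "Q k (asg k f)"
    proof (rule lim)
      show "Q k (asg k (g n))" for n using g by (simp add: asg_class_def)
      show "(\<lambda>n. asg k (g n) s) \<longlonglongrightarrow> asg k f s" for s
        by (simp add: asg_def l)
    qed
    with f show "(k, f) \<in> asg_class Q" by (simp add: asg_class_def B)
  qed
  with EQ ops show ?thesis by (auto simp: omega_clone_iff asg_class_def)
qed

section \<open>A calculus of expressions over an omega-clone\<close>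

definition expressible :: "bfun set \<Rightarrow> nat \<Rightarrow> ((nat \<Rightarrow> bool) \<Rightarrow> real) \<Rightarrow> bool" where
  "expressible C k F \<longleftrightarrow> (\<exists>f. (k, f) \<in> C \<and> asg k f = F)"

lemma expressibleI: "(k, f) \<in> C \<Longrightarrow> expressible C k (asg k f)"
  by (auto simp: expressible_def)

lemma expressibleD:
  assumes "expressible C k (asg k f)" "C \<subseteq> \<B>" "f \<in> \<B>\<^sub>a k"
  shows "(k, f) \<in> C"
proof -
  obtain g where "(k, g) \<in> C" "asg k g = asg k f" using assms by (auto simp: expressible_def)
  moreover from this assms have "g = f" by (intro asg_inj) (auto simp: \<B>_def)
  ultimately show ?thesis by simp
qed

lemma expressible_depends:
  "expressible C k F \<Longrightarrow> (\<And>i. i < k \<Longrightarrow> s i = t i) \<Longrightarrow> F s = F t"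
  by (auto simp: expressible_def intro: asg_cong)

lemma tuple_fun_in_B:
  "(\<And>x. x \<in> tuples k \<Longrightarrow> 0 \<le> f x) \<Longrightarrow> (\<lambda>x\<in>tuples k. f x) \<in> \<B>\<^sub>a k"
  by (auto simp: \<B>\<^sub>a_def)

context
  fixes C :: "bfun set"
  assumes C: "closed_under_ops C" "EQ \<in> C"
begin

lemma expressible_mult:
  assumes "expressible C k F" "expressible C k G"
  shows "expressible C k (\<lambda>s. F s * G s)"
proof -
  obtain f g where fg: "(k, f) \<in> C" "asg k f = F" "(k, g) \<in> C" "asg k g = G"
    using assms by (auto simp: expressible_def)
  with C have "(k, \<lambda>x\<in>tuples k. f x * g x) \<in> C"
    unfolding closed_under_ops_def by blast
  from expressibleI [OF this] show ?thesis by (simp only: asg_mult fg)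
qed

lemma expressible_fictitious:
  assumes "expressible C k F" shows "expressible C (Suc k) F"
proof -
  obtain f where f: "(k, f) \<in> C" "asg k f = F"
    using assms by (auto simp: expressible_def)
  with C have "add_fictitious (k, f) \<in> C"
    unfolding closed_under_ops_def by blast
  then have "(Suc k, \<lambda>x\<in>tuples (Suc k). f (butlast x)) \<in> C" by simp
  from expressibleI [OF this] show ?thesis by (simp only: asg_fictitious f)
qed

lemma expressible_mono: "expressible C k F \<Longrightarrow> k \<le> n \<Longrightarrow> expressible C n F"
  by (induction n rule: nat_induct) (auto simp: le_Suc_eq intro: expressible_fictitious)

lemma expressible_permute:
  assumes "expressible C k F" "\<pi> permutes {..<k}"
  shows "expressible C k (\<lambda>s. F (s \<circ> \<pi>))"
proof -
  obtain f where f: "(k, f) \<in> C" "asg k f = F"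
    using assms by (auto simp: expressible_def)
  with C assms have "permute_args \<pi> (k, f) \<in> C"
    unfolding closed_under_ops_def by blast
  then have "(k, \<lambda>x\<in>tuples k. f (permute_list \<pi> x)) \<in> C" by simp
  from expressibleI [OF this] show ?thesis by (simp only: asg_permute [OF assms(2)] f)
qed

lemma expressible_sum_last:
  assumes "expressible C (Suc k) F"
  shows "expressible C k (\<lambda>s. \<Sum>b\<in>UNIV. F (s(k := b)))"
proof -
  obtain f where f: "(Suc k, f) \<in> C" "asg (Suc k) f = F"
    using assms by (auto simp: expressible_def)
  then have "sum_last k f \<in> C" using C by (auto simp: closed_under_ops_def)
  then have "(k, snd (sum_last k f)) \<in> C" by (simp add: sum_last_def)
  then show ?thesis
    unfolding f(2) [symmetric] asg_sum_last [symmetric] by (rule expressibleI)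
qed

lemma expressible_EQ:
  assumes "i < n" "j < n" "i \<noteq> j"
  shows "expressible C n (\<lambda>s. of_bool (s i = s j))"
proof -
  have "expressible C 2 (asg 2 (snd EQ))"
    using C by (intro expressibleI) (simp add: EQ_def)
  then have "expressible C 2 (\<lambda>s. of_bool (s 0 = s 1))"
    by (simp add: asg_EQ [abs_def] cong: if_cong)
  then have *: "expressible C n (\<lambda>s. of_bool (s 0 = s 1))"
    by (rule expressible_mono) (use assms in arith)
  \<comment> \<open>Sends 0 to \<open>i\<close> and 1 to \<open>j\<close>: the inner transposition
    moves 1 to the place that \<open>transpose 0 i\<close> carries to \<open>j\<close>. It fixes 0,
    since that place is 0 only if \<open>i = j\<close>.\<close>
  define \<pi> where "\<pi> = Transposition.transpose 0 i \<circ> Transposition.transpose 1 (Transposition.transpose 0 i j)"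
  have "1 < n" using assms by arith
  then have "\<pi> permutes {..<n}"
    using assms unfolding \<pi>_def
    by (intro permutes_compose permutes_swap_id) (auto simp: transpose_def)
  moreover have "\<pi> 0 = i" "\<pi> 1 = j"
    using assms by (auto simp: \<pi>_def transpose_def)
  ultimately show ?thesis
    using expressible_permute [OF *, of \<pi>] by simp
qed

text \<open>The function is moved to fresh arguments, which are then identified with the new ones by \<open>EQ\<close>
  and summed out.\<close>

lemma expressible_rename:
  assumes F: "expressible C m F" and \<sigma>: "\<And>i. i < m \<Longrightarrow> \<sigma> i < n"
  shows "expressible C n (\<lambda>s. F (\<lambda>i. s (\<sigma> i)))"
proof -
  \<comment> \<open>Exchanges the block of the first \<open>m\<close> positions with the following
    \<open>n\<close>, so that \<open>F\<close> reads the positions from \<open>n\<close> on and the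
    first \<open>n\<close> become free.\<close>
  define \<pi> where "\<pi> = (\<lambda>i. if i < m then n + i else if i < n + m then i - m else i)"
  have "bij_betw \<pi> {..<n + m} {..<n + m}"
    by (intro bij_betwI [where g = "\<lambda>i. if i < n then i + m else i - n"]) (auto simp: \<pi>_def)
  then have "\<pi> permutes {..<n + m}"
    by (rule bij_imp_permutes) (auto simp: \<pi>_def)
  then have "expressible C (n + m) (\<lambda>s. F (s \<circ> \<pi>))"
    using expressible_mono [OF F, of "n + m"] by (intro expressible_permute) auto
  also have "\<dots> = (\<lambda>s. F (\<lambda>i. if i < m then s (n + i) else s (\<sigma> i)))"
    by (intro ext expressible_depends [OF F]) (auto simp: \<pi>_def)
  finally have start: "expressible C (n + m) (\<lambda>s. F (\<lambda>i. if i < m then s (n + i) else s (\<sigma> i)))" .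
  \<comment> \<open>Descending induction from \<open>m\<close>: arguments below \<open>l\<close>
    still read fresh positions, the others are already identified with their targets and summed
    out.\<close>
  have "expressible C (n + l) (\<lambda>s. F (\<lambda>i. if i < l then s (n + i) else s (\<sigma> i)))" if "l \<le> m" for l
    using that
  proof (induction rule: inc_induct)
    case base
    show ?case by (rule start)
  next
    case (step l)
    let ?G = "\<lambda>s. F (\<lambda>i. if i < Suc l then s (n + i) else s (\<sigma> i))"
    have lt: "\<sigma> l < n" using step \<sigma> by auto
    then have "expressible C (Suc (n + l)) (\<lambda>s. of_bool (s (n + l) = s (\<sigma> l)))"
      by (intro expressible_EQ) auto
    then have "expressible C (n + l) (\<lambda>s. \<Sum>b\<in>UNIV. ?G (s(n + l := b)) *
        of_bool ((s(n + l := b)) (n + l) = (s(n + l := b)) (\<sigma> l)))"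
      using step.IH by (intro expressible_sum_last expressible_mult) auto
    moreover have "(\<Sum>b\<in>UNIV. ?G (s(n + l := b)) *
        of_bool ((s(n + l := b)) (n + l) = (s(n + l := b)) (\<sigma> l))) =
        F (\<lambda>i. if i < l then s (n + i) else s (\<sigma> i))" for s
    proof -
      have "(\<Sum>b\<in>UNIV. ?G (s(n + l := b)) *
          of_bool ((s(n + l := b)) (n + l) = (s(n + l := b)) (\<sigma> l))) = ?G (s(n + l := s (\<sigma> l)))"
        using lt by (auto simp: UNIV_bool)
      also have "\<dots> = F (\<lambda>i. if i < l then s (n + i) else s (\<sigma> i))"
      proof (rule expressible_depends [OF F])
        fix i assume "i < m"
        then have "\<sigma> i < n" by (rule \<sigma>)
        then show "(if i < Suc l then (s(n + l := s (\<sigma> l))) (n + i) else (s(n + l := s (\<sigma> l))) (\<sigma> i)) =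
            (if i < l then s (n + i) else s (\<sigma> i))"
          by (auto simp: less_Suc_eq)
      qed
      finally show ?thesis .
    qed
    ultimately show ?case by simp
  qed
  from this [of 0] show ?thesis by simp
qed

lemma expressible_sum_many:
  assumes "expressible C (k + n) F"
  shows "expressible C k (\<lambda>s. \<Sum>t\<in>{..<n} \<rightarrow>\<^sub>E UNIV. F (\<lambda>i. if i < k then s i else t (i - k)))"
  using assms
proof (induction n arbitrary: F)
  case 0
  \<comment> \<open>The only extensional function on the empty set is \<open>undefined\<close>
    everywhere; \<open>F\<close> does not read these positions.\<close>
  have "F (\<lambda>i. if i < k then s i else undefined) = F s" for s
    using 0 by (intro expressible_depends [of C k F]) auto
  with 0 show ?case unfolding lessThan_0 PiE_empty_domain by (simp split del: if_split)
next
  case (Suc n)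
  have dep: "F s = F t" if "\<And>i. i < Suc (k + n) \<Longrightarrow> s i = t i" for s t
    using Suc.prems that by (intro expressible_depends [of C "Suc (k + n)" F]) auto
  have "expressible C (k + n) (\<lambda>s. \<Sum>b\<in>UNIV. F (s(k + n := b)))"
    using Suc.prems by (intro expressible_sum_last) simp
  from Suc.IH [OF this] have "expressible C k (\<lambda>s. \<Sum>t\<in>{..<n} \<rightarrow>\<^sub>E UNIV. \<Sum>b\<in>UNIV.
      F ((\<lambda>i. if i < k then s i else t (i - k))(k + n := b)))" .
  moreover have "(\<Sum>t\<in>{..<n} \<rightarrow>\<^sub>E UNIV. \<Sum>b\<in>UNIV. F ((\<lambda>i. if i < k then s i else t (i - k))(k + n := b))) =
      (\<Sum>t\<in>{..<Suc n} \<rightarrow>\<^sub>E UNIV. F (\<lambda>i. if i < k then s i else t (i - k)))" for s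
  proof -
    have "(\<Sum>t\<in>{..<Suc n} \<rightarrow>\<^sub>E UNIV. F (\<lambda>i. if i < k then s i else t (i - k))) =
        (\<Sum>(b, t)\<in>UNIV \<times> ({..<n} \<rightarrow>\<^sub>E UNIV). F (\<lambda>i. if i < k then s i else (t(n := b)) (i - k)))"
      unfolding lessThan_Suc PiE_insert_eq
      by (subst sum.reindex [OF inj_combinator]) (simp_all add: comp_def case_prod_unfold split del: if_split)
    also have "\<dots> = (\<Sum>t\<in>{..<n} \<rightarrow>\<^sub>E UNIV. \<Sum>b\<in>UNIV. F (\<lambda>i. if i < k then s i else (t(n := b)) (i - k)))"
      by (simp only: sum.cartesian_product [symmetric]) (rule sum.swap)
    also have "\<dots> = (\<Sum>t\<in>{..<n} \<rightarrow>\<^sub>E UNIV. \<Sum>b\<in>UNIV. F ((\<lambda>i. if i < k then s i else t (i - k))(k + n := b)))"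
    proof (rule sum.cong [OF refl], rule sum.cong [OF refl], rule dep)
      fix t b i assume "i < Suc (k + n)"
      then show "(if i < k then s i else (t(n := b)) (i - k)) = ((\<lambda>i. if i < k then s i else t (i - k))(k + n := b)) i"
        by (cases "i = k + n") auto
    qed
    finally show ?thesis ..
  qed
  ultimately show ?case by (simp only:)
qed

end

section \<open>Functions with non-negative Fourier coefficients\<close>

text \<open>Generating the cone, rather than defining it by the signs of coefficients, makes closure
  under products and renaming a direct induction; \<open>pos_def_iff\<close> recovers the
  coefficients. In the order on complex numbers, \<open>0 \<le> c\<close> includes that
  \<open>c\<close> is real.\<close>

inductive_set pos_def :: "('a \<Rightarrow> complex) \<Rightarrow> 'v set \<Rightarrow> (('v \<Rightarrow> 'a) \<Rightarrow> complex) set"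
  for \<zeta> :: "'a \<Rightarrow> complex" and V :: "'v set" where
  pos_def_const: "0 \<le> c \<Longrightarrow> (\<lambda>x. c) \<in> pos_def \<zeta> V"
| pos_def_add: "F \<in> pos_def \<zeta> V \<Longrightarrow> G \<in> pos_def \<zeta> V \<Longrightarrow> (\<lambda>x. F x + G x) \<in> pos_def \<zeta> V"
| pos_def_gen_mult: "v \<in> V \<Longrightarrow> F \<in> pos_def \<zeta> V \<Longrightarrow> (\<lambda>x. \<zeta> (x v) * F x) \<in> pos_def \<zeta> V"

lemma pos_def_scale: "F \<in> pos_def \<zeta> V \<Longrightarrow> 0 \<le> c \<Longrightarrow> (\<lambda>x. c * F x) \<in> pos_def \<zeta> V"
proof (induction rule: pos_def.induct)
  case (pos_def_const d)
  then show ?case by (auto intro!: pos_def.pos_def_const mult_nonneg_nonneg)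
next
  case (pos_def_add F G)
  then show ?case by (simp add: distrib_left pos_def.pos_def_add)
next
  case (pos_def_gen_mult v F)
  then show ?case using pos_def.pos_def_gen_mult [of v V "\<lambda>x. c * F x" \<zeta>] by (simp add: ac_simps)
qed

lemma pos_def_mult: "F \<in> pos_def \<zeta> V \<Longrightarrow> G \<in> pos_def \<zeta> V \<Longrightarrow> (\<lambda>x. F x * G x) \<in> pos_def \<zeta> V"
proof (induction rule: pos_def.induct)
  case (pos_def_const d)
  then show ?case by (intro pos_def_scale)
next
  case (pos_def_add F G)
  then show ?case by (simp add: distrib_right pos_def.pos_def_add)
next
  case (pos_def_gen_mult v F)
  then show ?case using pos_def.pos_def_gen_mult [of v V "\<lambda>x. F x * G x" \<zeta>] by (simp add: ac_simps)
qed

lemma pos_def_gen: "v \<in> V \<Longrightarrow> (\<lambda>x. \<zeta> (x v)) \<in> pos_def \<zeta> V"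
  using pos_def_gen_mult [of v V "\<lambda>_. 1" \<zeta>] pos_def_const [of 1 \<zeta> V] by (simp add: less_eq_complex_def)

lemma pos_def_power: "F \<in> pos_def \<zeta> V \<Longrightarrow> (\<lambda>x. F x ^ n) \<in> pos_def \<zeta> V"
  by (induction n) (auto intro: pos_def_mult pos_def_const simp: less_eq_complex_def)

lemma pos_def_sum: "(\<And>i. i \<in> I \<Longrightarrow> F i \<in> pos_def \<zeta> V) \<Longrightarrow> (\<lambda>x. \<Sum>i\<in>I. F i x) \<in> pos_def \<zeta> V"
  by (induction I rule: infinite_finite_induct) (auto intro: pos_def_add pos_def_const)

lemma pos_def_prod: "(\<And>i. i \<in> I \<Longrightarrow> F i \<in> pos_def \<zeta> V) \<Longrightarrow> (\<lambda>x. \<Prod>i\<in>I. F i x) \<in> pos_def \<zeta> V"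
  by (induction I rule: infinite_finite_induct)
    (auto intro: pos_def_mult pos_def_const simp: less_eq_complex_def)

lemma pos_def_rename:
  "F \<in> pos_def \<zeta> V \<Longrightarrow> \<phi> ` V \<subseteq> U \<Longrightarrow> (\<lambda>x. F (\<lambda>v. x (\<phi> v))) \<in> pos_def \<zeta> U"
proof (induction rule: pos_def.induct)
  case (pos_def_gen_mult v F)
  then have "(\<lambda>x. \<zeta> (x (\<phi> v)) * F (\<lambda>v. x (\<phi> v))) \<in> pos_def \<zeta> U"
    by (intro pos_def.pos_def_gen_mult) auto
  then show ?case .
qed (auto intro: pos_def.intros)

lemma pos_def_mono: "F \<in> pos_def \<zeta> V \<Longrightarrow> V \<subseteq> U \<Longrightarrow> F \<in> pos_def \<zeta> U"
  using pos_def_rename [of F \<zeta> V "\<lambda>v. v" U] by simp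

lemma pos_def_depends:
  "F \<in> pos_def \<zeta> V \<Longrightarrow> (\<And>v. v \<in> V \<Longrightarrow> x v = y v) \<Longrightarrow> F x = F y"
  by (induction rule: pos_def.induct) auto

section \<open>Characters and Fourier inversion over a finite alphabet\<close>

definition character :: "('a \<Rightarrow> complex) \<Rightarrow> 'v set \<Rightarrow> ('v \<Rightarrow> nat) \<Rightarrow> ('v \<Rightarrow> 'a) \<Rightarrow> complex" where
  "character \<zeta> V n x = (\<Prod>v\<in>V. \<zeta> (x v) ^ n v)"

lemma pos_def_character: "character \<zeta> V n \<in> pos_def \<zeta> V"
  unfolding character_def by (intro pos_def_prod pos_def_power pos_def_gen)

lemma character_upd:
  assumes "finite V" "v \<in> V"
  shows "\<zeta> (x v) * character \<zeta> V n x = character \<zeta> V (n(v := Suc (n v))) x"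
proof -
  have "character \<zeta> V n x = \<zeta> (x v) ^ n v * character \<zeta> (V - {v}) n x" for n
    using assms unfolding character_def by (rule prod.remove)
  moreover have "character \<zeta> (V - {v}) (n(v := Suc (n v))) x = character \<zeta> (V - {v}) n x"
    by (auto simp: character_def)
  ultimately show ?thesis by simp
qed

text \<open>An alphabet identified with the \<open>N\<close>-th roots of unity.
  \<open>sum_power\<close> reflects that a character sums to \<open>N\<close> or 0 over the group
  and is what summing out a variable needs; \<open>orthogonal\<close> gives inversion; by
  \<open>cnj_eq\<close> conjugate characters are again products of generators. The instances are
  single spins (\<open>N = 2\<close>) and pairs of spins (\<open>N = 4\<close>).\<close>

locale dual_alphabet =
  fixes \<zeta> :: "'a :: finite \<Rightarrow> complex" and N :: nat
  assumes N_pos: "0 < N"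
    and sum_power: "0 \<le> (\<Sum>a\<in>UNIV. \<zeta> a ^ j)"
    and orthogonal: "(\<Sum>j<N. (\<zeta> a * cnj (\<zeta> b)) ^ j) = (if a = b then of_nat N else 0)"
    and cnj_eq: "cnj (\<zeta> a) = \<zeta> a ^ (N - 1)"
begin

lemma pos_def_sum_out:
  assumes "F \<in> pos_def \<zeta> (insert v V)" "v \<notin> V"
  shows "(\<lambda>x. \<Sum>a\<in>UNIV. F (x(v := a))) \<in> pos_def \<zeta> V"
proof -
  \<comment> \<open>The factor \<open>\<zeta> a ^ j\<close> collects the generators at the removed
    variable that the induction pulls off \<open>F\<close>.\<close>
  have "(\<lambda>x. \<Sum>a\<in>UNIV. \<zeta> a ^ j * F (x(v := a))) \<in> pos_def \<zeta> V" for j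
    using assms(1)
  proof (induction arbitrary: j rule: pos_def.induct)
    case (pos_def_const c)
    have "0 \<le> (\<Sum>a\<in>UNIV. \<zeta> a ^ j) * c" using sum_power pos_def_const by (rule mult_nonneg_nonneg)
    then show ?case by (simp add: sum_distrib_right pos_def.pos_def_const)
  next
    case (pos_def_add F G)
    then show ?case by (simp add: distrib_left sum.distrib pos_def.pos_def_add)
  next
    case (pos_def_gen_mult u F)
    show ?case
    proof (cases "u = v")
      case True
      then show ?thesis using pos_def_gen_mult.IH [of "Suc j"] by (simp add: ac_simps)
    next
      case False
      then have "(\<lambda>x. \<zeta> (x u) * (\<Sum>a\<in>UNIV. \<zeta> a ^ j * F (x(v := a)))) \<in> pos_def \<zeta> V"
        using pos_def_gen_mult.hyps(1) by (intro pos_def.pos_def_gen_mult pos_def_gen_mult.IH) auto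
      with False show ?thesis by (simp add: sum_distrib_left ac_simps fun_upd_def)
    qed
  qed
  from this [of 0] show ?thesis by simp
qed

text \<open>A generator pulled off \<open>F\<close> raises one exponent of the character, so the
  induction needs all \<open>n\<close> at once. Conjugates need not be written: they occur among the
  exponents.\<close>

lemma pos_def_fourier:
  assumes "F \<in> pos_def \<zeta> V" "finite V"
  shows "0 \<le> (\<Sum>x\<in>V \<rightarrow>\<^sub>E UNIV. F x * character \<zeta> V n x)"
  using assms(1)
proof (induction arbitrary: n rule: pos_def.induct)
  case (pos_def_const c)
  have "(\<Sum>x\<in>V \<rightarrow>\<^sub>E UNIV. character \<zeta> V n x) = (\<Prod>v\<in>V. \<Sum>a\<in>UNIV. \<zeta> a ^ n v)"
    unfolding character_def using assms(2) by (subst prod_sum_PiE) auto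
  moreover have "0 \<le> (\<Prod>v\<in>U. \<Sum>a\<in>UNIV. \<zeta> a ^ n v)" for U
  proof (induction U rule: infinite_finite_induct)
    case (insert u U)
    then show ?case by (simp add: mult_nonneg_nonneg sum_power)
  qed (simp_all add: less_eq_complex_def)
  ultimately show ?case
    using pos_def_const by (simp flip: sum_distrib_left) 
next
  case (pos_def_add F G)
  then show ?case by (simp add: distrib_right sum.distrib)
next
  case (pos_def_gen_mult v F)
  have "\<zeta> (x v) * F x * character \<zeta> V n x = F x * character \<zeta> V (n(v := Suc (n v))) x" for x
    unfolding character_upd [OF assms(2) pos_def_gen_mult.hyps(1), symmetric] by (simp add: ac_simps)
  then show ?case using pos_def_gen_mult.IH [of "n(v := Suc (n v))"] by (simp only:)
qed

text \<open>The exponents \<open>(N - 1) * n\<close> are those of the conjugate character.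
  Exchanging the sums leaves one orthogonality relation per variable, and their product selects the
  assignment that agrees with \<open>x\<close> on \<open>V\<close>.\<close>

lemma fourier_inversion:
  assumes "finite V" and dep: "\<And>x y. (\<And>v. v \<in> V \<Longrightarrow> x v = y v) \<Longrightarrow> F x = (F y :: complex)"
  shows "F x = (\<Sum>n\<in>V \<rightarrow>\<^sub>E {..<N}. (\<Sum>y\<in>V \<rightarrow>\<^sub>E UNIV. F y * character \<zeta> V n y) *
    character \<zeta> V (\<lambda>v. (N - 1) * n v) x) / of_nat N ^ card V"
proof -
  have N: "of_nat N ^ card V \<noteq> (0 :: complex)" using N_pos by simp
  have ch: "character \<zeta> V n y * character \<zeta> V (\<lambda>v. (N - 1) * n v) x =
      (\<Prod>v\<in>V. (\<zeta> (y v) * cnj (\<zeta> (x v))) ^ n v)" for n y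
    unfolding character_def cnj_eq by (simp add: prod.distrib power_mult_distrib power_mult)
  have "(\<Sum>n\<in>V \<rightarrow>\<^sub>E {..<N}. (\<Sum>y\<in>V \<rightarrow>\<^sub>E UNIV. F y * character \<zeta> V n y) * character \<zeta> V (\<lambda>v. (N - 1) * n v) x)
    = (\<Sum>y\<in>V \<rightarrow>\<^sub>E UNIV. F y * (\<Sum>n\<in>V \<rightarrow>\<^sub>E {..<N}. character \<zeta> V n y * character \<zeta> V (\<lambda>v. (N - 1) * n v) x))"
    by (simp add: sum_distrib_right sum_distrib_left mult.assoc) (rule sum.swap)
  also have "\<dots> = (\<Sum>y\<in>V \<rightarrow>\<^sub>E UNIV. F y * (\<Prod>v\<in>V. if y v = x v then of_nat N else 0))"
    unfolding ch by (subst prod_sum_PiE [symmetric]) (auto simp: assms(1) orthogonal)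
  also have "\<dots> = (\<Sum>y\<in>V \<rightarrow>\<^sub>E UNIV. if y = restrict x V then F x * of_nat N ^ card V else 0)"
  proof (rule sum.cong [OF refl])
    fix y :: "'b \<Rightarrow> 'a" assume y: "y \<in> V \<rightarrow>\<^sub>E UNIV"
    show "F y * (\<Prod>v\<in>V. if y v = x v then of_nat N else 0) =
        (if y = restrict x V then F x * of_nat N ^ card V else 0)"
    proof (cases "\<forall>v\<in>V. y v = x v")
      case True
      then have "y = restrict x V" using y by (auto simp: fun_eq_iff PiE_iff extensional_def)
      moreover have "F y = F x" using True by (intro dep) auto
      ultimately show ?thesis by simp
    next
      case False
      then have "(\<Prod>v\<in>V. if y v = x v then of_nat N else 0) = (0 :: complex)"
        using assms(1) by (auto intro!: prod_zero)
      moreover have "y \<noteq> restrict x V" using False by auto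
      ultimately show ?thesis by simp
    qed
  qed
  also have "\<dots> = F x * of_nat N ^ card V"
    using assms(1) by (subst sum.delta) (auto simp: finite_PiE)
  finally show ?thesis using N by simp
qed

lemma pos_def_iff:
  assumes "finite V"
  shows "F \<in> pos_def \<zeta> V \<longleftrightarrow> (\<forall>x y. (\<forall>v\<in>V. x v = y v) \<longrightarrow> F x = F y) \<and>
    (\<forall>n. 0 \<le> (\<Sum>x\<in>V \<rightarrow>\<^sub>E UNIV. F x * character \<zeta> V n x))" (is "_ \<longleftrightarrow> ?D \<and> ?P")
proof
  assume F: "F \<in> pos_def \<zeta> V"
  show "?D \<and> ?P"
  proof (intro conjI allI impI)
    show "F x = F y" if "\<forall>v\<in>V. x v = y v" for x y using pos_def_depends [OF F] that by blast
  qed (rule pos_def_fourier [OF F assms])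
next
  assume a: "?D \<and> ?P"
  have "F = (\<lambda>x. (1 / of_nat N ^ card V) * (\<Sum>n\<in>V \<rightarrow>\<^sub>E {..<N}. (\<Sum>y\<in>V \<rightarrow>\<^sub>E UNIV. F y * character \<zeta> V n y) *
    character \<zeta> V (\<lambda>v. (N - 1) * n v) x))"
  proof
    fix x
    have dep: "F x = F y" if "\<And>v. v \<in> V \<Longrightarrow> x v = y v" for x y using a that by blast
    show "F x = (1 / of_nat N ^ card V) * (\<Sum>n\<in>V \<rightarrow>\<^sub>E {..<N}. (\<Sum>y\<in>V \<rightarrow>\<^sub>E UNIV. F y * character \<zeta> V n y) *
        character \<zeta> V (\<lambda>v. (N - 1) * n v) x)"
      unfolding times_divide_eq_left mult_1 by (rule fourier_inversion [OF assms]) (rule dep)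
  qed
  moreover have "\<dots> \<in> pos_def \<zeta> V"
  proof (intro pos_def_scale pos_def_sum pos_def_character)
    have "1 / of_nat N ^ card V = complex_of_real (1 / real N ^ card V)" by simp
    then show "0 \<le> 1 / complex_of_nat N ^ card V" by (simp only: less_eq_complex_def) simp
  qed (use a in auto)
  ultimately show "F \<in> pos_def \<zeta> V" by simp
qed

text \<open>The cone is closed because \<open>pos_def_iff\<close> describes it by non-strict
  conditions on finite sums of values, each continuous under pointwise limits.\<close>

lemma pos_def_limit:
  assumes "finite V" "\<And>n. F n \<in> pos_def \<zeta> V" and lim: "\<And>x. (\<lambda>n. F n x) \<longlonglongrightarrow> G x"
  shows "G \<in> pos_def \<zeta> V"
  unfolding pos_def_iff [OF assms(1)]
proof (intro conjI allI impI)
  fix x y :: "'b \<Rightarrow> 'a" assume "\<forall>v\<in>V. x v = y v"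
  then have "F n x = F n y" for n using pos_def_depends [OF assms(2)] by blast
  then show "G x = G y" using lim [of x] lim [of y] by (simp add: LIMSEQ_unique)
next
  fix m
  let ?S = "\<lambda>F. \<Sum>x\<in>V \<rightarrow>\<^sub>E UNIV. F x * character \<zeta> V m x"
  have l: "(\<lambda>n. ?S (F n)) \<longlonglongrightarrow> ?S G" by (intro tendsto_intros lim)
  have "0 \<le> ?S (F n)" for n using pos_def_fourier assms by blast
  then have p: "0 \<le> Re (?S (F n))" "Im (?S (F n)) = 0" for n
    by (auto simp only: less_eq_complex_def zero_complex.sel)
  have "0 \<le> Re (?S G)"
    using tendsto_Re [OF l] by (rule LIMSEQ_le_const) (use p in auto)
  moreover have "Im (?S G) = 0"
    using tendsto_Im [OF l] by (simp only: p(2)) (simp add: LIMSEQ_const_iff)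
  ultimately show "0 \<le> ?S G" by (simp only: less_eq_complex_def zero_complex.sel)
qed

end

definition bool_spin :: "bool \<Rightarrow> complex" where
  "bool_spin b = (if b then -1 else 1)"

interpretation spin: dual_alphabet bool_spin 2
proof
  show "0 \<le> (\<Sum>a\<in>UNIV. bool_spin a ^ j)" for j
    by (cases "even j") (auto simp: bool_spin_def UNIV_bool less_eq_complex_def)
qed (auto simp: bool_spin_def eval_nat_numeral)

text \<open>The Gray code identifies pairs of Boolean values with the fourth roots of unity; exchanging
  the two components is complex conjugation.\<close>

definition gray :: "bool \<times> bool \<Rightarrow> complex" where
  "gray p = (if fst p then if snd p then -1 else \<i> else if snd p then - \<i> else 1)"

lemma UNIV_bool_pair: "(UNIV :: (bool \<times> bool) set) = {(False, False), (False, True), (True, False), (True, True)}"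
  by auto

interpretation gray: dual_alphabet gray 4
proof
  fix j :: nat
  have "\<i> ^ j + (- \<i>) ^ j + (- 1) ^ j + 1 \<ge> 0"
  proof -
    \<comment> \<open>The sum is 4 if 4 divides \<open>j\<close> and 0 otherwise, so the residue
      decides.\<close>
    define r where "r = j mod 4"
    have j: "j = r + 4 * (j div 4)" by (simp add: r_def)
    have "\<i> ^ j = \<i> ^ r" "(- \<i>) ^ j = (- \<i>) ^ r" "(-1 :: complex) ^ j = (-1) ^ r"
      by (subst j, simp add: power_add power_mult)+
    moreover have "r < 4" by (simp add: r_def)
    then have "r = 0 \<or> r = 1 \<or> r = 2 \<or> r = 3" by arith
    ultimately show ?thesis by (auto simp: less_eq_complex_def eval_nat_numeral)
  qed
  then show "0 \<le> (\<Sum>a\<in>UNIV. gray a ^ j)"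
    by (simp add: UNIV_bool_pair gray_def ac_simps)
qed (auto simp: gray_def eval_nat_numeral)

section \<open>The omega-clones defined by conditions on functions\<close>

lemma bij_betw_assignments_tuples:
  "bij_betw (\<lambda>s. map s [0..<k]) ({..<k} \<rightarrow>\<^sub>E UNIV) (tuples k)"
proof (rule bij_betw_byWitness [where f' = "\<lambda>x. restrict ((!) x) {..<k}"])
  show "\<forall>x\<in>tuples k. map (restrict ((!) x) {..<k}) [0..<k] = x"
    by (auto simp: tuples_def intro!: nth_equalityI)
  show "\<forall>s\<in>{..<k} \<rightarrow>\<^sub>E (UNIV :: bool set). restrict ((!) (map s [0..<k])) {..<k} = s"
  proof
    fix s :: "nat \<Rightarrow> bool" assume "s \<in> {..<k} \<rightarrow>\<^sub>E UNIV"
    then show "restrict ((!) (map s [0..<k])) {..<k} = s"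
      by (intro PiE_ext [of _ "{..<k}" "\<lambda>_. UNIV"]) auto
  qed
qed (simp_all add: image_subset_iff)

lemma sum_tuples: "(\<Sum>x\<in>tuples k. g x) = (\<Sum>s\<in>{..<k} \<rightarrow>\<^sub>E UNIV. g (map s [0..<k]))"
  by (rule sum.reindex_bij_betw [OF bij_betw_assignments_tuples, symmetric])

lemma minus_one_power_hweight:
  "(- 1 :: 'a :: comm_ring_1) ^ hweight b = (\<Prod>i<length b. if b ! i then - 1 else 1)"
proof (induction b)
  case (Cons a b)
  then show ?case unfolding length_Cons prod.lessThan_Suc_shift by (simp add: hweight_def)
qed (simp add: hweight_def)

text \<open>Spins square to 1, so a character depends only on the parities of its exponents; the
  tuple of parities is the argument of the transform.\<close>

lemma fourier_character:
  "complex_of_real (fourier k f (map (\<lambda>i. odd (n i)) [0..<k])) =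
     (\<Sum>s\<in>{..<k} \<rightarrow>\<^sub>E UNIV. of_real (asg k f s) * character bool_spin {..<k} n s) / 2 ^ k"
proof -
  have "(- 1 :: real) ^ hweight (map2 (\<and>) (map s [0..<k]) (map (\<lambda>i. odd (n i)) [0..<k])) =
      (\<Prod>i<k. if s i \<and> odd (n i) then - 1 else 1)" for s
    by (simp add: minus_one_power_hweight)
  moreover have "complex_of_real (\<Prod>i<k. if s i \<and> odd (n i) then - 1 else 1) = character bool_spin {..<k} n s" for s
    unfolding character_def of_real_prod by (rule prod.cong) (auto simp: bool_spin_def)
  ultimately show ?thesis
    unfolding fourier_def sum_tuples
    by (simp add: asg_def ac_simps del: of_real_prod)
qed

lemma bool_spin_neq: "bool_spin (b \<noteq> t) = bool_spin b * bool_spin t"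
  by (auto simp: bool_spin_def)

lemma of_bool_eq_spin: "of_bool (a = b) = (1 + bool_spin a * bool_spin b) / 2"
  by (auto simp: bool_spin_def)

lemma character_flip:
  "character bool_spin {..<k} n (\<lambda>i. s i \<noteq> t) = (if t then (- 1) ^ (\<Sum>i<k. n i) else 1) * character bool_spin {..<k} n s"
  unfolding character_def bool_spin_neq power_mult_distrib prod.distrib power_sum
  by (cases t) (simp_all add: bool_spin_def)

lemma minus_one_power_hweight_odd:
  "(- 1 :: 'a :: comm_ring_1) ^ hweight (map (\<lambda>i. odd (n i)) [0..<k]) = (- 1) ^ (\<Sum>i<k. n i)"
  unfolding minus_one_power_hweight power_sum by (auto intro!: prod.cong)

lemma sum_assignments_flip:
  fixes g :: "(nat \<Rightarrow> bool) \<Rightarrow> 'a :: comm_monoid_add"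
  assumes "\<And>s t. (\<And>i. i < k \<Longrightarrow> s i = t i) \<Longrightarrow> g s = g t"
  shows "(\<Sum>s\<in>{..<k} \<rightarrow>\<^sub>E (UNIV :: bool set). g (\<lambda>i. s i \<noteq> t)) = (\<Sum>s\<in>{..<k} \<rightarrow>\<^sub>E UNIV. g s)"
proof (rule sum.reindex_bij_witness [where i = "\<lambda>s. restrict (\<lambda>i. s i \<noteq> t) {..<k}" and j = "\<lambda>s. restrict (\<lambda>i. s i \<noteq> t) {..<k}"])
  fix s :: "nat \<Rightarrow> bool" assume s: "s \<in> {..<k} \<rightarrow>\<^sub>E UNIV"
  show "(\<lambda>i\<in>{..<k}. (\<lambda>i\<in>{..<k}. s i \<noteq> t) i \<noteq> t) = s"
    using s by (intro PiE_ext [of _ "{..<k}" "\<lambda>_. UNIV"]) auto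
  then show "(\<lambda>i\<in>{..<k}. (\<lambda>i\<in>{..<k}. s i \<noteq> t) i \<noteq> t) = s" .
  show "g (\<lambda>i\<in>{..<k}. s i \<noteq> t) = g (\<lambda>i. s i \<noteq> t)"
    by (rule assms) simp
qed simp_all

lemma sum_flip_character:
  "(\<Sum>s\<in>{..<k} \<rightarrow>\<^sub>E UNIV. of_real (asg k f (\<lambda>i. s i \<noteq> t)) * character bool_spin {..<k} n s) =
     of_real (2 ^ k * (if t then (- 1) ^ (\<Sum>i<k. n i) else 1) * fourier k f (map (\<lambda>i. odd (n i)) [0..<k]))"
proof -
  let ?c = "(if t then (- 1) ^ (\<Sum>i<k. n i) else 1) :: complex"
  let ?g = "\<lambda>s. of_real (asg k f s) * character bool_spin {..<k} n (\<lambda>i. s i \<noteq> t)"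
  have "(\<Sum>s\<in>{..<k} \<rightarrow>\<^sub>E UNIV. of_real (asg k f (\<lambda>i. s i \<noteq> t)) * character bool_spin {..<k} n s) =
      (\<Sum>s\<in>{..<k} \<rightarrow>\<^sub>E UNIV. ?g (\<lambda>i. s i \<noteq> t))"
    by (intro sum.cong refl arg_cong2 [where f = "(*)"] arg_cong [where f = "character bool_spin {..<k} n"]) auto
  also have "\<dots> = (\<Sum>s\<in>{..<k} \<rightarrow>\<^sub>E UNIV. ?g s)"
    by (rule sum_assignments_flip) (auto simp: character_def intro!: arg_cong2 [where f = "(*)"] asg_cong prod.cong)
  also have "\<dots> = ?c * (\<Sum>s\<in>{..<k} \<rightarrow>\<^sub>E UNIV. of_real (asg k f s) * character bool_spin {..<k} n s)"
    unfolding character_flip sum_distrib_left by (simp add: ac_simps)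
  finally show ?thesis
    using fourier_character [of k f n] by (simp add: field_simps split: if_splits)
qed

section \<open>P and PN as one family of omega-clones\<close>

abbreviation flipped_pos_def :: "bool \<Rightarrow> nat \<Rightarrow> ((nat \<Rightarrow> bool) \<Rightarrow> real) \<Rightarrow> bool" where
  "flipped_pos_def t k F \<equiv> (\<lambda>s. of_real (F (\<lambda>i. s i \<noteq> t))) \<in> pos_def bool_spin {..<k}"

text \<open>Complementing all arguments multiplies the Fourier coefficient at \<open>x\<close> by -1
  to the power \<open>hweight x\<close>. So \<open>\<P>\<N>\<close> is \<open>\<P>\<close> seen
  through the global flip, and \<open>t\<close> treats both at once, up to maximality.\<close>

definition flipped_P :: "bool \<Rightarrow> bfun set" where
  "flipped_P t = asg_class (flipped_pos_def t)"

lemma in_flipped_P_iff: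
  "(k, f) \<in> flipped_P t \<longleftrightarrow> (k, f) \<in> \<B> \<and>
    (\<forall>x\<in>tuples k. 0 \<le> (if t then (- 1) ^ hweight x else 1) * fourier k f x)"
proof -
  let ?v = "\<lambda>x. (if t then (- 1) ^ hweight x else 1) * fourier k f x"
  have dep: "\<forall>x y. (\<forall>v\<in>{..<k}. x v = y v) \<longrightarrow>
      complex_of_real (asg k f (\<lambda>i. x i \<noteq> t)) = of_real (asg k f (\<lambda>i. y i \<noteq> t))"
    by (auto intro!: asg_cong)
  have r: "0 \<le> complex_of_real (2 ^ k * a * b) \<longleftrightarrow> 0 \<le> a * b" for a b
    by (simp add: less_eq_complex_def mult.assoc zero_le_mult_iff [of "2 ^ k"] not_le [THEN iffD2])
  have *: "(0 \<le> (\<Sum>s\<in>{..<k} \<rightarrow>\<^sub>E UNIV. of_real (asg k f (\<lambda>i. s i \<noteq> t)) * character bool_spin {..<k} n s)) \<longleftrightarrow>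
      0 \<le> ?v (map (\<lambda>i. odd (n i)) [0..<k])" for n
    unfolding sum_flip_character minus_one_power_hweight_odd r ..
  have "(\<forall>n :: nat \<Rightarrow> nat. 0 \<le> ?v (map (\<lambda>i. odd (n i)) [0..<k]))
    \<longleftrightarrow> (\<forall>x\<in>tuples k. 0 \<le> ?v x)" (is "?L \<longleftrightarrow> ?R")
  proof
    assume L: ?L
    show ?R
    proof
      fix x :: "bool list" assume x: "x \<in> tuples k"
      have m: "map (\<lambda>i. odd (of_bool (x ! i) :: nat)) [0..<k] = x"
        using map_nth_tuples [OF x] by simp
      with L [rule_format, of "\<lambda>i. of_bool (x ! i)"]
      show "0 \<le> ?v x" by (simp only: m)
    qed
  qed simp
  then have "(\<lambda>s. of_real (asg k f (\<lambda>i. s i \<noteq> t))) \<in> pos_def bool_spin {..<k} \<longleftrightarrow>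
      (\<forall>x\<in>tuples k. 0 \<le> ?v x)"
    using dep unfolding spin.pos_def_iff [OF finite_lessThan] * by blast
  then show ?thesis unfolding flipped_P_def asg_class_def mem_Collect_eq case_prod_conv by (rule conj_cong [OF refl])
qed

lemma P_eq: "\<P> = flipped_P False"
  using in_flipped_P_iff [of _ _ False] by (auto simp: \<P>_def)

lemma PN_eq: "\<P>\<N> = flipped_P True"
proof -
  have "(even (hweight x) \<longrightarrow> 0 \<le> fourier k f x) \<and> (odd (hweight x) \<longrightarrow> fourier k f x \<le> 0) \<longleftrightarrow>
      0 \<le> (if True then (- 1) ^ hweight x else 1) * fourier k f x" for k f x
    by (cases "even (hweight x)") auto
  then show ?thesis
    using in_flipped_P_iff [of _ _ True] unfolding \<P>\<N>_def by auto
qed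

lemma half_nonneg: "0 \<le> (1 / 2 :: complex)"
  by (simp add: less_eq_complex_def)

lemma pos_def_spin_eq:
  assumes "i \<in> V" "j \<in> V"
  shows "(\<lambda>s. of_bool (s i = s j)) \<in> pos_def bool_spin V"
proof -
  have "(\<lambda>s. 1/2 * (1 + bool_spin (s i) * bool_spin (s j))) \<in> pos_def bool_spin V"
    using assms
    by (intro pos_def_scale pos_def_add pos_def_mult pos_def_gen pos_def_const half_nonneg)
      (simp_all add: less_eq_complex_def)
  then show ?thesis by (simp add: of_bool_eq_spin)
qed

lemma omega_clone_flipped_P: "omega_clone (flipped_P t)"
  unfolding flipped_P_def
proof (rule omega_clone_asg_class)
  fix k and F :: "(nat \<Rightarrow> bool) \<Rightarrow> real"
  assume "flipped_pos_def t k F"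
  then show "flipped_pos_def t (Suc k) F"
    by (rule pos_def_mono) auto
next
  fix k \<pi> and F :: "(nat \<Rightarrow> bool) \<Rightarrow> real"
  assume "flipped_pos_def t k F" "\<pi> permutes {..<k}"
  then show "flipped_pos_def t k (\<lambda>s. F (s \<circ> \<pi>))"
    using pos_def_rename [of "\<lambda>s. complex_of_real (F (\<lambda>i. s i \<noteq> t))" bool_spin "{..<k}" \<pi> "{..<k}"]
    by (simp add: permutes_image comp_def)
next
  fix k and F G :: "(nat \<Rightarrow> bool) \<Rightarrow> real"
  assume "flipped_pos_def t k F"
    "flipped_pos_def t k G"
  from pos_def_mult [OF this]
  show "flipped_pos_def t k (\<lambda>s. F s * G s)" by simp
next
  fix k and F :: "(nat \<Rightarrow> bool) \<Rightarrow> real"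
  assume "flipped_pos_def t (Suc k) F"
  then have "(\<lambda>s. \<Sum>b\<in>UNIV. complex_of_real (F (\<lambda>i. (s(k := b)) i \<noteq> t))) \<in> pos_def bool_spin {..<k}"
    by (intro spin.pos_def_sum_out) (auto simp: lessThan_Suc)
  moreover have "(\<Sum>b\<in>UNIV. complex_of_real (F (\<lambda>i. (s(k := b)) i \<noteq> t))) =
      of_real (\<Sum>b\<in>UNIV. F ((\<lambda>i. s i \<noteq> t)(k := b)))" for s
  proof -
    \<comment> \<open>The flip merely exchanges the two summands of the sum over the last
      argument.\<close>
    have "(\<lambda>i. (s(k := b)) i \<noteq> t) = (\<lambda>i. s i \<noteq> t)(k := b \<noteq> t)" for b
      by (simp add: fun_eq_iff)
    then show ?thesis by (cases t) (simp_all add: UNIV_bool ac_simps)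
  qed
  ultimately show "flipped_pos_def t k (\<lambda>s. \<Sum>b\<in>UNIV. F (s(k := b)))"
    by simp
next
  have "(\<lambda>s. of_bool (s 0 = s 1)) \<in> pos_def bool_spin {..<2::nat}"
    by (rule pos_def_spin_eq) auto
  moreover have "((s 0 \<noteq> t) = (s 1 \<noteq> t)) = (s 0 = s 1)" for s :: "nat \<Rightarrow> bool" by auto
  ultimately show "(\<lambda>s. complex_of_real (of_bool ((s 0 \<noteq> t) = (s 1 \<noteq> t)))) \<in> pos_def bool_spin {..<2::nat}"
    by (simp only: of_bool_def of_real_1 of_real_0 if_distrib [of complex_of_real])
next
  fix k and F :: "nat \<Rightarrow> (nat \<Rightarrow> bool) \<Rightarrow> real" and G
  assume F: "\<And>n. flipped_pos_def t k (F n)"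
    and l: "\<And>s. (\<lambda>n. F n s) \<longlonglongrightarrow> G s"
  show "flipped_pos_def t k G"
  proof (rule spin.pos_def_limit [OF _ F])
    show "(\<lambda>n. complex_of_real (F n (\<lambda>i. s i \<noteq> t))) \<longlonglongrightarrow> complex_of_real (G (\<lambda>i. s i \<noteq> t))" for s
      by (intro tendsto_of_real l)
  qed simp
qed

section \<open>Self-duality as an invariant\<close>

lemma SD_eq: "\<S>\<D> = asg_class (\<lambda>k F. \<forall>s. F s = F (\<lambda>i. \<not> s i))"
proof -
  have neg: "f (map Not (map s [0..<k])) = asg k f (\<lambda>i. \<not> s i)" for k f s
    unfolding asg_def map_map comp_def ..
  have "(\<forall>x\<in>tuples k. f x = f (map Not x)) \<longleftrightarrow> (\<forall>s. asg k f s = asg k f (\<lambda>i. \<not> s i))" for k f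
  proof
    assume a: "\<forall>x\<in>tuples k. f x = f (map Not x)"
    show "\<forall>s. asg k f s = asg k f (\<lambda>i. \<not> s i)"
    proof
      fix s show "asg k f s = asg k f (\<lambda>i. \<not> s i)"
        using a [rule_format, OF map_upt_in_tuples [of s]] unfolding neg by (simp only: asg_def)
    qed
  next
    assume a: "\<forall>s. asg k f s = asg k f (\<lambda>i. \<not> s i)"
    show "\<forall>x\<in>tuples k. f x = f (map Not x)"
    proof
      fix x :: "bool list" assume x: "x \<in> tuples k"
      show "f x = f (map Not x)"
        using a [rule_format, of "(!) x"] unfolding neg [symmetric] asg_nth [OF x] map_nth_tuples [OF x] .
    qed
  qed
  then show ?thesis unfolding \<S>\<D>_def asg_class_def by (simp only:)
qed

lemma omega_clone_SD: "omega_clone \<S>\<D>"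
  unfolding SD_eq
proof (rule omega_clone_asg_class)
  fix k \<pi> and F :: "(nat \<Rightarrow> bool) \<Rightarrow> real"
  assume F: "\<forall>s. F s = F (\<lambda>i. \<not> s i)"
  show "\<forall>s. F (s \<circ> \<pi>) = F ((\<lambda>i. \<not> s i) \<circ> \<pi>)"
    using F by (auto simp: comp_def)
  have eq: "F (s(k := b)) = F ((\<lambda>i. \<not> s i)(k := \<not> b))" for s b
    using F [rule_format, of "s(k := b)"] by (simp add: fun_upd_def if_distrib [of Not])
  show "\<forall>s. (\<Sum>b\<in>UNIV. F (s(k := b))) = (\<Sum>b\<in>UNIV. F ((\<lambda>i. \<not> s i)(k := b)))"
  proof (intro allI)
    fix s
    show "(\<Sum>b\<in>UNIV. F (s(k := b))) = (\<Sum>b\<in>UNIV. F ((\<lambda>i. \<not> s i)(k := b)))"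
      using eq [of s False] eq [of s True] by (simp add: UNIV_bool add.commute)
  qed
next
  fix F :: "nat \<Rightarrow> (nat \<Rightarrow> bool) \<Rightarrow> real" and G assume F: "\<And>n. \<forall>s. F n s = F n (\<lambda>i. \<not> s i)" and l: "\<And>s. (\<lambda>n. F n s :: real) \<longlonglongrightarrow> G s"
  show "\<forall>s. G s = G (\<lambda>i. \<not> s i)"
  proof
    fix s
    have "(\<lambda>n. F n s) \<longlonglongrightarrow> G (\<lambda>i. \<not> s i)" by (subst F) (rule l)
    then show "G s = G (\<lambda>i. \<not> s i)" using l LIMSEQ_unique by blast
  qed
next
  fix F G :: "(nat \<Rightarrow> bool) \<Rightarrow> real"
  assume "\<forall>s. F s = F (\<lambda>i. \<not> s i)" "\<forall>s. G s = G (\<lambda>i. \<not> s i)"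
  then show "\<forall>s. F s * G s = F (\<lambda>i. \<not> s i) * G (\<lambda>i. \<not> s i)" by metis
qed auto

section \<open>The two-copy invariant\<close>

definition two_copy :: "((nat \<Rightarrow> bool) \<Rightarrow> real) \<Rightarrow> (nat \<Rightarrow> bool \<times> bool) \<Rightarrow> complex" where
  "two_copy F x = of_real (F (\<lambda>i. fst (x i)) * F (\<lambda>i. snd (x i)))"

text \<open>An omega-clone that contains the match-circuit functions but not all hypergraph Ising
  functions.  Non-negativity of the Fourier coefficient at \<open>(1,1,1,1)\<close> of \<open>f(s)f(s')\<close> is the Lebowitz
  inequality for four spins.\<close>

definition \<W> :: "bfun set" where
  "\<W> = asg_class (\<lambda>k F. two_copy F \<in> pos_def gray {..<k})"

text \<open>For u = \<open>gray (x i)\<close> and v = \<open>gray (x j)\<close> the cube is the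
  conjugate, and the generating expression is 2 Re (u cnj v). The rotation by -pi/4 cancels, which
  leaves the inner product of the two pairs of spins.\<close>

lemma pos_def_gray_dot:
  assumes "i \<in> V" "j \<in> V"
  shows "(\<lambda>x. bool_spin (fst (x i)) * bool_spin (fst (x j)) + bool_spin (snd (x i)) * bool_spin (snd (x j)))
    \<in> pos_def gray V"
proof -
  have "(\<lambda>x. gray (x i) * gray (x j) ^ 3 + gray (x i) ^ 3 * gray (x j)) \<in> pos_def gray V" (is "?H \<in> _")
    using assms by (intro pos_def_add pos_def_mult pos_def_power pos_def_gen)
  also have "?H =
      (\<lambda>x. bool_spin (fst (x i)) * bool_spin (fst (x j)) + bool_spin (snd (x i)) * bool_spin (snd (x j)))"
    by (auto simp: fun_eq_iff gray_def bool_spin_def power3_eq_cube)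
  finally show ?thesis .
qed

text \<open>This is 2 Re (u v). The two rotations by -pi/4 add up and turn the real part of the
  product of the unrotated pairs into its imaginary part, the sum of mixed products.\<close>

lemma pos_def_gray_cross:
  assumes "i \<in> V" "j \<in> V"
  shows "(\<lambda>x. bool_spin (fst (x i)) * bool_spin (snd (x j)) + bool_spin (snd (x i)) * bool_spin (fst (x j)))
    \<in> pos_def gray V"
proof -
  have "(\<lambda>x. gray (x i) * gray (x j) + gray (x i) ^ 3 * gray (x j) ^ 3) \<in> pos_def gray V" (is "?H \<in> _")
    using assms by (intro pos_def_add pos_def_mult pos_def_power pos_def_gen)
  also have "?H =
      (\<lambda>x. bool_spin (fst (x i)) * bool_spin (snd (x j)) + bool_spin (snd (x i)) * bool_spin (fst (x j)))"
    by (auto simp: fun_eq_iff gray_def bool_spin_def power3_eq_cube)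
  finally show ?thesis .
qed

lemma pos_def_gray_overlap:
  assumes "i \<in> V"
  shows "(\<lambda>x. bool_spin (fst (x i)) * bool_spin (snd (x i))) \<in> pos_def gray V"
proof -
  have "(\<lambda>x. gray (x i) ^ 2) \<in> pos_def gray V" (is "?H \<in> _")
    using assms by (intro pos_def_power pos_def_gen)
  also have "?H = (\<lambda>x. bool_spin (fst (x i)) * bool_spin (snd (x i)))"
    by (auto simp: fun_eq_iff gray_def bool_spin_def)
  finally show ?thesis .
qed

lemma sum_UNIV_pair: "(\<Sum>p\<in>UNIV. g (fst p) (snd p)) = (\<Sum>a\<in>UNIV. \<Sum>b\<in>UNIV. g a b)"
  by (simp add: sum.cartesian_product case_prod_unfold)

text \<open>Multiplied out, the two factors give 1, \<open>w\<close> times an inner product and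
  \<open>w\<close> squared times two overlaps. This is where ferromagnetic signs are needed.\<close>

lemma pos_def_gray_edge:
  assumes "i \<in> V" "j \<in> V" "0 \<le> w"
  shows "(\<lambda>x. (1 + of_real w * (bool_spin (fst (x i)) * bool_spin (fst (x j)))) *
    (1 + of_real w * (bool_spin (snd (x i)) * bool_spin (snd (x j))))) \<in> pos_def gray V"
proof -
  have w: "0 \<le> complex_of_real w" "0 \<le> complex_of_real w * of_real w"
    using assms(3) by (simp_all add: less_eq_complex_def)
  have "(\<lambda>x. 1 + (of_real w * (bool_spin (fst (x i)) * bool_spin (fst (x j)) + bool_spin (snd (x i)) * bool_spin (snd (x j)))
     + of_real w * of_real w * ((bool_spin (fst (x i)) * bool_spin (snd (x i))) * (bool_spin (fst (x j)) * bool_spin (snd (x j))))))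
     \<in> pos_def gray V"
    by (intro pos_def_add pos_def_scale [OF _ w(1)] pos_def_scale [OF _ w(2)] pos_def_gray_dot assms
        pos_def_mult pos_def_gray_overlap pos_def_const) (simp add: less_eq_complex_def)
  then show ?thesis by (simp add: algebra_simps)
qed

lemma omega_clone_W: "omega_clone \<W>"
  unfolding \<W>_def
proof (rule omega_clone_asg_class)
  fix k F assume "two_copy F \<in> pos_def gray {..<k}"
  then show "two_copy F \<in> pos_def gray {..<Suc k}" by (rule pos_def_mono) auto
next
  fix k \<pi> F assume "two_copy F \<in> pos_def gray {..<k}" "\<pi> permutes {..<k}"
  then have "(\<lambda>x. two_copy F (\<lambda>i. x (\<pi> i))) \<in> pos_def gray {..<k}"
    using pos_def_rename [of "two_copy F" gray "{..<k}" \<pi> "{..<k}"] by (simp add: permutes_image)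
  then show "two_copy (\<lambda>s. F (s \<circ> \<pi>)) \<in> pos_def gray {..<k}"
    by (simp add: two_copy_def [abs_def] comp_def)
next
  fix k F G assume "two_copy F \<in> pos_def gray {..<k}" "two_copy G \<in> pos_def gray {..<k}"
  from pos_def_mult [OF this] show "two_copy (\<lambda>s. F s * G s) \<in> pos_def gray {..<k}"
    by (simp add: two_copy_def [abs_def] ac_simps)
next
  fix k F assume "two_copy F \<in> pos_def gray {..<Suc k}"
  then have "(\<lambda>x. \<Sum>a\<in>UNIV. two_copy F (x(k := a))) \<in> pos_def gray {..<k}"
    by (intro gray.pos_def_sum_out) (auto simp: lessThan_Suc)
  moreover have "(\<Sum>a\<in>UNIV. two_copy F (x(k := a))) = two_copy (\<lambda>s. \<Sum>b\<in>UNIV. F (s(k := b))) x" for x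
  proof -
    have "(\<lambda>i. fst ((x(k := a)) i)) = (\<lambda>i. fst (x i))(k := fst a)"
      "(\<lambda>i. snd ((x(k := a)) i)) = (\<lambda>i. snd (x i))(k := snd a)" for a by auto
    then have "(\<Sum>a\<in>UNIV. two_copy F (x(k := a))) =
        (\<Sum>a\<in>UNIV. of_real (F ((\<lambda>i. fst (x i))(k := fst a)) * F ((\<lambda>i. snd (x i))(k := snd a))))"
      by (simp only: two_copy_def)
    also have "\<dots> = two_copy (\<lambda>s. \<Sum>b\<in>UNIV. F (s(k := b))) x"
      using sum_UNIV_pair [of "\<lambda>a b. complex_of_real (F ((\<lambda>i. fst (x i))(k := a)) * F ((\<lambda>i. snd (x i))(k := b)))"]
      by (simp add: two_copy_def sum_product)
    finally show ?thesis .
  qed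
  ultimately show "two_copy (\<lambda>s. \<Sum>b\<in>UNIV. F (s(k := b))) \<in> pos_def gray {..<k}" by simp
next
  \<comment> \<open>Equality is an edge factor of weight 1 with prefactor 1/2, once in each
    copy.\<close>
  have "(\<lambda>x. (1/2 * (1/2)) * ((1 + of_real 1 * (bool_spin (fst (x 0)) * bool_spin (fst (x 1)))) *
    (1 + of_real 1 * (bool_spin (snd (x 0)) * bool_spin (snd (x 1)))))) \<in> pos_def gray {..<2::nat}" (is "?H \<in> _")
    by (intro pos_def_scale pos_def_gray_edge mult_nonneg_nonneg half_nonneg) auto
  also have "?H =
      two_copy (\<lambda>s. of_bool (s 0 = s 1))"
    by (auto simp: fun_eq_iff two_copy_def bool_spin_def)
  finally show "two_copy (\<lambda>s. of_bool (s 0 = s 1)) \<in> pos_def gray {..<2}" .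
next
  fix k F G assume F: "\<And>n. two_copy (F n) \<in> pos_def gray {..<k}" and l: "\<And>s. (\<lambda>n. F n s) \<longlonglongrightarrow> G s"
  show "two_copy G \<in> pos_def gray {..<k}"
  proof (rule gray.pos_def_limit [OF _ F])
    show "(\<lambda>n. two_copy (F n) x) \<longlonglongrightarrow> two_copy G x" for x
      unfolding two_copy_def by (intro tendsto_of_real tendsto_mult l)
  qed simp
qed

section \<open>Log-supermodular functions\<close>

abbreviation log_supermodular :: "((nat \<Rightarrow> bool) \<Rightarrow> real) \<Rightarrow> bool" where
  "log_supermodular F \<equiv> \<forall>s t. F s * F t \<le> F (\<lambda>i. s i \<or> t i) * F (\<lambda>i. s i \<and> t i)"

definition LSM :: "bfun set" where
  "LSM = asg_class (\<lambda>k. log_supermodular)"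

text \<open>The one-variable case of the Ahlswede-Daykin four functions theorem; \<open>c\<close>
  belongs to joins and \<open>d\<close> to meets. The diagonal terms compare directly. The mixed
  terms P, Q satisfy P Q <= R S and P, Q <= R, which forces P + Q <= R + S.\<close>

lemma four_function_step:
  fixes a0 a1 b0 b1 c0 c1 d0 d1 :: real
  assumes nn: "0 \<le> a0" "0 \<le> a1" "0 \<le> b0" "0 \<le> b1" "0 \<le> c0" "0 \<le> c1" "0 \<le> d0" "0 \<le> d1"
    and h: "a0 * b0 \<le> c0 * d0" "a1 * b1 \<le> c1 * d1" "a0 * b1 \<le> c1 * d0" "a1 * b0 \<le> c1 * d0"
  shows "(a0 + a1) * (b0 + b1) \<le> (c0 + c1) * (d0 + d1)"
proof -
  define P Q R S where "P = a0 * b1" and "Q = a1 * b0" and "R = c1 * d0" and "S = c0 * d1"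
  have PQ: "P * Q \<le> R * S"
    using mult_mono [OF h(1,2)] nn by (simp add: P_def Q_def R_def S_def ac_simps)
  have le: "P \<le> R" "Q \<le> R" and pos: "0 \<le> P" "0 \<le> Q" "0 \<le> R" "0 \<le> S"
    using h nn by (simp_all add: P_def Q_def R_def S_def)
  have "P + Q \<le> R + S"
  proof (cases "R = 0")
    case False
    \<comment> \<open>Expanded, R (P + Q) <= R^2 + P Q <= R^2 + R S; then R cancels.\<close>
    have "0 \<le> (R - P) * (R - Q)" using le by simp
    with PQ have "R * (P + Q) \<le> R * (R + S)" by (simp add: algebra_simps)
    with False pos show ?thesis by simp
  qed (use le pos in auto)
  with h show ?thesis by (simp add: algebra_simps P_def Q_def R_def S_def)
qed

lemma omega_clone_LSM: "omega_clone LSM"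
  unfolding LSM_def
proof (rule omega_clone_asg_class)
  fix k \<pi> and F :: "(nat \<Rightarrow> bool) \<Rightarrow> real"
  assume "log_supermodular F"
  then show "log_supermodular (\<lambda>s. F (s \<circ> \<pi>))"
    by (simp add: comp_def)
next
  fix F G :: "(nat \<Rightarrow> bool) \<Rightarrow> real"
  assume F: "log_supermodular F"
    and G: "log_supermodular G"
    and nn: "\<And>s. 0 \<le> F s" "\<And>s. 0 \<le> G s"
  show "log_supermodular (\<lambda>s. F s * G s)"
  proof (intro allI)
    fix s t
    from mult_mono [OF F [rule_format, of s t] G [rule_format, of s t]] nn
    show "(F s * G s) * (F t * G t) \<le>
      (F (\<lambda>i. s i \<or> t i) * G (\<lambda>i. s i \<or> t i)) * (F (\<lambda>i. s i \<and> t i) * G (\<lambda>i. s i \<and> t i))"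
      by (simp add: ac_simps)
  qed
next
  fix k :: nat and F :: "(nat \<Rightarrow> bool) \<Rightarrow> real"
  assume F: "log_supermodular F" and nn: "\<And>s. 0 \<le> F s"
  show "log_supermodular (\<lambda>s. \<Sum>b\<in>UNIV. F (s(k := b)))"
  proof (intro allI)
    fix s t
    have or: "(\<lambda>i. (s(k := a)) i \<or> (t(k := b)) i) = (\<lambda>i. s i \<or> t i)(k := a \<or> b)" for a b by auto
    have and_eq: "(\<lambda>i. (s(k := a)) i \<and> (t(k := b)) i) = (\<lambda>i. s i \<and> t i)(k := a \<and> b)" for a b by auto
    have "F (s(k := a)) * F (t(k := b)) \<le> F ((\<lambda>i. s i \<or> t i)(k := a \<or> b)) * F ((\<lambda>i. s i \<and> t i)(k := a \<and> b))" for a b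
      using F [rule_format, of "s(k := a)" "t(k := b)"] unfolding or and_eq .
    from this [of False False] this [of True True] this [of False True] this [of True False]
    show "(\<Sum>b\<in>UNIV. F (s(k := b))) * (\<Sum>b\<in>UNIV. F (t(k := b))) \<le>
      (\<Sum>b\<in>UNIV. F ((\<lambda>i. s i \<or> t i)(k := b))) * (\<Sum>b\<in>UNIV. F ((\<lambda>i. s i \<and> t i)(k := b)))"
      by (simp add: UNIV_bool four_function_step nn)
  qed
next
  fix F :: "nat \<Rightarrow> (nat \<Rightarrow> bool) \<Rightarrow> real" and G assume F: "\<And>n. log_supermodular (F n)"
    and l: "\<And>s. (\<lambda>n. F n s :: real) \<longlonglongrightarrow> G s"
  show "log_supermodular G"
    by (intro allI LIMSEQ_le [OF tendsto_mult [OF l l] tendsto_mult [OF l l]]) (use F in auto)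
qed auto

section \<open>Self-dual functions\<close>

text \<open>The constants permit rescaling a function to maximum 1, the normalisation under which
  its powers converge to an indicator.\<close>

locale scaled_omega_clone =
  fixes C :: "bfun set"
  assumes omega_clone: "omega_clone C" and nullary_subset: "nullary \<subseteq> C"
begin

lemma closed: "closed_under_ops C" "EQ \<in> C" and subset_B: "C \<subseteq> \<B>"
  using omega_clone by (auto simp: omega_clone_iff)

lemmas mult = expressible_mult [OF closed]
  and mono = expressible_mono [OF closed]
  and rename = expressible_rename [OF closed]
  and sum_last = expressible_sum_last [OF closed]
  and sum_many = expressible_sum_many [OF closed]

lemma const:
  assumes "0 \<le> c" shows "expressible C k (\<lambda>s. c)"
proof -
  have "(0, \<lambda>x\<in>tuples 0. c) \<in> C"
    using nullary_subset assms by (auto simp: nullary_def \<B>\<^sub>a_def)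
  from expressibleI [OF this] have "expressible C 0 (\<lambda>s. c)"
    by (simp add: asg_restrict) (simp add: asg_def [abs_def])
  then show ?thesis by (rule mono) simp
qed

lemma prod: "(\<And>i. i \<in> I \<Longrightarrow> expressible C k (F i)) \<Longrightarrow> expressible C k (\<lambda>s. \<Prod>i\<in>I. F i s)"
  by (induction I rule: infinite_finite_induct) (auto intro: mult const)

lemma scale: "expressible C k F \<Longrightarrow> 0 \<le> c \<Longrightarrow> expressible C k (\<lambda>s. c * F s)"
  by (intro mult const)

text \<open>All powers lie in the clone of the one-element set \<open>{(k, f)}\<close>, so a single
  finite set serves every accuracy. Powers tend to 1 where the value is 1 and to 0
  elsewhere.\<close>

lemma level_one:
  assumes F: "expressible C k F" and le: "\<And>s. 0 \<le> F s" "\<And>s. F s \<le> 1"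
  shows "expressible C k (\<lambda>s. of_bool (F s = 1))"
proof -
  obtain f where f: "(k, f) \<in> C" "asg k f = F"
    using F by (auto simp: expressible_def)
  have f01: "0 \<le> f x" "f x \<le> 1" if "x \<in> tuples k" for x
    using le [of "(!) x"] asg_nth [OF that, of f] f(2) by simp_all
  \<comment> \<open>The exponents start at 1, so that the first power is \<open>f\<close>
    itself.\<close>
  let ?g = "\<lambda>n. \<lambda>x\<in>tuples k. f x ^ Suc n"
  have "(k, \<lambda>x\<in>tuples k. of_bool (f x = 1)) \<in> C"
  proof (rule in_omega_clone_limit [where S = "{(k, f)}" and g = ?g])
    have hull: "closed_under_ops (functional_clone {(k, f)})"
      unfolding functional_clone_def by (rule hull_in, rule closed_under_ops_Inter) blast
    have inc: "(k, f) \<in> functional_clone {(k, f)}"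
      unfolding functional_clone_def by (rule hull_inc) simp
    show "(k, ?g n) \<in> functional_clone {(k, f)}" for n
    proof (induction n)
      case 0
      have "f \<in> extensional (tuples k)"
        using f subset_B by (auto simp: \<B>_def \<B>\<^sub>a_def PiE_iff)
      then have "?g 0 = f" by (simp add: extensional_restrict)
      with inc show ?case by simp
    next
      case (Suc n)
      have "(\<lambda>x\<in>tuples k. f x * ?g n x) = ?g (Suc n)" by (rule restrict_ext) simp
      moreover have "(k, \<lambda>x\<in>tuples k. f x * ?g n x) \<in> functional_clone {(k, f)}"
        using hull inc Suc unfolding closed_under_ops_def by blast
      ultimately show ?case by (simp only:)
    qed
    show "(\<lambda>n. ?g n x) \<longlonglongrightarrow> (\<lambda>x\<in>tuples k. of_bool (f x = 1)) x" if x: "x \<in> tuples k" for x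
    proof (cases "f x = 1")
      case False
      then have "(\<lambda>n. f x ^ Suc n) \<longlonglongrightarrow> 0"
        using f01 [OF x] by (intro LIMSEQ_Suc LIMSEQ_power_zero) auto
      with False x show ?thesis by simp
    qed (use x in simp)
  qed (use omega_clone f in \<open>auto intro: tuple_fun_in_B\<close>)
  from expressibleI [OF this]
  have "expressible C k (\<lambda>s. of_bool (asg k f s = 1))"
    by (simp add: asg_restrict) (simp add: asg_def [abs_def])
  then show ?thesis by (simp only: f)
qed

lemma rename2:
  assumes "expressible C 2 (\<lambda>s. g (s 0) (s 1))" "i < n" "j < n"
  shows "expressible C n (\<lambda>s. g (s i) (s j))"
  using rename [OF assms(1), of "\<lambda>l. if l = 0 then i else j" n] assms(2,3) by simp

lemma rename3:
  assumes "expressible C 3 (\<lambda>s. g (s 0) (s 1) (s 2))" "i < n" "j < n" "l < n"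
  shows "expressible C n (\<lambda>s. g (s i) (s j) (s l))"
  using rename [OF assms(1), of "\<lambda>m. if m = 0 then i else if m = 1 then j else l" n] assms(2-4) by simp

end

lemma asg_ising_2: "asg 2 (snd (ising 2 lam)) s = (if s 0 = s 1 then 1 else lam)"
  by (auto simp: ising_def asg_restrict) (auto simp: asg_def numeral_2_eq_2)

locale anti_ising_clone = scaled_omega_clone +
  assumes anti_ising: "1 \<le> lam \<Longrightarrow> ising 2 lam \<in> C"
begin

lemma anti:
  assumes "1 \<le> lam" shows "expressible C 2 (\<lambda>s. if s 0 = s 1 then 1 else lam)"
proof -
  have "(2, snd (ising 2 lam)) \<in> C" using anti_ising [OF assms] by (simp add: ising_def)
  from expressibleI [OF this] show ?thesis by (simp only: asg_ising_2 [abs_def])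
qed

lemma neq:
  assumes "i < n" "j < n" shows "expressible C n (\<lambda>s. of_bool (s i \<noteq> s j))"
proof -
  \<comment> \<open>The parameter 2, halved, puts the maximum 1 exactly on unequal
    arguments.\<close>
  have "expressible C 2 (\<lambda>s. 1/2 * (if s 0 = s 1 then 1 else 2))"
    by (rule scale [OF anti]) auto
  then have "expressible C 2 (\<lambda>s. of_bool (1/2 * (if s 0 = s 1 then 1 else 2) = (1 :: real)))"
    by (rule level_one) auto
  also have "\<dots> =
      (\<lambda>s. of_bool (s 0 \<noteq> s 1) :: real)"
    by (rule ext) auto
  finally show ?thesis using assms by (rule rename2)
qed

lemma binary_weight:
  assumes "0 < a" "0 < b" "i < n" "j < n"
  shows "expressible C n (\<lambda>s. if s i = s j then a else b)"
proof -
  have le: "expressible C n (\<lambda>s. if s i = s j then a else b)" if "0 < a" "a \<le> b" "i < n" "j < n" for a b i j n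
  proof -
    have "expressible C 2 (\<lambda>s. a * (if s 0 = s 1 then 1 else b / a))"
      using that by (intro scale [OF anti]) auto
    also have "\<dots> = (\<lambda>s. if s 0 = s 1 then a else b)"
      using that by auto
    finally show ?thesis using that(3,4) by (rule rename2)
  qed
  show ?thesis
  proof (cases "a \<le> b")
    case False
    \<comment> \<open>Preference for equality with \<open>s j\<close> is preference for inequality
      with its complement, held in the new variable \<open>s n\<close>.\<close>
    have "expressible C (Suc n) (\<lambda>s. (if s i = s n then b else a) * of_bool (s n \<noteq> s j))"
      using False assms by (intro mult le neq) auto
    from sum_last [OF this] have "expressible C n (\<lambda>s. \<Sum>c\<in>UNIV.
        (if (s(n := c)) i = (s(n := c)) n then b else a) * of_bool ((s(n := c)) n \<noteq> (s(n := c)) j))" .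
    also have "\<dots>
        = (\<lambda>s. if s i = s j then a else b)"
      using assms by (auto simp: UNIV_bool fun_eq_iff)
    finally show ?thesis .
  qed (use assms le in auto)
qed

lemma not_all_equal:
  assumes "i < n" "j < n" "l < n"
  shows "expressible C n (\<lambda>s. of_bool (\<not> (s i = (s j \<noteq> y) \<and> s i = s l)))"
proof -
  have False_case: "expressible C n (\<lambda>s. of_bool (\<not> (s i = s j \<and> s i = s l)))"
    if "i < n" "j < n" "l < n" for i j l n
  proof -
    let ?w = "\<lambda>s :: nat \<Rightarrow> bool. \<lambda>i j. if s i = s j then 1 else 2 :: real"
    \<comment> \<open>A frustrated triangle: three Boolean values that are not all equal differ
      along exactly two edges, so the product of weights is 4, and it is 1 if they all
      agree.\<close>
    have "expressible C 3 (\<lambda>s. 1/4 * (?w s 0 1 * (?w s 1 2 * ?w s 0 2)))"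
      by (intro scale mult binary_weight) auto
    then have "expressible C 3 (\<lambda>s. of_bool (1/4 * (?w s 0 1 * (?w s 1 2 * ?w s 0 2)) = 1))"
      by (rule level_one) auto
    also have "\<dots> =
        (\<lambda>s. of_bool (\<not> (s 0 = s 1 \<and> s 0 = s 2)) :: real)"
      by (rule ext) auto
    finally show ?thesis using that by (rule rename3)
  qed
  show ?thesis
  proof (cases y)
    case True
    have "expressible C (Suc n) (\<lambda>s. of_bool (s n \<noteq> s j) * of_bool (\<not> (s i = s n \<and> s i = s l)))"
      using assms by (intro mult neq False_case) auto
    from sum_last [OF this] have "expressible C n (\<lambda>s. \<Sum>c\<in>UNIV. of_bool ((s(n := c)) n \<noteq> (s(n := c)) j) *
        of_bool (\<not> ((s(n := c)) i = (s(n := c)) n \<and> (s(n := c)) i = (s(n := c)) l)))" .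
    also have "\<dots> =
        (\<lambda>s. of_bool (\<not> (s i = (s j \<noteq> y) \<and> s i = s l)) :: real)"
      using assms True by (auto simp: UNIV_bool fun_eq_iff)
    finally show ?thesis .
  qed (use False_case assms in auto)
qed

text \<open>With \<open>w = s k\<close> and \<open>z = s (k + 1)\<close>: if \<open>w \<noteq> z\<close>, then all the constraints hold; if \<open>w = z\<close>,
  then they force \<open>s\<close> to be \<open>y\<close> or its complement.\<close>

lemma bump_pair:
  assumes "0 < a"
  shows "expressible C k (\<lambda>s. 1 + a * (of_bool (\<forall>i<k. s i = y i) + of_bool (\<forall>i<k. s i \<noteq> y i)))"
proof -
  let ?G = "\<lambda>s. (if s k = s (Suc k) then a else 1/2) *
    (\<Prod>i<k. of_bool (\<not> (s k = (s i \<noteq> y i) \<and> s k = s (Suc k))))"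
  have "expressible C (Suc (Suc k)) ?G"
    using assms by (intro mult prod binary_weight not_all_equal) auto
  from sum_last [OF sum_last [OF this]]
  have "expressible C k (\<lambda>s. \<Sum>w\<in>UNIV. \<Sum>z\<in>UNIV. ?G (s(k := w, Suc k := z)))" by simp
  also have "\<dots> =
      (\<lambda>s. 1 + a * (of_bool (\<forall>i<k. s i = y i) + of_bool (\<forall>i<k. s i \<noteq> y i)))"
  proof
    fix s
    have ge: "?G (s(k := w, Suc k := z)) = (if w = z then a else 1/2) *
        (\<Prod>i<k. of_bool (\<not> (w = (s i \<noteq> y i) \<and> w = z)))" for w z
    proof -
      have "(\<Prod>i<k. of_bool (\<not> (w = ((s(k := w, Suc k := z)) i \<noteq> y i) \<and> w = z))) =
          (\<Prod>i<k. of_bool (\<not> (w = (s i \<noteq> y i) \<and> w = z)) :: real)"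
        by (rule prod.cong) auto
      then show ?thesis by simp
    qed
    have of_bool_prod: "(\<Prod>i<k. of_bool (p i)) = (of_bool (\<forall>i<k. p i) :: real)" for p
      by (induction k) (auto simp: less_Suc_eq)
    show "(\<Sum>w\<in>UNIV. \<Sum>z\<in>UNIV. ?G (s(k := w, Suc k := z))) =
        1 + a * (of_bool (\<forall>i<k. s i = y i) + of_bool (\<forall>i<k. s i \<noteq> y i))"
      unfolding ge of_bool_prod by (simp add: UNIV_bool algebra_simps)
  qed
  finally show ?thesis .
qed

text \<open>In a product with one bump per tuple \<open>y\<close>, an assignment is met twice, by
  \<open>y\<close> equal to its tuple and to the complement. Each value therefore arises as a
  square, which explains the root in \<open>a\<close>.\<close>

lemma positive_self_dual:
  assumes f: "(k, f) \<in> \<S>\<D>" and pos: "\<And>x. x \<in> tuples k \<Longrightarrow> 0 < f x"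
  shows "expressible C k (asg k f)"
proof (cases "k = 0")
  \<comment> \<open>The empty tuple is its own complement and would be met only once.\<close>
  case True
  have "asg k f = (\<lambda>s. f [])" using True by (simp add: asg_def [abs_def])
  moreover have "0 \<le> f []" using pos [of "[]"] True by (simp add: tuples_def)
  ultimately show ?thesis using const by simp
next
  case False
  \<comment> \<open>Half the minimum keeps \<open>f y / m\<close> strictly above 1, hence
    \<open>a y\<close> positive, as \<open>bump_pair\<close> requires.\<close>
  define m where "m = Min (f ` tuples k) / 2"
  have fin: "finite (f ` tuples k)" "f ` tuples k \<noteq> {}" by auto
  have "0 < Min (f ` tuples k)" using fin pos by (subst Min_gr_iff) auto
  then have m: "0 < m" "\<And>x. x \<in> tuples k \<Longrightarrow> m < f x"
  proof -
    fix x assume x: "x \<in> tuples k"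
    then have "Min (f ` tuples k) \<le> f x" by simp
    with pos [OF x] show "m < f x" by (simp add: m_def)
  qed (simp add: m_def)
  define a where "a y = sqrt (f y / m) - 1" for y
  have a: "0 < a y" if "y \<in> tuples k" for y
    using m that by (simp add: a_def)
  have "expressible C k (\<lambda>s. m * (\<Prod>y\<in>tuples k. 1 + a y * (of_bool (\<forall>i<k. s i = y ! i) + of_bool (\<forall>i<k. s i \<noteq> y ! i))))"
    using m a by (intro scale prod bump_pair) auto
  also have "\<dots> = asg k f"
  proof
    fix s :: "nat \<Rightarrow> bool"
    define x where "x = map s [0..<k]"
    have x: "x \<in> tuples k" "map Not x \<in> tuples k" by (simp_all add: x_def tuples_def)
    have ne: "x \<noteq> map Not x"
      using False by (auto simp: x_def list_eq_iff_nth_eq)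
    have eq: "(\<forall>i<k. s i = y ! i) \<longleftrightarrow> y = x" "(\<forall>i<k. s i \<noteq> y ! i) \<longleftrightarrow> y = map Not x"
      if "y \<in> tuples k" for y
      using that by (auto simp: x_def tuples_def list_eq_iff_nth_eq)
    have "(\<Prod>y\<in>tuples k. 1 + a y * (of_bool (\<forall>i<k. s i = y ! i) + of_bool (\<forall>i<k. s i \<noteq> y ! i))) =
        (\<Prod>y\<in>tuples k. 1 + a y * (of_bool (y = x) + of_bool (y = map Not x)))"
      by (rule prod.cong) (simp_all only: eq)
    also have "\<dots> = (\<Prod>y\<in>{x, map Not x}. 1 + a y * (of_bool (y = x) + of_bool (y = map Not x)))"
      by (rule prod.mono_neutral_right) (use x in auto)
    also have "\<dots> = (1 + a x) * (1 + a (map Not x))" using ne by simp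
    also have "a (map Not x) = a x" using f x by (auto simp: a_def \<S>\<D>_def)
    also have "(1 + a x) * (1 + a x) = f x / m"
      using m x pos [of x] by (simp add: a_def)
    finally show "m * (\<Prod>y\<in>tuples k. 1 + a y * (of_bool (\<forall>i<k. s i = y ! i) + of_bool (\<forall>i<k. s i \<noteq> y ! i))) = asg k f s"
      using m by (simp add: asg_def x_def)
  qed
  finally show ?thesis .
qed

text \<open>Products of bumps are strictly positive. Zeros are cut out separately: \<open>g\<close>
  replaces them by 1, and the level set where \<open>h\<close> equals 1 removes them again.\<close>

lemma SD_subset: "\<S>\<D> \<subseteq> C"
proof clarify
  fix k f assume f: "(k, f) \<in> \<S>\<D>"
  then have "f \<in> \<B>\<^sub>a k" by (simp add: \<S>\<D>_def \<B>_def)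
  then have nn: "0 \<le> f x" if "x \<in> tuples k" for x
    using that by (auto simp: \<B>\<^sub>a_def PiE_iff)
  have sd: "f x = f (map Not x)" if "x \<in> tuples k" for x
    using that f by (auto simp: \<S>\<D>_def)
  have Not: "map Not x \<in> tuples k" if "x \<in> tuples k" for x using that by (simp add: tuples_def)
  define g where "g = (\<lambda>x\<in>tuples k. if f x = 0 then 1 else f x)"
  define h where "h = (\<lambda>x\<in>tuples k. if f x = 0 then 1/2 else (1 :: real))"
  have "(k, g) \<in> \<S>\<D>" "(k, h) \<in> \<S>\<D>"
    using nn Not sd by (auto simp: \<S>\<D>_def \<B>_def g_def h_def intro!: tuple_fun_in_B)
  then have gh: "expressible C k (asg k g)" "expressible C k (asg k h)"
    using nn by (auto intro!: positive_self_dual simp: g_def h_def order_less_le)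
  have "expressible C k (\<lambda>s. asg k g s * of_bool (asg k h s = 1))"
    by (intro mult gh level_one) (simp_all add: asg_def h_def)
  also have "\<dots> = asg k f"
    by (rule ext) (simp add: asg_def g_def h_def)
  finally show "(k, f) \<in> C"
    using subset_B f by (intro expressibleD) (auto simp: \<S>\<D>_def \<B>_def)
qed

end

lemma nullary_subset_B: "nullary \<subseteq> \<B>"
  by (auto simp: nullary_def \<B>_def)

lemma ising_in_B: "0 \<le> lam \<Longrightarrow> ising k lam \<in> \<B>"
  by (auto simp: ising_def \<B>_def intro: tuple_fun_in_B)

lemma omega_clone_I_anti: "omega_clone \<I>_anti"
  unfolding \<I>_anti_def by (rule omega_clone_omega_closure) (auto simp: ising_in_B nullary_subset_B [THEN subsetD])

lemma nullary_subset_SD: "nullary \<subseteq> \<S>\<D>"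
  by (auto simp: nullary_def \<S>\<D>_def \<B>_def tuples_def)

lemma ising_in_SD: "0 \<le> lam \<Longrightarrow> ising k lam \<in> \<S>\<D>"
  using ising_in_B [of lam k]
  by (auto simp: ising_def \<S>\<D>_def tuples_def list_eq_iff_nth_eq)

theorem SD_eq_I_anti: "\<S>\<D> = \<I>_anti"
proof
  interpret anti_ising_clone \<I>_anti
    using subset_omega_closure [of "{ising 2 lam |lam. 1 \<le> lam} \<union> nullary"] omega_clone_I_anti
    by unfold_locales (auto simp: \<I>_anti_def)
  show "\<S>\<D> \<subseteq> \<I>_anti" by (rule SD_subset)
  show "\<I>_anti \<subseteq> \<S>\<D>"
    unfolding \<I>_anti_def using omega_clone_SD nullary_subset_SD
    by (intro omega_closure_minimal Un_least subsetI) (auto simp: omega_clone_iff intro!: ising_in_SD)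
qed

lemma expressible_asg_class:
  assumes nn: "\<And>s. 0 \<le> F s" and dep: "\<And>s t. (\<And>i. i < k \<Longrightarrow> s i = t i) \<Longrightarrow> F s = F t" and Q: "Q k F"
  shows "expressible (asg_class Q) k F"
proof -
  let ?f = "\<lambda>x\<in>tuples k. F ((!) x)"
  have "asg k ?f = F"
    by (rule ext) (auto simp: asg_restrict asg_def intro!: dep)
  moreover have "?f \<in> \<B>\<^sub>a k" using nn by (intro tuple_fun_in_B)
  ultimately show ?thesis
    using Q unfolding expressible_def asg_class_def \<B>_def by auto
qed

lemma expressible_subset: "expressible C k F \<Longrightarrow> C \<subseteq> D \<Longrightarrow> expressible D k F"
  by (auto simp: expressible_def)

lemma expressible_B_nonneg: "expressible \<B> k F \<Longrightarrow> 0 \<le> F s"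
  by (auto simp: expressible_def \<B>_def asg_nonneg)

lemma sum_bool_delta: "(\<Sum>b\<in>UNIV. H b * of_bool (b = (c :: bool))) = (H c :: real)"
  by (cases c) (simp_all add: UNIV_bool)

lemma asg_class_inter: "asg_class Q \<inter> asg_class R = asg_class (\<lambda>k F. Q k F \<and> R k F)"
  by (auto simp: asg_class_def)

section \<open>The functions in SDP\<close>

lemma SD_flipped_P_iff:
  assumes "(k, f) \<in> \<S>\<D>" shows "(k, f) \<in> flipped_P t \<longleftrightarrow> (k, f) \<in> \<P>"
proof -
  have "asg k f (\<lambda>i. \<not> s i) = asg k f s" for s
    using assms by (simp add: SD_eq asg_class_def)
  then show ?thesis
    unfolding P_eq flipped_P_def asg_class_def by (cases t) simp_all
qed

text \<open>By inversion only characters of even total exponent remain, and each of these is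
  invariant under the global flip. A function in \<open>\<P>\<close> and \<open>\<P>\<N>\<close>
  satisfies the hypothesis, its odd coefficients having both signs.\<close>

lemma fourier_odd_zero_imp_SD:
  assumes f: "(k, f) \<in> \<B>" and z: "\<And>x. x \<in> tuples k \<Longrightarrow> odd (hweight x) \<Longrightarrow> fourier k f x = 0"
  shows "(k, f) \<in> \<S>\<D>"
proof -
  let ?F = "\<lambda>s. complex_of_real (asg k f s)"
  let ?c = "\<lambda>n. \<Sum>s\<in>{..<k} \<rightarrow>\<^sub>E UNIV. ?F s * character bool_spin {..<k} n s"
  have c: "?c n = 0" if "odd (\<Sum>i<k. n i)" for n
  proof -
    have "odd (hweight (map (\<lambda>i. odd (n i)) [0..<k]))"
      using minus_one_power_hweight_odd [of n k, where 'a = int] that by (cases "even (hweight (map (\<lambda>i. odd (n i)) [0..<k]))") auto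
    then show ?thesis using fourier_character [of k f n] z by simp
  qed
  have "?F (\<lambda>i. \<not> s i) = ?F s" for s
  proof -
    have inv: "?F s = (\<Sum>n\<in>{..<k} \<rightarrow>\<^sub>E {..<2}. ?c n * character bool_spin {..<k} (\<lambda>v. (2 - 1) * n v) s) / of_nat 2 ^ card {..<k}" for s
      by (rule spin.fourier_inversion) (auto intro!: asg_cong)
    have "?c n * character bool_spin {..<k} (\<lambda>v. (2 - 1) * n v) (\<lambda>i. \<not> s i) = ?c n * character bool_spin {..<k} (\<lambda>v. (2 - 1) * n v) s" for n
      using c [of n] character_flip [of k n s True] by (cases "even (\<Sum>i<k. n i)") simp_all
    then show ?thesis unfolding inv [of s] inv [of "\<lambda>i. \<not> s i"] by (simp only:)
  qed
  then have "asg k f s = asg k f (\<lambda>i. \<not> s i)" for s by (simp only: of_real_eq_iff)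
  with f show ?thesis by (simp add: SD_eq asg_class_def)
qed

lemma P_inter_PN_subset_SD: "\<P> \<inter> \<P>\<N> \<subseteq> \<S>\<D>"
proof clarify
  fix k f assume "(k, f) \<in> \<P>" "(k, f) \<in> \<P>\<N>"
  then show "(k, f) \<in> \<S>\<D>"
    by (intro fourier_odd_zero_imp_SD) (auto simp: \<P>_def \<P>\<N>_def intro: order_antisym)
qed

lemma SDP_eq: "\<S>\<D>\<P> = \<S>\<D> \<inter> \<P>" "\<S>\<D>\<P> = \<S>\<D> \<inter> \<P>\<N>" "\<S>\<D>\<P> = \<P> \<inter> \<P>\<N>"
  using SD_flipped_P_iff [of _ _ True] P_inter_PN_subset_SD
  unfolding \<S>\<D>\<P>_def PN_eq [symmetric] by auto

lemma omega_clone_P: "omega_clone \<P>" and omega_clone_PN: "omega_clone \<P>\<N>"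
  by (simp_all add: P_eq PN_eq omega_clone_flipped_P)

lemma omega_clone_SDP: "omega_clone \<S>\<D>\<P>"
  using omega_meet_glb(1) [OF omega_clone_SD omega_clone_P] by (simp add: SDP_eq(1) omega_meet_def)

lemma nullary_subset_flipped_P: "nullary \<subseteq> flipped_P t"
proof clarify
  fix k f assume "(k, f) \<in> nullary"
  then have f: "k = 0" "f \<in> \<B>\<^sub>a 0" by (auto simp: nullary_def)
  then have "0 \<le> complex_of_real (f [])"
    by (simp add: less_eq_complex_def \<B>\<^sub>a_def PiE_iff tuples_def)
  then have "(\<lambda>s. complex_of_real (f [])) \<in> pos_def bool_spin {..<0::nat}" by (rule pos_def_const)
  with f show "(k, f) \<in> flipped_P t" by (simp add: flipped_P_def asg_class_def \<B>_def asg_def)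
qed

lemma nullary_subset_SDP: "nullary \<subseteq> \<S>\<D>\<P>"
  using nullary_subset_flipped_P [of False] nullary_subset_SD by (auto simp: SDP_eq(1) P_eq)

lemma SDP_asg_class:
  "\<S>\<D>\<P> = asg_class (\<lambda>k F. (\<forall>s. F s = F (\<lambda>i. \<not> s i)) \<and> (\<lambda>s. of_real (F s)) \<in> pos_def bool_spin {..<k})"
  unfolding SDP_eq(1) SD_eq P_eq flipped_P_def by (simp add: asg_class_inter)

section \<open>Maximality\<close>

context scaled_omega_clone
begin

text \<open>An unbalanced unary function, divided by its maximum, has the pin to \<open>c\<close> as
  the limit of its powers. The pin sits at position \<open>k\<close> so that \<open>sum_last\<close>
  can consume it.\<close>

lemma unary_delta:
  assumes u: "expressible C 1 (\<lambda>s. u (s 0))" and less: "u (\<not> c) < u c"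
  shows "expressible C (Suc k) (\<lambda>s. of_bool (s k = c))"
proof -
  have nn: "0 \<le> u b" for b
    using expressible_B_nonneg [OF expressible_subset [OF u subset_B], of "\<lambda>_. b"] .
  then have pos: "0 < u c" using less by (meson le_less_trans)
  have le: "u b \<le> u c" for b using less by (cases "b = c") auto
  have "expressible C 1 (\<lambda>s. 1 / u c * u (s 0))"
    using nn by (intro scale u) simp
  then have "expressible C 1 (\<lambda>s. of_bool (1 / u c * u (s 0) = 1))"
    using nn pos le by (intro level_one) (auto simp: field_simps)
  also have "\<dots> = (\<lambda>s. of_bool (s 0 = c) :: real)" (is "?L = ?R")
  proof
    fix s :: "nat \<Rightarrow> bool"
    show "?L s = ?R s"
      using less pos by (cases "s 0 = c") auto
  qed
  finally show ?thesis using rename [of 1 _ "\<lambda>_. k" "Suc k"] by simp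
qed

lemma B_subsetI:
  assumes "\<And>k g. g \<in> \<B>\<^sub>a k \<Longrightarrow> expressible C k (asg k g)"
  shows "C = \<B>"
  using assms subset_B expressibleD [OF _ subset_B] by (auto simp: \<B>_def)

end

lemma maximal_in_SD_B: "maximal_in \<S>\<D> \<B>"
proof -
  have "C = \<B>" if C: "omega_clone C" "\<S>\<D> \<subset> C" for C
  proof -
    interpret scaled_omega_clone C
      using C nullary_subset_SD by unfold_locales auto
    obtain k f where f: "(k, f) \<in> C" "(k, f) \<notin> \<S>\<D>" using C(2) by auto
    then obtain x where x: "x \<in> tuples k" "f x \<noteq> f (map Not x)"
      using subset_B by (auto simp: \<S>\<D>_def)
    let ?F = "asg k f"
    have "expressible \<S>\<D> 2 (\<lambda>s. of_bool (s 0 \<noteq> s 1))"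
      unfolding SD_eq by (rule expressible_asg_class) auto
    then have neq: "expressible C 2 (\<lambda>s. of_bool (s 0 \<noteq> s 1))"
      using C(2) by (auto intro: expressible_subset)
    \<comment> \<open>Arguments where the witness \<open>x\<close> is 1 are identified with
      \<open>s 0\<close>, the others with \<open>s 1\<close>. Forcing the two to differ and summing
      out \<open>s 1\<close> leaves a unary function with the values of \<open>f\<close> at
      \<open>x\<close> and its complement, which are different.\<close>
    have "expressible C 2 (\<lambda>s. ?F (\<lambda>i. s (if x ! i then 0 else 1)))"
      by (rule rename [OF expressibleI [OF f(1)]]) simp
    from mult [OF this neq]
    have "expressible C (Suc 1) (\<lambda>s. ?F (\<lambda>i. s (if x ! i then 0 else 1)) * of_bool (s 0 \<noteq> s 1))"
      by (simp add: numeral_2_eq_2)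
    from sum_last [OF this]
    have "expressible C 1 (\<lambda>s. \<Sum>b\<in>UNIV. ?F (\<lambda>i. (s(1 := b)) (if x ! i then 0 else 1)) * of_bool ((s(1 := b)) 0 \<noteq> (s(1 := b)) 1))" .
    also have "\<dots> =
        (\<lambda>s. ?F (\<lambda>i. x ! i = s 0))"
    proof
      fix s :: "nat \<Rightarrow> bool"
      have "(\<lambda>i. (s(1 := \<not> s 0)) (if x ! i then 0 else 1)) = (\<lambda>i. x ! i = s 0)" by (auto simp: fun_eq_iff)
      moreover have "(\<Sum>b\<in>UNIV. ?F (\<lambda>i. (s(1 := b)) (if x ! i then 0 else 1)) * of_bool ((s(1 := b)) 0 \<noteq> (s(1 := b)) 1)) =
          ?F (\<lambda>i. (s(1 := \<not> s 0)) (if x ! i then 0 else 1))"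
        by (cases "s 0") (simp_all add: UNIV_bool)
      ultimately show "(\<Sum>b\<in>UNIV. ?F (\<lambda>i. (s(1 := b)) (if x ! i then 0 else 1)) * of_bool ((s(1 := b)) 0 \<noteq> (s(1 := b)) 1)) =
          ?F (\<lambda>i. x ! i = s 0)" by simp
    qed
    finally have u: "expressible C 1 (\<lambda>s. ?F (\<lambda>i. x ! i = s 0))" .
    have "?F (\<lambda>i. x ! i = True) = f x" using asg_nth [OF x(1)] by simp
    moreover have "map (\<lambda>i. x ! i = False) [0..<k] = map Not (map ((!) x) [0..<k])" by simp
    then have "?F (\<lambda>i. x ! i = False) = f (map Not x)"
      unfolding asg_def map_nth_tuples [OF x(1)] by simp
    moreover define v where "v b = ?F (\<lambda>i. x ! i = b)" for b
    ultimately have v: "v True \<noteq> v False" using x(2) by simp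
    obtain c where "v (\<not> c) < v c"
    proof (cases "v True < v False")
      case True
      then show ?thesis using that [of False] by simp
    next
      case False
      then show ?thesis using v that [of True] by simp
    qed
    from unary_delta [OF u [folded v_def] this]
    have delta: "expressible C (Suc k) (\<lambda>s. of_bool (s k = c))" for k .
    show ?thesis
    proof (rule B_subsetI)
      fix k g assume g: "g \<in> \<B>\<^sub>a k"
      \<comment> \<open>The self-dual extension of \<open>g\<close>: the extra argument tells
        whether the other arguments are to be complemented. Pinning it to \<open>c\<close> gives
        back \<open>g\<close>.\<close>
      let ?G = "\<lambda>s. asg k g (\<lambda>i. s i \<noteq> (s k \<noteq> c))"
      have "expressible \<S>\<D> (Suc k) ?G"
        unfolding SD_eq by (rule expressible_asg_class) (auto intro!: asg_cong asg_nonneg g)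
      then have "expressible C (Suc k) (\<lambda>s. ?G s * of_bool (s k = c))"
        using C(2) by (intro mult delta) (auto intro: expressible_subset)
      from sum_last [OF this]
      have "expressible C k (\<lambda>s. \<Sum>b\<in>UNIV. ?G (s(k := b)) * of_bool ((s(k := b)) k = c))" .
      also have "\<dots> = asg k g"
      proof
        fix s
        show "(\<Sum>b\<in>UNIV. ?G (s(k := b)) * of_bool ((s(k := b)) k = c)) = asg k g s"
          unfolding fun_upd_same sum_bool_delta by (rule asg_cong) simp
      qed
      finally show "expressible C k (asg k g)" .
    qed
  qed
  then show ?thesis
    unfolding maximal_in_def using omega_clone_SD closed_under_ops_B closed_under_limits_B EQ_in_B
    by (auto simp: omega_clone_iff)
qed

section \<open>Point masses and the maximality of P and PN\<close>

definition real_character :: "nat \<Rightarrow> (nat \<Rightarrow> nat) \<Rightarrow> (nat \<Rightarrow> bool) \<Rightarrow> real" where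
  "real_character k n s = (\<Prod>i<k. (if s i then - 1 else 1) ^ n i)"

lemma of_real_character: "complex_of_real (real_character k n s) = character bool_spin {..<k} n s"
  by (simp add: real_character_def character_def bool_spin_def if_distrib [of complex_of_real] cong: if_cong)

lemma abs_real_character: "\<bar>real_character k n s\<bar> = 1"
  unfolding real_character_def abs_prod by (rule prod.neutral) (simp add: power_abs)

lemma real_character_bounds: "- 1 \<le> real_character k n s" "real_character k n s \<le> 1"
  using abs_real_character [of k n s] by (simp_all add: abs_le_iff [of _ 1] abs_if split: if_splits)

lemma real_character_cong: "(\<And>i. i < k \<Longrightarrow> s i = t i) \<Longrightarrow> real_character k n s = real_character k n t"
  by (simp add: real_character_def)

lemma real_character_flip:
  "real_character k n (\<lambda>i. \<not> s i) = (- 1) ^ (\<Sum>i<k. n i) * real_character k n s"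
  unfolding real_character_def power_sum prod.distrib [symmetric]
  by (rule prod.cong) (auto simp: power_mult_distrib [symmetric])

lemma conj_absorb_left: "P \<Longrightarrow> (P \<and> Q) = Q"
  by simp

lemma real_pos_def_iff:
  assumes dep: "\<And>s t. (\<And>i. i < k \<Longrightarrow> s i = t i) \<Longrightarrow> F s = F t"
  shows "(\<lambda>s. complex_of_real (F s)) \<in> pos_def bool_spin {..<k} \<longleftrightarrow>
    (\<forall>n. 0 \<le> (\<Sum>s\<in>{..<k} \<rightarrow>\<^sub>E UNIV. F s * real_character k n s))"
proof -
  have r: "0 \<le> complex_of_real r \<longleftrightarrow> 0 \<le> r" for r by (simp add: less_eq_complex_def)
  have sum: "(\<Sum>s\<in>{..<k} \<rightarrow>\<^sub>E UNIV. complex_of_real (F s) * character bool_spin {..<k} n s) =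
      of_real (\<Sum>s\<in>{..<k} \<rightarrow>\<^sub>E UNIV. F s * real_character k n s)" for n
    by (simp add: of_real_character)
  have "\<forall>s t. (\<forall>v\<in>{..<k}. s v = t v) \<longrightarrow> complex_of_real (F s) = complex_of_real (F t)"
  proof (intro allI impI)
    fix s t :: "nat \<Rightarrow> bool" assume "\<forall>v\<in>{..<k}. s v = t v"
    then have "F s = F t" by (intro dep) simp
    then show "complex_of_real (F s) = complex_of_real (F t)" by simp
  qed
  then show ?thesis
    unfolding spin.pos_def_iff [OF finite_lessThan] sum r by (rule conj_absorb_left)
qed

text \<open>A point mass at the all-False assignment contributes the same amount \<open>c\<close> to
  every Fourier sum, and \<open>c\<close> bounds each Fourier sum of \<open>g\<close> in absolute
  value.\<close>

lemma pos_def_dominated: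
  fixes g :: "(nat \<Rightarrow> bool) \<Rightarrow> real"
  assumes dep: "\<And>s t. (\<And>i. i < k \<Longrightarrow> s i = t i) \<Longrightarrow> g s = g t"
    and c: "(\<Sum>s\<in>{..<k} \<rightarrow>\<^sub>E UNIV. \<bar>g s\<bar>) \<le> c"
  shows "(\<lambda>s. complex_of_real (c * of_bool (\<forall>i<k. \<not> s i) + g s)) \<in> pos_def bool_spin {..<k}"
proof (rule real_pos_def_iff [THEN iffD2])
  show "c * of_bool (\<forall>i<k. \<not> s i) + g s = c * of_bool (\<forall>i<k. \<not> t i) + g t"
    if "\<And>i. i < k \<Longrightarrow> s i = t i" for s t
    using that dep [of s t] by simp
  show "\<forall>n. 0 \<le> (\<Sum>s\<in>{..<k} \<rightarrow>\<^sub>E UNIV. (c * of_bool (\<forall>i<k. \<not> s i) + g s) * real_character k n s)"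
  proof
    fix n
    let ?A = "{..<k} \<rightarrow>\<^sub>E (UNIV :: bool set)" and ?z = "\<lambda>i\<in>{..<k}. False"
    have "(\<forall>i<k. \<not> s i) \<longleftrightarrow> s = ?z" if "s \<in> ?A" for s
    proof
      assume "\<forall>i<k. \<not> s i" then show "s = ?z"
        using that by (intro PiE_ext [of _ "{..<k}" "\<lambda>_. UNIV"]) auto
    qed auto
    then have "(\<Sum>s\<in>?A. c * of_bool (\<forall>i<k. \<not> s i) * real_character k n s) =
        (\<Sum>s\<in>?A. if s = ?z then c * real_character k n s else 0)"
      by (intro sum.cong) auto
    also have "\<dots> = c * real_character k n ?z"
      by (subst sum.delta) (auto simp: finite_PiE)
    also have "real_character k n ?z = 1" by (simp add: real_character_def)
    finally have "(\<Sum>s\<in>?A. (c * of_bool (\<forall>i<k. \<not> s i) + g s) * real_character k n s) =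
        c + (\<Sum>s\<in>?A. g s * real_character k n s)"
      by (simp add: distrib_right sum.distrib)
    moreover have "\<bar>\<Sum>s\<in>?A. g s * real_character k n s\<bar> \<le> (\<Sum>s\<in>?A. \<bar>g s * real_character k n s\<bar>)"
      by (rule sum_abs)
    then have "\<bar>\<Sum>s\<in>?A. g s * real_character k n s\<bar> \<le> c"
      using c by (simp add: abs_mult abs_real_character)
    ultimately show "0 \<le> (\<Sum>s\<in>?A. (c * of_bool (\<forall>i<k. \<not> s i) + g s) * real_character k n s)"
      by linarith
  qed
qed

lemma maximal_in_flipped_P_B: "maximal_in (flipped_P t) \<B>"
proof -
  have "C = \<B>" if C: "omega_clone C" "flipped_P t \<subset> C" for C
  proof -
    interpret scaled_omega_clone C
      using C nullary_subset_flipped_P by unfold_locales auto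
    obtain k f where f: "(k, f) \<in> C" "(k, f) \<notin> flipped_P t" using C(2) by auto
    let ?F = "asg k f" and ?A = "{..<k} \<rightarrow>\<^sub>E (UNIV :: bool set)"
    have "(\<lambda>s. complex_of_real (?F (\<lambda>i. s i \<noteq> t))) \<notin> pos_def bool_spin {..<k}"
      using f subset_B by (auto simp: flipped_P_def asg_class_def)
    then obtain n where n: "(\<Sum>s\<in>?A. ?F (\<lambda>i. s i \<noteq> t) * real_character k n s) < 0"
      by (subst (asm) real_pos_def_iff) (auto simp: not_le intro!: asg_cong)
    define S0 S where "S0 = (\<Sum>s\<in>?A. ?F (\<lambda>i. s i \<noteq> t))"
      and "S = (\<Sum>s\<in>?A. ?F (\<lambda>i. s i \<noteq> t) * real_character k n s)"
    define \<sigma> :: "bool \<Rightarrow> real" where "\<sigma> b = (if b then - 1 else 1)" for b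
    have sigma: "complex_of_real (\<sigma> b) = bool_spin b" for b by (simp add: \<sigma>_def bool_spin_def)
    \<comment> \<open>Couples a new variable to the character that witnesses failure. The value is
      non-negative because a real character is 1 or -1, and in flipped coordinates it is half the
      sum of two characters. Summing out the arguments of \<open>f\<close> exposes
      \<open>S\<close>.\<close>
    let ?E = "\<lambda>s. (1 + \<sigma> (s 0 \<noteq> t) * real_character k n (\<lambda>i. s (Suc i) \<noteq> t)) / 2"
    have "expressible (flipped_P t) (1 + k) ?E"
      unfolding flipped_P_def
    proof (rule expressible_asg_class)
      show "0 \<le> ?E s" for s
        using real_character_bounds [of k n "\<lambda>i. s (Suc i) \<noteq> t"] by (auto simp: \<sigma>_def)
      show "?E s = ?E s'" if "\<And>i. i < 1 + k \<Longrightarrow> s i = s' i" for s s'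
        using that real_character_cong [of k "\<lambda>i. s (Suc i) \<noteq> t" "\<lambda>i. s' (Suc i) \<noteq> t" n] by simp
      have "(\<lambda>s. character bool_spin {..<k} n (\<lambda>i. s (Suc i))) \<in> pos_def bool_spin {..<1 + k}"
        by (rule pos_def_rename [OF pos_def_character]) auto
      then have "(\<lambda>s. 1/2 * (1 + bool_spin (s 0) * character bool_spin {..<k} n (\<lambda>i. s (Suc i)))) \<in> pos_def bool_spin {..<1 + k}"
        by (intro pos_def_scale pos_def_add pos_def_const pos_def_gen_mult half_nonneg)
          (auto simp: less_eq_complex_def)
      moreover have "((b \<noteq> t) \<noteq> t) = b" for b by auto
      ultimately show "(\<lambda>s. complex_of_real (?E (\<lambda>i. s i \<noteq> t))) \<in> pos_def bool_spin {..<1 + k}"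
        by (simp add: sigma of_real_character)
    qed
    then have "expressible C (1 + k) ?E" using C(2) by (auto intro: expressible_subset)
    moreover have "expressible C (1 + k) (\<lambda>s. ?F (\<lambda>i. s (Suc i)))"
      by (rule rename [OF expressibleI [OF f(1)]]) simp
    ultimately have "expressible C (1 + k) (\<lambda>s. ?F (\<lambda>i. s (Suc i)) * ?E s)" by (intro mult)
    from sum_many [OF this]
    have "expressible C 1 (\<lambda>s. \<Sum>y\<in>?A. ?F y * ((1 + \<sigma> (s 0 \<noteq> t) * real_character k n (\<lambda>i. y i \<noteq> t)) / 2))"
      by simp
    moreover have "(\<Sum>y\<in>?A. ?F y * ((1 + \<sigma> b * real_character k n (\<lambda>i. y i \<noteq> t)) / 2)) = (S0 + \<sigma> b * S) / 2" for b
    proof -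
      let ?g = "\<lambda>y. ?F (\<lambda>i. y i \<noteq> t) * ((1 + \<sigma> b * real_character k n y) / 2)"
      have "(\<Sum>y\<in>?A. ?F y * ((1 + \<sigma> b * real_character k n (\<lambda>i. y i \<noteq> t)) / 2)) = (\<Sum>y\<in>?A. ?g (\<lambda>i. y i \<noteq> t))"
        by (intro sum.cong refl arg_cong2 [where f = "(*)"] asg_cong) auto
      also have "\<dots> = (\<Sum>y\<in>?A. ?g y)"
        by (rule sum_assignments_flip)
          (auto intro!: arg_cong2 [where f = "(*)"] asg_cong simp: real_character_def)
      also have "\<dots> = (S0 + \<sigma> b * S) / 2"
        unfolding S0_def S_def
        by (simp add: sum_distrib_left sum.distrib [symmetric] sum_divide_distrib algebra_simps)
      finally show ?thesis .
    qed
    ultimately have u: "expressible C 1 (\<lambda>s. (S0 + \<sigma> (s 0 \<noteq> t) * S) / 2)" by (simp only:)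
    \<comment> \<open>As \<open>S\<close> is negative, the unary function is larger where its sign
      is -1, that is at \<open>\<not> t\<close>.\<close>
    have delta: "expressible C (Suc k) (\<lambda>s. of_bool (s k = (\<not> t)))" for k
      by (rule unary_delta [where u = "\<lambda>b. (S0 + \<sigma> (b \<noteq> t) * S) / 2", OF u])
        (use n in \<open>simp add: \<sigma>_def S_def\<close>)
    show ?thesis
    proof (rule B_subsetI)
      fix k g assume g: "g \<in> \<B>\<^sub>a k"
      let ?g = "\<lambda>s. asg k g (\<lambda>i. s i \<noteq> t)"
      define c where "c = (\<Sum>s\<in>{..<k} \<rightarrow>\<^sub>E UNIV. \<bar>?g s\<bar>)"
      let ?p = "\<lambda>s. complex_of_real (c * of_bool (\<forall>i<k. \<not> s i) + ?g s)"
        and ?m = "\<lambda>s. complex_of_real (c * of_bool (\<forall>i<k. \<not> s i) + - ?g s)"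
      have c: "0 \<le> c" unfolding c_def by (rule sum_nonneg) simp
      \<comment> \<open>The target \<open>g\<close> sits at the pinned value
        \<open>\<not> t\<close>, a point mass at \<open>t\<close>. In flipped coordinates this is
        half of \<open>?p\<close> plus the spin of \<open>s k\<close> times half of
        \<open>?m\<close>, and the mass \<open>c\<close> dominates \<open>g\<close> with either
        sign.\<close>
      let ?G = "\<lambda>s. if s k = t then c * of_bool (\<forall>i<k. s i = t) else asg k g s"
      have "expressible (flipped_P t) (Suc k) ?G"
        unfolding flipped_P_def
      proof (rule expressible_asg_class)
        show "0 \<le> ?G s" for s using c asg_nonneg [OF g] by simp
        show "?G s = ?G s'" if "\<And>i. i < Suc k \<Longrightarrow> s i = s' i" for s s'
          using that asg_cong [of k s s' g] by simp
        have "?p \<in> pos_def bool_spin {..<k}"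
          "?m \<in> pos_def bool_spin {..<k}"
          by (rule pos_def_dominated; auto simp: c_def intro!: asg_cong)+
        moreover have "{..<k} \<subseteq> {..<Suc k}" by auto
        ultimately
        have "?p \<in> pos_def bool_spin {..<Suc k}"
          "?m \<in> pos_def bool_spin {..<Suc k}"
          by (blast intro: pos_def_mono)+
        then have "(\<lambda>s. 1/2 * (?p s +
            bool_spin (s k) * ?m s)) \<in> pos_def bool_spin {..<Suc k}" (is "?H \<in> _")
          by (intro pos_def_scale pos_def_add pos_def_gen_mult half_nonneg) auto
        also have "?H =
            (\<lambda>s. complex_of_real (?G (\<lambda>i. s i \<noteq> t)))" (is "?L = ?R")
        proof
          fix s :: "nat \<Rightarrow> bool"
          have "(\<forall>i<k. (s i \<noteq> t) = t) = (\<forall>i<k. \<not> s i)" "((s k \<noteq> t) = t) = (\<not> s k)" by auto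
          then show "?L s = ?R s"
            by (simp only:) (cases "s k"; simp add: bool_spin_def)
        qed
        finally show "(\<lambda>s. complex_of_real (?G (\<lambda>i. s i \<noteq> t))) \<in> pos_def bool_spin {..<Suc k}" .
      qed
      then have "expressible C (Suc k) (\<lambda>s. ?G s * of_bool (s k = (\<not> t)))"
        using C(2) by (intro mult delta) (auto intro: expressible_subset)
      from sum_last [OF this]
      have "expressible C k (\<lambda>s. \<Sum>b\<in>UNIV. ?G (s(k := b)) * of_bool ((s(k := b)) k = (\<not> t)))" .
      also have "\<dots> = asg k g"
      proof
        fix s
        have "asg k g (s(k := \<not> t)) = asg k g s" by (rule asg_cong) auto
        then show "(\<Sum>b\<in>UNIV. ?G (s(k := b)) * of_bool ((s(k := b)) k = (\<not> t))) = asg k g s"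
          unfolding fun_upd_same sum_bool_delta by simp
      qed
      finally show "expressible C k (asg k g)" .
    qed
  qed
  then show ?thesis
    unfolding maximal_in_def using omega_clone_flipped_P [of t] closed_under_ops_B closed_under_limits_B EQ_in_B
    by (auto simp: omega_clone_iff)
qed

section \<open>Maximality of SDP in SD\<close>

lemma pos_def_symmetrize:
  assumes "F \<in> pos_def bool_spin V"
  shows "(\<lambda>s. F s + F (\<lambda>i. \<not> s i)) \<in> pos_def bool_spin V"
proof -
  \<comment> \<open>Multiplication by a spin exchanges the parts that are even and odd under the
    global flip, so the induction carries both.\<close>
  have "(\<lambda>s. F s + F (\<lambda>i. \<not> s i)) \<in> pos_def bool_spin V \<and> (\<lambda>s. F s - F (\<lambda>i. \<not> s i)) \<in> pos_def bool_spin V"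
    using assms
  proof (induction rule: pos_def.induct)
    case (pos_def_const c)
    then have "0 \<le> c + c" by (rule add_nonneg_nonneg) (rule pos_def_const)
    then show ?case using pos_def.pos_def_const [of "c + c" bool_spin V] pos_def.pos_def_const [of 0 bool_spin V]
      by simp
  next
    case (pos_def_add F G)
    have "(\<lambda>s. (F s + F (\<lambda>i. \<not> s i)) + (G s + G (\<lambda>i. \<not> s i))) \<in> pos_def bool_spin V"
      "(\<lambda>s. (F s - F (\<lambda>i. \<not> s i)) + (G s - G (\<lambda>i. \<not> s i))) \<in> pos_def bool_spin V"
      using pos_def_add.IH by (auto intro: pos_def.pos_def_add)
    then show ?case by (simp add: algebra_simps)
  next
    case (pos_def_gen_mult v F)
    have "(\<lambda>s. bool_spin (s v) * (F s + F (\<lambda>i. \<not> s i))) \<in> pos_def bool_spin V"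
      "(\<lambda>s. bool_spin (s v) * (F s - F (\<lambda>i. \<not> s i))) \<in> pos_def bool_spin V"
      using pos_def_gen_mult by (auto intro: pos_def.pos_def_gen_mult)
    moreover have "bool_spin (\<not> b) = - bool_spin b" for b by (simp add: bool_spin_def)
    ultimately show ?case by (simp add: algebra_simps)
  qed
  then show ?thesis ..
qed

lemma maximal_in_SDP_SD: "maximal_in \<S>\<D>\<P> \<S>\<D>"
proof -
  have "\<S>\<D> \<subseteq> C" if C: "omega_clone C" "\<S>\<D>\<P> \<subset> C" "C \<subseteq> \<S>\<D>" for C
  proof -
    interpret scaled_omega_clone C
      using C nullary_subset_SDP by unfold_locales auto
    obtain k f where f: "(k, f) \<in> C" "(k, f) \<notin> \<S>\<D>\<P>" using C(2) by auto
    let ?F = "asg k f" and ?A = "{..<k} \<rightarrow>\<^sub>E (UNIV :: bool set)"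
    have sd: "?F (\<lambda>i. \<not> s i) = ?F s" for s using f C(3) by (auto simp: SD_eq asg_class_def)
    have "(\<lambda>s. complex_of_real (?F s)) \<notin> pos_def bool_spin {..<k}"
      using f C(3) sd by (auto simp: SDP_asg_class asg_class_def \<S>\<D>_def)
    then obtain n where n: "(\<Sum>s\<in>?A. ?F s * real_character k n s) < 0"
      by (subst (asm) real_pos_def_iff) (auto simp: not_le intro!: asg_cong)
    define S0 S where "S0 = (\<Sum>s\<in>?A. ?F s)" and "S = (\<Sum>s\<in>?A. ?F s * real_character k n s)"
    \<comment> \<open>The flip multiplies \<open>S\<close> by -1 to the total exponent; since
      \<open>S\<close> is not 0, that exponent is even.\<close>
    have "S = (\<Sum>s\<in>?A. ?F (\<lambda>i. s i \<noteq> True) * real_character k n (\<lambda>i. s i \<noteq> True))"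
      unfolding S_def
      by (rule sum_assignments_flip [where g = "\<lambda>s. ?F s * real_character k n s", symmetric])
        (auto intro!: arg_cong2 [where f = "(*)"] asg_cong simp: real_character_def)
    also have "\<dots> = (- 1) ^ (\<Sum>i<k. n i) * S"
      by (simp add: sd real_character_flip S_def sum_distrib_left ac_simps)
    finally have even: "even (\<Sum>i<k. n i)" using n by (cases "even (\<Sum>i<k. n i)") (auto simp: S_def)
    define \<sigma> :: "bool \<Rightarrow> real" where "\<sigma> b = (if b then - 1 else 1)" for b
    have sigma: "complex_of_real (\<sigma> b) = bool_spin b" for b by (simp add: \<sigma>_def bool_spin_def)
    \<comment> \<open>Two new variables instead of one: the product of their signs is invariant
      under the global flip, and so is the character of even total exponent. This keeps
      \<open>?E\<close> self-dual.\<close>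
    let ?E = "\<lambda>s. (1 + \<sigma> (s 0) * (\<sigma> (s 1) * real_character k n (\<lambda>i. s (2 + i)))) / 2"
    have "expressible \<S>\<D>\<P> (2 + k) ?E"
      unfolding SDP_asg_class
    proof (rule expressible_asg_class; (intro conjI allI)?)
      show "0 \<le> ?E s" for s
        using real_character_bounds [of k n "\<lambda>i. s (2 + i)"] by (auto simp: \<sigma>_def)
      show "?E s = ?E s'" if "\<And>i. i < 2 + k \<Longrightarrow> s i = s' i" for s s'
        using that real_character_cong [of k "\<lambda>i. s (2 + i)" "\<lambda>i. s' (2 + i)" n] by simp
      show "?E s = ?E (\<lambda>i. \<not> s i)" for s
        using even by (simp add: real_character_flip \<sigma>_def)
      have "(\<lambda>s. character bool_spin {..<k} n (\<lambda>i. s (2 + i))) \<in> pos_def bool_spin {..<2 + k}"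
        by (rule pos_def_rename [OF pos_def_character]) auto
      then have "(\<lambda>s. 1/2 * (1 + bool_spin (s 0) * (bool_spin (s 1) * character bool_spin {..<k} n (\<lambda>i. s (2 + i))))) \<in> pos_def bool_spin {..<2 + k}"
        by (intro pos_def_scale pos_def_add pos_def_const pos_def_gen_mult half_nonneg)
          (auto simp: less_eq_complex_def)
      then show "(\<lambda>s. complex_of_real (?E s)) \<in> pos_def bool_spin {..<2 + k}"
        by (simp add: sigma of_real_character)
    qed
    then have "expressible C (2 + k) ?E" using C(2) by (auto intro: expressible_subset)
    moreover have "expressible C (2 + k) (\<lambda>s. ?F (\<lambda>i. s (2 + i)))"
      by (rule rename [OF expressibleI [OF f(1)]]) simp
    ultimately have "expressible C (2 + k) (\<lambda>s. ?F (\<lambda>i. s (2 + i)) * ?E s)" by (intro mult)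
    from sum_many [OF this]
    have "expressible C 2 (\<lambda>s. \<Sum>y\<in>?A. ?F y * ((1 + \<sigma> (s 0) * (\<sigma> (s 1) * real_character k n y)) / 2))"
      by simp
    moreover have "(\<Sum>y\<in>?A. ?F y * ((1 + \<sigma> a * (\<sigma> b * real_character k n y)) / 2)) = (S0 + \<sigma> a * \<sigma> b * S) / 2" for a b
      unfolding S0_def S_def
      by (simp add: sum_distrib_left sum.distrib [symmetric] sum_divide_distrib algebra_simps)
    ultimately have u: "expressible C 2 (\<lambda>s. (S0 + \<sigma> (s 0) * \<sigma> (s 1) * S) / 2)" by (simp only:)
    \<comment> \<open>Non-negativity at equal arguments and \<open>S < 0\<close> make the value at
      unequal arguments the positive maximum. Divided by it, the powers converge to
      disequality.\<close>
    have "0 \<le> (S0 + S) / 2"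
      using expressible_B_nonneg [OF expressible_subset [OF u subset_B], of "\<lambda>_. False"] by (simp add: \<sigma>_def)
    with n have q: "0 < S0 - S" "0 \<le> S0 + S" "S < 0" by (simp_all add: S_def)
    have "expressible C 2 (\<lambda>s. 2 / (S0 - S) * ((S0 + \<sigma> (s 0) * \<sigma> (s 1) * S) / 2))"
      using q by (intro scale u) auto
    then have "expressible C 2 (\<lambda>s. of_bool (2 / (S0 - S) * ((S0 + \<sigma> (s 0) * \<sigma> (s 1) * S) / 2) = 1))"
      using q by (intro level_one) (auto simp: \<sigma>_def field_simps)
    also have "\<dots> = (\<lambda>s. of_bool (s 0 \<noteq> s 1) :: real)"
      using q by (auto simp: \<sigma>_def fun_eq_iff field_simps)
    finally have neq: "expressible C (Suc (Suc k)) (\<lambda>s. of_bool (s k \<noteq> s (Suc k)))" for k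
      by (rule rename2) auto
    show "\<S>\<D> \<subseteq> C"
    proof clarify
      fix k g assume gSD: "(k, g) \<in> \<S>\<D>"
      then have g: "g \<in> \<B>\<^sub>a k" and gsd: "\<And>s. asg k g (\<lambda>i. \<not> s i) = asg k g s"
        by (auto simp: SD_eq asg_class_def \<B>_def)
      let ?g = "asg k g"
      \<comment> \<open>Symmetrising doubles the self-dual function, so \<open>?g / 2\<close> is
        what has to be dominated. The single point mass becomes the pair of masses in
        \<open>?h\<close>.\<close>
      define c where "c = (\<Sum>s\<in>{..<k} \<rightarrow>\<^sub>E UNIV. \<bar>?g s / 2\<bar>)"
      have c: "0 \<le> c" unfolding c_def by (rule sum_nonneg) simp
      let ?h = "\<lambda>s. c * of_bool (\<forall>i<k. \<not> s i) + c * of_bool (\<forall>i<k. s i)"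
      let ?p = "\<lambda>s. complex_of_real (?h s + ?g s)" and ?m = "\<lambda>s. complex_of_real (?h s - ?g s)"
      let ?G = "\<lambda>s. if s k = s (Suc k) then ?h s else ?g s"
      have "expressible \<S>\<D>\<P> (Suc (Suc k)) ?G"
        unfolding SDP_asg_class
      proof (rule expressible_asg_class; (intro conjI allI)?)
        show "0 \<le> ?G s" for s using c asg_nonneg [OF g] by simp
        show "?G s = ?G s'" if "\<And>i. i < Suc (Suc k) \<Longrightarrow> s i = s' i" for s s'
          using that asg_cong [of k s s' g] by simp
        show "?G s = ?G (\<lambda>i. \<not> s i)" for s
          by (simp add: gsd)
        have "(\<lambda>s. complex_of_real (c * of_bool (\<forall>i<k. \<not> s i) + ?g s / 2)) \<in> pos_def bool_spin {..<k}"
          "(\<lambda>s. complex_of_real (c * of_bool (\<forall>i<k. \<not> s i) + - ?g s / 2)) \<in> pos_def bool_spin {..<k}"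
          by (rule pos_def_dominated; auto simp: c_def intro!: asg_cong)+
        from this [THEN pos_def_symmetrize]
        have "?p \<in> pos_def bool_spin {..<k}"
          "?m \<in> pos_def bool_spin {..<k}"
          by (simp_all add: gsd algebra_simps)
        moreover have "{..<k} \<subseteq> {..<Suc (Suc k)}" by auto
        ultimately
        have "?p \<in> pos_def bool_spin {..<Suc (Suc k)}"
          "?m \<in> pos_def bool_spin {..<Suc (Suc k)}"
          by (blast intro: pos_def_mono)+
        then have "(\<lambda>s. 1/2 * (?p s +
            bool_spin (s k) * (bool_spin (s (Suc k)) * ?m s))) \<in> pos_def bool_spin {..<Suc (Suc k)}" (is "?H \<in> _")
          by (intro pos_def_scale pos_def_add pos_def_gen_mult half_nonneg) auto
        also have "?H =
            (\<lambda>s. complex_of_real (?G s))" (is "?L = ?R")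
        proof
          fix s :: "nat \<Rightarrow> bool"
          show "?L s = ?R s"
            by (cases "s k"; cases "s (Suc k)"; simp add: bool_spin_def)
        qed
        finally show "(\<lambda>s. complex_of_real (?G s)) \<in> pos_def bool_spin {..<Suc (Suc k)}" .
      qed
      then have "expressible C (Suc (Suc k)) (\<lambda>s. ?G s * of_bool (s k \<noteq> s (Suc k)))"
        using C(2) by (intro mult neq) (auto intro: expressible_subset)
      \<comment> \<open>Two settings of the auxiliary pair are unequal and each contributes
        \<open>?g\<close>; hence the factor 1/2.\<close>
      from scale [OF sum_last [OF sum_last [OF this]], of "1/2"]
      have "expressible C k (\<lambda>s. 1/2 * (\<Sum>a\<in>UNIV. \<Sum>b\<in>UNIV. ?G (s(k := a, Suc k := b)) *
          of_bool ((s(k := a, Suc k := b)) k \<noteq> (s(k := a, Suc k := b)) (Suc k))))" by simp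
      also have "\<dots> = ?g" (is "?L = ?R")
      proof
        fix s
        have "?g (s(k := a, Suc k := b)) = ?g s" for a b by (rule asg_cong) auto
        then show "?L s = ?R s"
          by (simp add: UNIV_bool)
      qed
      finally show "(k, g) \<in> C" using subset_B g by (intro expressibleD)
    qed
  qed
  then show ?thesis
    unfolding maximal_in_def using omega_clone_SDP omega_clone_SD by (auto simp: SDP_eq(1))
qed

section \<open>Expansion of the functions implemented by circuits\<close>

definition real_spin :: "bool \<Rightarrow> real" where
  "real_spin b = (if b then - 1 else 1)"

lemma of_real_spin: "complex_of_real (real_spin b) = bool_spin b"
  by (simp add: real_spin_def bool_spin_def)

lemma real_spin_not: "real_spin (\<not> b) = - real_spin b"
  by (simp add: real_spin_def)

lemma sum_real_spin_power: "(\<Sum>b\<in>UNIV. real_spin b ^ d) = 2 * of_bool (even d)"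
  by (simp add: UNIV_bool real_spin_def)

lemma real_fourier_inversion:
  "asg k f s = (\<Sum>m\<in>{..<k} \<rightarrow>\<^sub>E {..<2}. fourier k f (map (\<lambda>i. odd (m i)) [0..<k]) * real_character k m s)"
proof -
  have dep: "complex_of_real (asg k f x) = complex_of_real (asg k f y)" if "\<And>v. v \<in> {..<k} \<Longrightarrow> x v = y v" for x y
    using that by (auto intro!: asg_cong)
  have "complex_of_real (asg k f s) = (\<Sum>m\<in>{..<k} \<rightarrow>\<^sub>E {..<2}. (\<Sum>y\<in>{..<k} \<rightarrow>\<^sub>E UNIV. complex_of_real (asg k f y) *
      character bool_spin {..<k} m y) * character bool_spin {..<k} (\<lambda>v. (2 - 1) * m v) s) / of_nat 2 ^ card {..<k}"
    by (rule spin.fourier_inversion [OF finite_lessThan]) (rule dep)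
  also have "\<dots> = of_real (\<Sum>m\<in>{..<k} \<rightarrow>\<^sub>E {..<2}. fourier k f (map (\<lambda>i. odd (m i)) [0..<k]) * real_character k m s)"
    by (subst sum_divide_distrib) (simp add: fourier_character of_real_character)
  finally show ?thesis by (simp only: of_real_eq_iff)
qed

lemma circuit_graph_finite: "circuit_graph k n E \<Longrightarrow> finite E"
proof -
  assume "circuit_graph k n E"
  then have "E \<subseteq> Pow (circuit_vertices k n)" by (auto simp: circuit_graph_def)
  moreover have "finite (Pow (circuit_vertices k n))" by (simp add: circuit_vertices_def)
  ultimately show ?thesis by (rule finite_subset)
qed

lemma circuit_graph_terminal:
  assumes "circuit_graph k n E" "i < k"
  shows "terminal E i \<in> E" "External i \<in> terminal E i"
    and "e \<in> E \<Longrightarrow> External i \<in> e \<longleftrightarrow> e = terminal E i"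
proof -
  have "card {e \<in> E. External i \<in> e} = 1" using assms by (simp add: circuit_graph_def)
  then obtain d where d: "{e \<in> E. External i \<in> e} = {d}" by (auto simp: card_1_singleton_iff)
  then have mem: "e \<in> E \<and> External i \<in> e \<longleftrightarrow> e = d" for e by (simp add: set_eq_iff)
  then have ex1: "\<exists>!e. e \<in> E \<and> External i \<in> e" by simp
  from theI' [OF this] show *: "terminal E i \<in> E" "External i \<in> terminal E i"
    by (simp_all add: terminal_def)
  show "External i \<in> e \<longleftrightarrow> e = terminal E i" if "e \<in> E"
    using that * mem [of e] mem [of "terminal E i"] by simp
qed

definition edge_sign :: "(cvertex \<Rightarrow> bool) \<Rightarrow> cvertex set \<Rightarrow> real" where
  "edge_sign \<rho> e = (\<Prod>v\<in>e. real_spin (\<rho> v))"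

lemma edge_sign_split:
  assumes "e \<subseteq> circuit_vertices k n"
  shows "edge_sign \<rho> e = (\<Prod>i<k. if External i \<in> e then real_spin (\<rho> (External i)) else 1) *
    (\<Prod>j<n. if Internal j \<in> e then real_spin (\<rho> (Internal j)) else 1)"
proof -
  let ?g = "\<lambda>v. if v \<in> e then real_spin (\<rho> v) else 1"
  have "edge_sign \<rho> e = (\<Prod>v\<in>circuit_vertices k n. ?g v)"
    unfolding edge_sign_def
    using assms by (subst prod.inter_restrict [symmetric]) (auto simp: circuit_vertices_def Int_absorb1)
  also have "\<dots> = prod ?g (External ` {..<k}) * prod ?g (Internal ` {..<n})"
    unfolding circuit_vertices_def by (rule prod.union_disjoint) auto
  also have "\<dots> = (\<Prod>i<k. ?g (External i)) * (\<Prod>j<n. ?g (Internal j))"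
    by (simp add: prod.reindex inj_on_def)
  finally show ?thesis .
qed

text \<open>Fourier inversion sums over tuples and then over the edge sets that use exactly the
  prescribed terminals. Every admissible \<open>H\<close> occurs for one tuple only, so the two sums
  merge and its character splits over the edges of \<open>H\<close>. The product over
  \<open>i\<close> inside each edge also covers an edge that is the terminal of two external
  vertices.\<close>

lemma circuit_expansion:
  assumes G: "circuit_graph k n E"
    and f: "\<And>y. y \<in> tuples k \<Longrightarrow> fourier k f y = circuit_value deg k n E w y"
  shows "asg k f s = (\<Sum>H | H \<subseteq> E \<and> (\<forall>j<n. deg (card {e \<in> H. Internal j \<in> e})).
    \<Prod>e\<in>H. w e * (\<Prod>i<k. if External i \<in> e then real_spin (s i) else 1))"
proof -
  let ?D = "{H. H \<subseteq> E \<and> (\<forall>j<n. deg (card {e \<in> H. Internal j \<in> e}))}"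
  let ?N = "{..<k} \<rightarrow>\<^sub>E {..<2 :: nat}"
  let ?m = "\<lambda>H. \<lambda>i\<in>{..<k}. of_bool (terminal E i \<in> H) :: nat"
  have fin: "finite ?D" "finite ?N" using circuit_graph_finite [OF G] by (auto intro: finite_PiE)
  have val: "fourier k f (map (\<lambda>i. odd (m i)) [0..<k]) * real_character k m s =
      (\<Sum>H\<in>?D. if m = ?m H then (\<Prod>e\<in>H. w e) * real_character k m s else 0)" if m: "m \<in> ?N" for m
  proof -
    have "(\<forall>i<k. terminal E i \<in> H \<longleftrightarrow> map (\<lambda>i. odd (m i)) [0..<k] ! i) \<longleftrightarrow> m = ?m H" for H
    proof
      assume a: "\<forall>i<k. terminal E i \<in> H \<longleftrightarrow> map (\<lambda>i. odd (m i)) [0..<k] ! i"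
      show "m = ?m H"
      proof (rule PiE_ext [OF m])
        fix i assume i: "i \<in> {..<k}"
        with m have "m i < 2" by auto
        with a i show "m i = ?m H i" by (auto simp: less_2_cases_iff)
      qed auto
    next
      assume "m = ?m H"
      then have "m i = of_bool (terminal E i \<in> H)" if "i < k" for i using that by simp
      then show "\<forall>i<k. terminal E i \<in> H \<longleftrightarrow> map (\<lambda>i. odd (m i)) [0..<k] ! i" by simp
    qed
    then have "{H. H \<subseteq> E \<and> (\<forall>i<k. terminal E i \<in> H \<longleftrightarrow> map (\<lambda>i. odd (m i)) [0..<k] ! i) \<and>
        (\<forall>j<n. deg (card {e \<in> H. Internal j \<in> e}))} = {H \<in> ?D. m = ?m H}" by blast
    then have "fourier k f (map (\<lambda>i. odd (m i)) [0..<k]) = (\<Sum>H\<in>{H \<in> ?D. m = ?m H}. \<Prod>e\<in>H. w e)"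
      by (simp only: f [OF map_upt_in_tuples] circuit_value_def)
    also have "\<dots> = (\<Sum>H\<in>?D. if m = ?m H then (\<Prod>e\<in>H. w e) else 0)"
      by (rule sum.inter_filter [OF fin(1)])
    finally show ?thesis by (simp add: sum_distrib_right if_distrib [of "\<lambda>x. x * _"] cong: if_cong)
  qed
  have "asg k f s = (\<Sum>m\<in>?N. \<Sum>H\<in>?D. if m = ?m H then (\<Prod>e\<in>H. w e) * real_character k m s else 0)"
    unfolding real_fourier_inversion by (rule sum.cong [OF refl val])
  also have "\<dots> = (\<Sum>H\<in>?D. \<Sum>m\<in>?N. if m = ?m H then (\<Prod>e\<in>H. w e) * real_character k m s else 0)"
    by (rule sum.swap)
  also have "\<dots> = (\<Sum>H\<in>?D. (\<Prod>e\<in>H. w e) * real_character k (?m H) s)"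
  proof (rule sum.cong [OF refl])
    fix H
    have "?m H \<in> ?N" by auto
    then show "(\<Sum>m\<in>?N. if m = ?m H then (\<Prod>e\<in>H. w e) * real_character k m s else 0) =
        (\<Prod>e\<in>H. w e) * real_character k (?m H) s"
      by (simp add: sum.delta [OF fin(2)] del: restrict_apply)
  qed
  also have "\<dots> = (\<Sum>H\<in>?D. \<Prod>e\<in>H. w e * (\<Prod>i<k. if External i \<in> e then real_spin (s i) else 1))"
  proof (rule sum.cong [OF refl])
    fix H assume "H \<in> ?D"
    then have H: "H \<subseteq> E" "finite H" using circuit_graph_finite [OF G] finite_subset by auto
    have "real_character k (?m H) s = (\<Prod>i<k. if terminal E i \<in> H then real_spin (s i) else 1)"
      by (auto simp: real_character_def real_spin_def intro!: prod.cong)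
    also have "\<dots> = (\<Prod>i<k. \<Prod>e\<in>H. if External i \<in> e then real_spin (s i) else 1)"
    proof (rule prod.cong [OF refl])
      fix i assume "i \<in> {..<k}"
      then have "(\<Prod>e\<in>H. if External i \<in> e then real_spin (s i) else 1) =
          (\<Prod>e\<in>H. if e = terminal E i then real_spin (s i) else 1)"
        using H circuit_graph_terminal(3) [OF G] by (intro prod.cong) auto
      then show "(if terminal E i \<in> H then real_spin (s i) else 1) =
          (\<Prod>e\<in>H. if External i \<in> e then real_spin (s i) else 1)"
        using H by (simp add: prod.delta)
    qed
    also have "\<dots> = (\<Prod>e\<in>H. \<Prod>i<k. if External i \<in> e then real_spin (s i) else 1)"
      by (rule prod.swap)
    finally show "(\<Prod>e\<in>H. w e) * real_character k (?m H) s =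
        (\<Prod>e\<in>H. w e * (\<Prod>i<k. if External i \<in> e then real_spin (s i) else 1))"
      by (simp add: prod.distrib)
  qed
  finally show ?thesis .
qed

lemma sum_filter_prod:
  assumes "finite E"
  shows "(\<Sum>H | H \<subseteq> E \<and> P H. g H) = (\<Sum>H\<in>Pow E. g H * of_bool (P H) :: real)"
proof -
  have "(\<Sum>H\<in>{H \<in> Pow E. P H}. g H) = (\<Sum>H\<in>Pow E. if P H then g H else 0)"
    using assms by (intro sum.inter_filter) simp
  also have "\<dots> = (\<Sum>H\<in>Pow E. g H * of_bool (P H))" by (rule sum.cong) auto
  finally show ?thesis by (simp add: Pow_def)
qed

lemma of_bool_ball_prod: "finite I \<Longrightarrow> (of_bool (\<forall>i\<in>I. P i) :: real) = (\<Prod>i\<in>I. of_bool (P i))"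
  by (induction I rule: finite_induct) auto

text \<open>The high-temperature expansion of the Ising model, read backwards: the parity constraint at
  an internal vertex is an average over a spin at this vertex.\<close>

lemma even_circuit_expansion:
  assumes G: "circuit_graph k n E"
    and f: "\<And>y. y \<in> tuples k \<Longrightarrow> fourier k f y = circuit_value even k n E w y"
  shows "asg k f s = (\<Sum>t\<in>{..<n} \<rightarrow>\<^sub>E UNIV. \<Prod>e\<in>E. 1 + w e * edge_sign (case_cvertex s t) e) / 2 ^ n"
proof -
  let ?x = "\<lambda>e. \<Prod>i<k. if External i \<in> e then real_spin (s i) else 1"
  let ?y = "\<lambda>t :: nat \<Rightarrow> bool. \<lambda>e. \<Prod>j<n. if Internal j \<in> e then real_spin (t j) else 1"
  let ?s = "\<lambda>t e. edge_sign (case_cvertex s t) e"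
  have circuit: "asg k f s = (\<Sum>H | H \<subseteq> E \<and> (\<forall>j<n. even (card {e \<in> H. Internal j \<in> e})). \<Prod>e\<in>H. w e * ?x e)"
    by (rule circuit_expansion [OF G]) (rule f)
  have fin: "finite E" by (rule circuit_graph_finite [OF G])
  have ind: "of_bool (\<forall>j<n. even (card {e \<in> H. Internal j \<in> e})) =
      (\<Sum>t\<in>{..<n} \<rightarrow>\<^sub>E UNIV. \<Prod>e\<in>H. ?y t e) / 2 ^ n"
    if H: "finite H" for H
  proof -
    have "(of_bool (\<forall>j<n. even (card {e \<in> H. Internal j \<in> e})) :: real) =
        (\<Prod>j<n. (\<Sum>b\<in>UNIV. real_spin b ^ card {e \<in> H. Internal j \<in> e}) / 2)"
      using of_bool_ball_prod [of "{..<n}" "\<lambda>j. even (card {e \<in> H. Internal j \<in> e})"]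
      by (simp add: sum_real_spin_power Ball_def)
    also have "\<dots> = (\<Prod>j<n. \<Sum>b\<in>UNIV. real_spin b ^ card {e \<in> H. Internal j \<in> e}) / 2 ^ n"
      by (simp add: prod_dividef)
    also have "(\<Prod>j<n. \<Sum>b\<in>UNIV. real_spin b ^ card {e \<in> H. Internal j \<in> e}) =
        (\<Sum>t\<in>{..<n} \<rightarrow>\<^sub>E UNIV. \<Prod>j<n. real_spin (t j) ^ card {e \<in> H. Internal j \<in> e})"
      by (rule prod_sum_PiE) auto
    also have "\<dots> = (\<Sum>t\<in>{..<n} \<rightarrow>\<^sub>E UNIV. \<Prod>j<n. \<Prod>e\<in>H. if Internal j \<in> e then real_spin (t j) else 1)"
      by (simp add: prod.inter_filter [OF H, symmetric])
    also have "\<dots> = (\<Sum>t\<in>{..<n} \<rightarrow>\<^sub>E UNIV. \<Prod>e\<in>H. ?y t e)"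
      by (rule sum.cong [OF refl prod.swap])
    finally show ?thesis .
  qed
  have "asg k f s = (\<Sum>H\<in>Pow E. (\<Prod>e\<in>H. w e * ?x e) *
      ((\<Sum>t\<in>{..<n} \<rightarrow>\<^sub>E UNIV. \<Prod>e\<in>H. ?y t e) / 2 ^ n))"
    unfolding circuit sum_filter_prod [OF fin]
    using fin by (intro sum.cong refl arg_cong2 [where f = "(*)"] ind) (auto intro: finite_subset)
  also have "\<dots> = (\<Sum>H\<in>Pow E. \<Sum>t\<in>{..<n} \<rightarrow>\<^sub>E UNIV. (\<Prod>e\<in>H. w e * ?x e) *
      (\<Prod>e\<in>H. ?y t e)) / 2 ^ n"
    by (simp add: sum_divide_distrib sum_distrib_left)
  also have "(\<Sum>H\<in>Pow E. \<Sum>t\<in>{..<n} \<rightarrow>\<^sub>E UNIV. (\<Prod>e\<in>H. w e * ?x e) *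
      (\<Prod>e\<in>H. ?y t e)) =
      (\<Sum>t\<in>{..<n} \<rightarrow>\<^sub>E UNIV. \<Sum>H\<in>Pow E. (\<Prod>e\<in>H. w e * ?x e) *
      (\<Prod>e\<in>H. ?y t e))"
    by (rule sum.swap)
  also have "\<dots> = (\<Sum>t\<in>{..<n} \<rightarrow>\<^sub>E UNIV. \<Prod>e\<in>E. 1 + w e * ?s t e)"
  proof (rule sum.cong [OF refl])
    fix t :: "nat \<Rightarrow> bool"
    have "(\<Prod>e\<in>E. 1 + w e * ?s t e) =
        (\<Prod>e\<in>E. w e * ?s t e + 1)" by (simp add: add.commute)
    also have "\<dots> = (\<Sum>H\<in>Pow E. (\<Prod>e\<in>H. w e * ?s t e) * (\<Prod>e\<in>E - H. 1))"
      by (rule prod_add [OF fin])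
    also have "\<dots> = (\<Sum>H\<in>Pow E. (\<Prod>e\<in>H. w e * ?x e) *
      (\<Prod>e\<in>H. ?y t e))"
    proof (rule sum.cong [OF refl])
      fix H assume "H \<in> Pow E"
      then have "e \<subseteq> circuit_vertices k n" if "e \<in> H" for e
        using that G by (auto simp: circuit_graph_def)
      then show "(\<Prod>e\<in>H. w e * ?s t e) * (\<Prod>e\<in>E - H. 1) = (\<Prod>e\<in>H. w e * ?x e) *
          (\<Prod>e\<in>H. ?y t e)"
        by (simp add: prod.distrib [symmetric] mult.assoc edge_sign_split [of _ k n] cong: prod.cong if_cong)
    qed
    finally show "(\<Sum>H\<in>Pow E. (\<Prod>e\<in>H. w e * ?x e) *
      (\<Prod>e\<in>H. ?y t e)) =
      (\<Prod>e\<in>E. 1 + w e * ?s t e)" ..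
  qed
  finally show ?thesis .
qed

lemma edge_sign_flip: "card e = 2 \<Longrightarrow> edge_sign (\<lambda>v. \<not> \<rho> v) e = edge_sign \<rho> e"
  by (auto simp: edge_sign_def real_spin_not card_2_iff)

text \<open>The spins \<open>\<tau> (j, e)\<close> sit on the half-edges at internal vertices; averaging over them turns
  \<open>\<Sum>\<^sub>e \<tau> (j, e)\<close> into the constraint that exactly one edge at \<open>j\<close> is used.\<close>

definition half_edges :: "nat \<Rightarrow> cvertex set set \<Rightarrow> (nat \<times> cvertex set) set" where
  "half_edges n E = (SIGMA j:{..<n}. {e \<in> E. Internal j \<in> e})"

definition half_edge_weight ::
  "nat \<Rightarrow> cvertex set set \<Rightarrow> (cvertex set \<Rightarrow> real) \<Rightarrow> (nat \<Rightarrow> bool) \<Rightarrow> (nat \<times> cvertex set \<Rightarrow> bool) \<Rightarrow> real" where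
  "half_edge_weight n E w s \<tau> = (\<Prod>j<n. \<Sum>e | e \<in> E \<and> Internal j \<in> e. real_spin (\<tau> (j, e))) *
     (\<Prod>e\<in>E. 1 + w e * edge_sign (case_cvertex s (\<lambda>j. \<tau> (j, e))) e)"

text \<open>Expanding the product of linear forms chooses one element \<open>c j\<close> at every
  \<open>j\<close>. A sum over spins vanishes unless each spin occurs to an even power, which here
  means that \<open>H\<close> meets \<open>A j\<close> in \<open>c j\<close> alone. So the sum
  counts the choices compatible with \<open>H\<close>: one if \<open>H\<close> meets every
  \<open>A j\<close> exactly once, none otherwise.\<close>

lemma exactly_one_indicator:
  assumes I: "finite I" and A: "\<And>j. j \<in> I \<Longrightarrow> finite (A j)"
  shows "(\<Sum>\<tau>\<in>Sigma I A \<rightarrow>\<^sub>E UNIV. (\<Prod>j\<in>I. \<Sum>e\<in>A j. real_spin (\<tau> (j, e))) *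
      (\<Prod>j\<in>I. \<Prod>e\<in>A j. if e \<in> H then real_spin (\<tau> (j, e)) else 1)) =
    2 ^ card (Sigma I A) * of_bool (\<forall>j\<in>I. card {e \<in> A j. e \<in> H} = 1)" (is "?L = ?R")
proof -
  let ?T = "Sigma I A \<rightarrow>\<^sub>E (UNIV :: bool set)"
  \<comment> \<open>The exponent of the spin at \<open>(j, e)\<close>: one from the choice
    \<open>c\<close>, one from membership in \<open>H\<close>.\<close>
  let ?d = "\<lambda>c j e. of_bool (e = c j) + of_bool (e \<in> H) :: nat"
  let ?z = "\<lambda>\<tau> c. \<Prod>j\<in>I. \<Prod>e\<in>A j. real_spin (\<tau> (j, e)) ^ ?d c j e" and ?h = "\<lambda>\<tau>. \<Prod>j\<in>I. \<Prod>e\<in>A j. if e \<in> H then real_spin (\<tau> (j, e)) else 1"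
  have fS: "finite (Sigma I A)" using assms by simp
  have "?L = (\<Sum>\<tau>\<in>?T. \<Sum>c\<in>PiE I A. ?z \<tau> c)"
  proof (rule sum.cong [OF refl])
    fix \<tau> :: "'a \<times> 'b \<Rightarrow> bool"
    have "(\<Prod>j\<in>I. \<Sum>e\<in>A j. real_spin (\<tau> (j, e))) = (\<Sum>c\<in>PiE I A. \<Prod>j\<in>I. real_spin (\<tau> (j, c j)))"
      using assms by (intro prod_sum_PiE) auto
    moreover have "(\<Prod>j\<in>I. real_spin (\<tau> (j, c j))) * ?h \<tau> =
        ?z \<tau> c" if c: "c \<in> PiE I A" for c
      unfolding prod.distrib [symmetric]
    proof (rule prod.cong [OF refl])
      fix j assume j: "j \<in> I"
      have "real_spin (\<tau> (j, c j)) = (\<Prod>e\<in>A j. if e = c j then real_spin (\<tau> (j, e)) else 1)"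
        using A [OF j] PiE_mem [OF c j] by (simp add: prod.delta)
      then show "real_spin (\<tau> (j, c j)) * (\<Prod>e\<in>A j. if e \<in> H then real_spin (\<tau> (j, e)) else 1) =
          (\<Prod>e\<in>A j. real_spin (\<tau> (j, e)) ^ ?d c j e)"
        by (simp only: prod.distrib [symmetric]) (rule prod.cong; auto)
    qed
    ultimately show "(\<Prod>j\<in>I. \<Sum>e\<in>A j. real_spin (\<tau> (j, e))) *
        ?h \<tau> =
        (\<Sum>c\<in>PiE I A. ?z \<tau> c)"
      by (simp add: sum_distrib_right)
  qed
  also have "\<dots> = (\<Sum>c\<in>PiE I A. \<Sum>\<tau>\<in>?T. ?z \<tau> c)"
    by (rule sum.swap)
  also have "\<dots> = (\<Sum>c\<in>PiE I A. \<Prod>j\<in>I. \<Prod>e\<in>A j. 2 * of_bool (e = c j \<longleftrightarrow> e \<in> H))"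
  proof (rule sum.cong [OF refl])
    fix c
    have "(\<Sum>\<tau>\<in>?T. ?z \<tau> c) =
        (\<Sum>\<tau>\<in>?T. \<Prod>p\<in>Sigma I A. real_spin (\<tau> p) ^ ?d c (fst p) (snd p))"
      using assms by (simp add: prod.Sigma case_prod_unfold)
    also have "\<dots> = (\<Prod>p\<in>Sigma I A. \<Sum>b\<in>UNIV. real_spin b ^ ?d c (fst p) (snd p))"
      by (rule prod_sum_PiE [symmetric]) (use fS in auto)
    also have "\<dots> = (\<Prod>p\<in>Sigma I A. 2 * of_bool (snd p = c (fst p) \<longleftrightarrow> snd p \<in> H))"
      unfolding sum_real_spin_power by (rule prod.cong) auto
    also have "\<dots> = (\<Prod>j\<in>I. \<Prod>e\<in>A j. 2 * of_bool (e = c j \<longleftrightarrow> e \<in> H))"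
      using assms by (simp add: prod.Sigma case_prod_unfold)
    finally show "(\<Sum>\<tau>\<in>?T. ?z \<tau> c) =
        (\<Prod>j\<in>I. \<Prod>e\<in>A j. 2 * of_bool (e = c j \<longleftrightarrow> e \<in> H))" .
  qed
  also have "\<dots> = (\<Prod>j\<in>I. \<Sum>d\<in>A j. \<Prod>e\<in>A j. 2 * of_bool (e = d \<longleftrightarrow> e \<in> H))"
    using assms by (intro prod_sum_PiE [symmetric]) auto
  also have "\<dots> = (\<Prod>j\<in>I. 2 ^ card (A j) * of_bool (card {e \<in> A j. e \<in> H} = 1))"
  proof (rule prod.cong [OF refl])
    fix j assume j: "j \<in> I"
    let ?B = "{e \<in> A j. e \<in> H}"
    have "(\<Sum>d\<in>A j. \<Prod>e\<in>A j. 2 * of_bool (e = d \<longleftrightarrow> e \<in> H)) =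
        (\<Sum>d\<in>A j. 2 ^ card (A j) * of_bool (?B = {d}) :: real)"
    proof (rule sum.cong [OF refl])
      fix d assume "d \<in> A j"
      then have "(\<forall>e\<in>A j. e = d \<longleftrightarrow> e \<in> H) \<longleftrightarrow> ?B = {d}" by blast
      then show "(\<Prod>e\<in>A j. 2 * of_bool (e = d \<longleftrightarrow> e \<in> H)) = (2 ^ card (A j) * of_bool (?B = {d}) :: real)"
        using of_bool_ball_prod [OF A [OF j], of "\<lambda>e. e = d \<longleftrightarrow> e \<in> H"] by (simp add: prod.distrib)
    qed
    also have "\<dots> = 2 ^ card (A j) * of_bool (card ?B = 1)"
    proof (cases "card ?B = 1")
      case True
      then obtain d where d: "?B = {d}" by (auto simp: card_1_singleton_iff)
      then have "d \<in> A j" by blast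
      moreover have "of_bool (?B = {d'}) = (if d' = d then 1 else 0 :: real)" for d' using d by auto
      ultimately show ?thesis using d A [OF j] by (simp add: sum_distrib_left [symmetric] sum.delta)
    next
      case False
      then have "?B \<noteq> {d}" for d by (metis card_1_singleton_iff One_nat_def)
      with False show ?thesis by simp
    qed
    finally show "(\<Sum>d\<in>A j. \<Prod>e\<in>A j. 2 * of_bool (e = d \<longleftrightarrow> e \<in> H)) =
        (2 ^ card (A j) * of_bool (card ?B = 1) :: real)" .
  qed
  also have "\<dots> = ?R"
    using assms by (simp add: prod.distrib of_bool_ball_prod card_SigmaI power_sum)
  finally show ?thesis .
qed

text \<open>Once the degree condition is an average over \<open>\<tau>\<close>, the sum over
  \<open>H\<close> runs over all subsets of \<open>E\<close> and factorises into one factor per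
  edge.\<close>

lemma match_circuit_expansion:
  assumes G: "circuit_graph k n E"
    and f: "\<And>y. y \<in> tuples k \<Longrightarrow> fourier k f y = circuit_value (\<lambda>d. d = 1) k n E w y"
  shows "asg k f s = (\<Sum>\<tau>\<in>half_edges n E \<rightarrow>\<^sub>E UNIV. half_edge_weight n E w s \<tau>) / 2 ^ card (half_edges n E)"
proof -
  let ?x = "\<lambda>e. \<Prod>i<k. if External i \<in> e then real_spin (s i) else 1"
  let ?A = "\<lambda>j. {e \<in> E. Internal j \<in> e}" and ?T = "half_edges n E \<rightarrow>\<^sub>E (UNIV :: bool set)"
  let ?V = "\<lambda>\<tau>. \<Prod>j<n. \<Sum>e\<in>?A j. real_spin (\<tau> (j, e))"
  let ?y = "\<lambda>\<tau> e. \<Prod>j<n. if Internal j \<in> e then real_spin (\<tau> (j, e)) else 1"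
  let ?t = "\<lambda>H \<tau>. (\<Prod>e\<in>H. w e * ?x e) * (?V \<tau> * (\<Prod>e\<in>H. ?y \<tau> e))" and ?C = "card (half_edges n E)"
  have circuit: "asg k f s = (\<Sum>H | H \<subseteq> E \<and> (\<forall>j<n. card {e \<in> H. Internal j \<in> e} = 1). \<Prod>e\<in>H. w e * ?x e)"
    by (rule circuit_expansion [OF G]) (rule f)
  have fin: "finite E" by (rule circuit_graph_finite [OF G])
  have ind: "of_bool (\<forall>j<n. card {e \<in> H. Internal j \<in> e} = 1) =
      (\<Sum>\<tau>\<in>?T. ?V \<tau> * (\<Prod>e\<in>H. ?y \<tau> e)) / 2 ^ ?C" if H: "H \<subseteq> E" for H
  proof -
    have "(\<Prod>j<n. \<Prod>e\<in>?A j. if e \<in> H then real_spin (\<tau> (j, e)) else 1) = (\<Prod>e\<in>H. ?y \<tau> e)" for \<tau> :: "nat \<times> cvertex set \<Rightarrow> bool"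
    proof -
      have "(\<Prod>e\<in>?A j. if e \<in> H then real_spin (\<tau> (j, e)) else 1) =
          (\<Prod>e\<in>H. if Internal j \<in> e then real_spin (\<tau> (j, e)) else 1)" for j
      proof -
        have "(\<Prod>e\<in>?A j. if e \<in> H then real_spin (\<tau> (j, e)) else 1) = (\<Prod>e\<in>{e \<in> ?A j. e \<in> H}. real_spin (\<tau> (j, e)))"
          using fin by (intro prod.inter_filter [symmetric]) simp
        also have "{e \<in> ?A j. e \<in> H} = {e \<in> H. Internal j \<in> e}" using H by auto
        also have "prod (\<lambda>e. real_spin (\<tau> (j, e))) \<dots> = (\<Prod>e\<in>H. if Internal j \<in> e then real_spin (\<tau> (j, e)) else 1)"
          using finite_subset [OF H fin] by (rule prod.inter_filter)
        finally show ?thesis .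
      qed
      then show ?thesis by (simp only:) (rule prod.swap)
    qed
    moreover have "{e \<in> ?A j. e \<in> H} = {e \<in> H. Internal j \<in> e}" for j using H by auto
    ultimately show ?thesis
      using exactly_one_indicator [of "{..<n}" ?A H] fin
      by (simp add: half_edges_def Ball_def lessThan_iff)
  qed
  have "asg k f s = (\<Sum>H\<in>Pow E. (\<Prod>e\<in>H. w e * ?x e) *
      ((\<Sum>\<tau>\<in>?T. ?V \<tau> * (\<Prod>e\<in>H. ?y \<tau> e)) / 2 ^ ?C))"
    unfolding circuit sum_filter_prod [OF fin]
    by (intro sum.cong refl arg_cong2 [where f = "(*)"] ind) auto
  also have "\<dots> = (\<Sum>H\<in>Pow E. \<Sum>\<tau>\<in>?T. ?t H \<tau>) / 2 ^ ?C"
    by (simp add: sum_divide_distrib sum_distrib_left)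
  also have "(\<Sum>H\<in>Pow E. \<Sum>\<tau>\<in>?T. ?t H \<tau>) =
      (\<Sum>\<tau>\<in>?T. \<Sum>H\<in>Pow E. ?t H \<tau>)"
    by (rule sum.swap)
  also have "\<dots> = (\<Sum>\<tau>\<in>?T. half_edge_weight n E w s \<tau>)"
  proof (rule sum.cong [OF refl])
    fix \<tau> :: "nat \<times> cvertex set \<Rightarrow> bool"
    let ?s = "\<lambda>e. edge_sign (case_cvertex s (\<lambda>j. \<tau> (j, e))) e"
    have "(\<Prod>e\<in>E. 1 + w e * ?s e) = (\<Prod>e\<in>E. w e * ?s e + 1)" by (simp add: add.commute)
    also have "\<dots> = (\<Sum>H\<in>Pow E. (\<Prod>e\<in>H. w e * ?s e) * (\<Prod>e\<in>E - H. 1))"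
      by (rule prod_add [OF fin])
    also have "\<dots> = (\<Sum>H\<in>Pow E. (\<Prod>e\<in>H. w e * ?x e) * (\<Prod>e\<in>H. ?y \<tau> e))"
    proof (rule sum.cong [OF refl])
      fix H assume "H \<in> Pow E"
      then have "e \<subseteq> circuit_vertices k n" if "e \<in> H" for e
        using that G by (auto simp: circuit_graph_def)
      then show "(\<Prod>e\<in>H. w e * ?s e) * (\<Prod>e\<in>E - H. 1) = (\<Prod>e\<in>H. w e * ?x e) * (\<Prod>e\<in>H. ?y \<tau> e)"
        by (simp add: prod.distrib [symmetric] mult.assoc edge_sign_split [of _ k n] cong: prod.cong if_cong)
    qed
    finally show "(\<Sum>H\<in>Pow E. ?t H \<tau>) = half_edge_weight n E w s \<tau>"
      by (simp add: half_edge_weight_def sum_distrib_left ac_simps)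
  qed
  finally show ?thesis .
qed

section \<open>Match-circuit functions\<close>

lemma edge_sign_cong: "(\<And>v. v \<in> e \<Longrightarrow> \<rho> v = \<rho>' v) \<Longrightarrow> edge_sign \<rho> e = edge_sign \<rho>' e"
  by (simp add: edge_sign_def)

lemma match_implementedE:
  assumes "(k, f) \<in> \<M>"
  obtains n E w where "match_circuit k n E w"
    and "\<And>y. y \<in> tuples k \<Longrightarrow> fourier k f y = circuit_value (\<lambda>d. d = 1) k n E w y"
  using assms by (auto simp: \<M>_def match_implemented_def)

lemma match_circuit_graph: "match_circuit k n E w \<Longrightarrow> circuit_graph k n E"
  by (simp add: match_circuit_def)

lemma match_circuit_weight_nonneg: "match_circuit k n E w \<Longrightarrow> e \<in> E \<Longrightarrow> 0 \<le> w e"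
  by (cases "e \<in> terminals k E") (auto simp: match_circuit_def intro: less_imp_le)

lemma M_subset_P: "\<M> \<subseteq> \<P>"
proof clarify
  fix k f assume f: "(k, f) \<in> \<M>"
  then obtain n E w where c: "match_circuit k n E w"
    and v: "\<And>y. y \<in> tuples k \<Longrightarrow> fourier k f y = circuit_value (\<lambda>d. d = 1) k n E w y"
    by (rule match_implementedE) blast
  have "0 \<le> circuit_value (\<lambda>d. d = 1) k n E w y" for y
    unfolding circuit_value_def
    by (intro sum_nonneg prod_nonneg ballI) (use match_circuit_weight_nonneg [OF c] in blast)
  with f v show "(k, f) \<in> \<P>" by (simp add: \<P>_def \<M>_def)
qed

text \<open>An edge has two ends, so its sign survives the global flip, while each of the
  \<open>n\<close> vertex sums changes sign.\<close>

lemma half_edge_weight_flip: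
  assumes "circuit_graph k n E"
  shows "half_edge_weight n E w (\<lambda>i. \<not> s i) (\<lambda>p. \<not> \<tau> p) = (- 1) ^ n * half_edge_weight n E w s \<tau>"
proof -
  have "edge_sign (case_cvertex (\<lambda>i. \<not> s i) (\<lambda>j. \<not> \<tau> (j, e))) e = edge_sign (case_cvertex s (\<lambda>j. \<tau> (j, e))) e"
    if "e \<in> E" for e
  proof -
    have "edge_sign (case_cvertex (\<lambda>i. \<not> s i) (\<lambda>j. \<not> \<tau> (j, e))) e =
        edge_sign (\<lambda>v. \<not> case_cvertex s (\<lambda>j. \<tau> (j, e)) v) e"
      by (rule edge_sign_cong) (simp split: cvertex.split)
    with edge_sign_flip [of e] assms that show ?thesis by (simp add: circuit_graph_def)
  qed
  moreover have "(\<Prod>j<n. \<Sum>e | e \<in> E \<and> Internal j \<in> e. real_spin (\<not> \<tau> (j, e))) =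
      (- 1) ^ n * (\<Prod>j<n. \<Sum>e | e \<in> E \<and> Internal j \<in> e. real_spin (\<tau> (j, e)))"
  proof -
    have "(\<Prod>j<n. \<Sum>e | e \<in> E \<and> Internal j \<in> e. real_spin (\<not> \<tau> (j, e))) =
        (\<Prod>j<n. (- 1) * (\<Sum>e | e \<in> E \<and> Internal j \<in> e. real_spin (\<tau> (j, e))))"
      by (simp add: real_spin_not sum_negf)
    then show ?thesis unfolding prod.distrib by simp
  qed
  ultimately show ?thesis by (simp add: half_edge_weight_def cong: prod.cong)
qed

lemma half_edge_weight_cong:
  assumes G: "circuit_graph k n E" and \<tau>: "\<And>p. p \<in> half_edges n E \<Longrightarrow> \<tau> p = \<tau>' p"
  shows "half_edge_weight n E w s \<tau> = half_edge_weight n E w s \<tau>'"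
proof -
  have "edge_sign (case_cvertex s (\<lambda>j. \<tau> (j, e))) e = edge_sign (case_cvertex s (\<lambda>j. \<tau>' (j, e))) e"
    if "e \<in> E" for e
  proof (rule edge_sign_cong)
    fix v assume "v \<in> e"
    moreover from that G have "e \<subseteq> circuit_vertices k n" by (simp add: circuit_graph_def)
    ultimately show "case_cvertex s (\<lambda>j. \<tau> (j, e)) v = case_cvertex s (\<lambda>j. \<tau>' (j, e)) v"
      using that by (cases v) (auto simp: circuit_vertices_def half_edges_def intro!: \<tau>)
  qed
  moreover have "real_spin (\<tau> (j, e)) = real_spin (\<tau>' (j, e))" if "j < n" "e \<in> E" "Internal j \<in> e" for j e
    using that by (intro arg_cong [where f = real_spin] \<tau>) (simp add: half_edges_def)
  ultimately show ?thesis
    unfolding half_edge_weight_def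
    by (intro arg_cong2 [where f = "(*)"] prod.cong sum.cong refl) auto
qed

lemma finite_half_edges: "finite E \<Longrightarrow> finite (half_edges n E)"
  by (simp add: half_edges_def)

text \<open>Flipping all the spins multiplies the sum over half-edge spins by \<open>(-1)\<^sup>n\<close>; for odd \<open>n\<close> a
  non-negative function can only be zero.\<close>

lemma M_subset_SD: "\<M> \<subseteq> \<S>\<D>"
proof clarify
  fix k f assume f: "(k, f) \<in> \<M>"
  then obtain n E w where c: "match_circuit k n E w"
    and v: "\<And>y. y \<in> tuples k \<Longrightarrow> fourier k f y = circuit_value (\<lambda>d. d = 1) k n E w y"
    by (rule match_implementedE) blast
  note G = match_circuit_graph [OF c]
  let ?U = "half_edges n E"
  let ?W = "half_edge_weight n E w" and ?r = "\<lambda>\<tau>. \<lambda>p\<in>?U. \<not> \<tau> p"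
  have exp: "asg k f s = (\<Sum>\<tau>\<in>?U \<rightarrow>\<^sub>E UNIV. ?W s \<tau>) / 2 ^ card ?U" for s
    by (rule match_circuit_expansion [OF G]) (rule v)
  have neg: "asg k f (\<lambda>i. \<not> s i) = (- 1) ^ n * asg k f s" for s
  proof -
    have "(\<Sum>\<tau>\<in>?U \<rightarrow>\<^sub>E UNIV. ?W (\<lambda>i. \<not> s i) \<tau>) =
        (\<Sum>\<tau>\<in>?U \<rightarrow>\<^sub>E UNIV. (- 1) ^ n * ?W s \<tau>)"
    proof (rule sum.reindex_bij_witness [where i = ?r and j = ?r])
      fix \<tau> :: "nat \<times> cvertex set \<Rightarrow> bool" assume \<tau>: "\<tau> \<in> ?U \<rightarrow>\<^sub>E UNIV"
      show *: "?r (?r \<tau>) = \<tau>"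
        using \<tau> by (intro PiE_ext [of _ ?U "\<lambda>_. UNIV"]) auto
      show "?r (?r \<tau>) = \<tau>" by (rule *)
      have "?W s (?r \<tau>) = ?W s (\<lambda>p. \<not> \<tau> p)"
        by (rule half_edge_weight_cong [OF G]) simp
      then show "(- 1) ^ n * ?W s (?r \<tau>) = ?W (\<lambda>i. \<not> s i) \<tau>"
        using half_edge_weight_flip [OF G, of w s "\<lambda>p. \<not> \<tau> p"] by simp
    qed simp_all
    then show ?thesis by (simp add: exp sum_distrib_left)
  qed
  have nn: "0 \<le> asg k f s" for s using f by (simp add: \<M>_def \<B>_def asg_nonneg)
  have "asg k f s = asg k f (\<lambda>i. \<not> s i)" for s
    using neg [of s] nn [of s] nn [of "\<lambda>i. \<not> s i"] by (cases "even n") auto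
  with f show "(k, f) \<in> \<S>\<D>" by (simp add: SD_eq asg_class_def \<M>_def)
qed

lemma M_subset_B: "\<M> \<subseteq> \<B>"
  by (auto simp: \<M>_def)

lemma M_omega_subset_SDP: "\<M>_omega \<subseteq> \<S>\<D>\<P>"
  using omega_clone_SDP M_subset_P M_subset_SD
  by (intro omega_closure_minimal) (auto simp: omega_clone_iff SDP_eq(1))

text \<open>The sum type keeps the spins of the arguments (\<open>Inl\<close>) apart from the spins
  that are averaged over (\<open>Inr\<close>), whose index type is different.\<close>

lemma (in dual_alphabet) pos_def_sum_out_Inr:
  fixes V :: "'b set" and U :: "'c set"
  assumes "finite U" "F \<in> pos_def \<zeta> (Inl ` V \<union> Inr ` U)"
  shows "(\<lambda>x. \<Sum>y\<in>U \<rightarrow>\<^sub>E UNIV. F (case_sum x y)) \<in> pos_def \<zeta> V"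
  using assms
proof (induction U arbitrary: F rule: finite_induct)
  case empty
  let ?\<phi> = "case_sum id (\<lambda>_. undefined) :: 'b + 'c \<Rightarrow> 'b"
  from empty have F: "F \<in> pos_def \<zeta> (Inl ` V)" by simp
  have "F (case_sum x (\<lambda>_. undefined)) = F (\<lambda>v. x (?\<phi> v))" for x
    by (rule pos_def_depends [OF F]) auto
  moreover have "(\<lambda>x. F (\<lambda>v. x (?\<phi> v))) \<in> pos_def \<zeta> V"
    by (rule pos_def_rename [OF F]) auto
  ultimately show ?case unfolding PiE_empty_domain by simp
next
  case (insert u U)
  have upd: "(case_sum x y)(Inr u := a) = case_sum x (y(u := a))" for x :: "'b \<Rightarrow> 'a" and y a
    by (auto simp: fun_eq_iff split: sum.split)
  have "(\<lambda>z. \<Sum>a\<in>UNIV. F (z(Inr u := a))) \<in> pos_def \<zeta> (Inl ` V \<union> Inr ` U)"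
    using insert.prems insert.hyps by (intro pos_def_sum_out) auto
  from insert.IH [OF this]
  have "(\<lambda>x. \<Sum>y\<in>U \<rightarrow>\<^sub>E UNIV. \<Sum>a\<in>UNIV. F (case_sum x (y(u := a)))) \<in> pos_def \<zeta> V"
    by (simp only: upd)
  moreover have "(\<Sum>y\<in>insert u U \<rightarrow>\<^sub>E UNIV. F (case_sum x y)) = (\<Sum>y\<in>U \<rightarrow>\<^sub>E UNIV. \<Sum>a\<in>UNIV. F (case_sum x (y(u := a))))" for x
  proof -
    have "(\<Sum>y\<in>insert u U \<rightarrow>\<^sub>E UNIV. F (case_sum x y)) = (\<Sum>(a, y)\<in>UNIV \<times> (U \<rightarrow>\<^sub>E UNIV). F (case_sum x (y(u := a))))"
      unfolding PiE_insert_eq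
      by (subst sum.reindex [OF inj_combinator]) (use insert.hyps in \<open>simp_all add: comp_def case_prod_unfold\<close>)
    also have "\<dots> = (\<Sum>y\<in>U \<rightarrow>\<^sub>E UNIV. \<Sum>a\<in>UNIV. F (case_sum x (y(u := a))))"
      by (simp only: sum.cartesian_product [symmetric]) (rule sum.swap)
    finally show ?thesis .
  qed
  ultimately show ?case by simp
qed

lemma sum_PiE_pairs:
  fixes g h :: "('u \<Rightarrow> bool) \<Rightarrow> real"
  assumes g: "\<And>x y. (\<And>u. u \<in> U \<Longrightarrow> x u = y u) \<Longrightarrow> g x = g y"
    and h: "\<And>x y. (\<And>u. u \<in> U \<Longrightarrow> x u = y u) \<Longrightarrow> h x = h y"
  shows "(\<Sum>x\<in>U \<rightarrow>\<^sub>E UNIV. g x) * (\<Sum>x\<in>U \<rightarrow>\<^sub>E UNIV. h x) =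
    (\<Sum>y\<in>U \<rightarrow>\<^sub>E UNIV. g (\<lambda>u. fst (y u)) * h (\<lambda>u. snd (y u)))"
proof -
  have "(\<Sum>x\<in>U \<rightarrow>\<^sub>E UNIV. g x) * (\<Sum>x\<in>U \<rightarrow>\<^sub>E UNIV. h x) =
      (\<Sum>(a, b)\<in>(U \<rightarrow>\<^sub>E UNIV) \<times> (U \<rightarrow>\<^sub>E UNIV). g a * h b)"
    by (simp add: sum_product sum.cartesian_product)
  also have "\<dots> = (\<Sum>y\<in>U \<rightarrow>\<^sub>E UNIV. g (\<lambda>u. fst (y u)) * h (\<lambda>u. snd (y u)))"
  proof (rule sum.reindex_bij_witness [where i = "\<lambda>y. (\<lambda>u\<in>U. fst (y u), \<lambda>u\<in>U. snd (y u))"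
        and j = "\<lambda>p. \<lambda>u\<in>U. (fst p u, snd p u)"])
    fix p :: "('u \<Rightarrow> bool) \<times> ('u \<Rightarrow> bool)" assume p: "p \<in> (U \<rightarrow>\<^sub>E UNIV) \<times> (U \<rightarrow>\<^sub>E UNIV)"
    have "(\<lambda>u\<in>U. fst ((\<lambda>u\<in>U. (fst p u, snd p u)) u)) = fst p"
      using p by (intro PiE_ext [of _ U "\<lambda>_. UNIV"]) auto
    moreover have "(\<lambda>u\<in>U. snd ((\<lambda>u\<in>U. (fst p u, snd p u)) u)) = snd p"
      using p by (intro PiE_ext [of _ U "\<lambda>_. UNIV"]) auto
    ultimately show "(\<lambda>u\<in>U. fst ((\<lambda>u\<in>U. (fst p u, snd p u)) u), \<lambda>u\<in>U. snd ((\<lambda>u\<in>U. (fst p u, snd p u)) u)) = p"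
      by simp
    have "g (\<lambda>u. fst ((\<lambda>u\<in>U. (fst p u, snd p u)) u)) = g (fst p)" by (rule g) simp
    moreover have "h (\<lambda>u. snd ((\<lambda>u\<in>U. (fst p u, snd p u)) u)) = h (snd p)" by (rule h) simp
    ultimately show "g (\<lambda>u. fst ((\<lambda>u\<in>U. (fst p u, snd p u)) u)) * h (\<lambda>u. snd ((\<lambda>u\<in>U. (fst p u, snd p u)) u)) =
        (case p of (a, b) \<Rightarrow> g a * h b)" by (simp add: case_prod_unfold)
  next
    fix y :: "'u \<Rightarrow> bool \<times> bool" assume y: "y \<in> U \<rightarrow>\<^sub>E UNIV"
    show "(\<lambda>u\<in>U. (fst (\<lambda>u\<in>U. fst (y u), \<lambda>u\<in>U. snd (y u)) u, snd (\<lambda>u\<in>U. fst (y u), \<lambda>u\<in>U. snd (y u)) u)) = y"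
      using y by (intro PiE_ext [of _ U "\<lambda>_. UNIV"]) auto
  qed simp_all
  finally show ?thesis .
qed

text \<open>Exchanging the two indices leaves the double sum unchanged, so it is half of a sum of
  symmetric mixed products, which \<open>pos_def_gray_cross\<close> covers.\<close>

lemma pos_def_gray_sum:
  assumes "\<And>i. i \<in> I \<Longrightarrow> v i \<in> V"
  shows "(\<lambda>x. (\<Sum>i\<in>I. bool_spin (fst (x (v i)))) * (\<Sum>i\<in>I. bool_spin (snd (x (v i))))) \<in> pos_def gray V"
proof -
  have "(\<lambda>x. 1/2 * (\<Sum>i\<in>I. \<Sum>j\<in>I. bool_spin (fst (x (v i))) * bool_spin (snd (x (v j))) +
      bool_spin (snd (x (v i))) * bool_spin (fst (x (v j))))) \<in> pos_def gray V"
    using assms by (intro pos_def_scale pos_def_sum pos_def_gray_cross half_nonneg)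
  moreover have "(\<Sum>i\<in>I. \<Sum>j\<in>I. bool_spin (snd (x (v i))) * bool_spin (fst (x (v j)))) =
      (\<Sum>i\<in>I. \<Sum>j\<in>I. bool_spin (fst (x (v i))) * bool_spin (snd (x (v j))))" for x
    by (subst sum.swap) (simp add: mult.commute)
  ultimately show ?thesis by (simp add: sum.distrib sum_product)
qed

text \<open>The square of the half-edge expansion is a sum over pairs of spins. On pairs, a vertex
  contributes \<open>pos_def_gray_sum\<close> and an edge \<open>pos_def_gray_edge\<close>; summing
  out the half-edge pairs stays in the cone.\<close>

lemma M_subset_W: "\<M> \<subseteq> \<W>"
proof clarify
  fix k f assume f: "(k, f) \<in> \<M>"
  then obtain n E w where c: "match_circuit k n E w"
    and v: "\<And>y. y \<in> tuples k \<Longrightarrow> fourier k f y = circuit_value (\<lambda>d. d = 1) k n E w y"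
    by (rule match_implementedE) blast
  note G = match_circuit_graph [OF c]
  note fin = circuit_graph_finite [OF G]
  let ?U = "half_edges n E" and ?c = "2 ^ card (half_edges n E) :: real" and ?W = "half_edge_weight n E w"
  have exp: "asg k f s = (\<Sum>\<tau>\<in>?U \<rightarrow>\<^sub>E UNIV. ?W s \<tau>) / ?c" for s
    by (rule match_circuit_expansion [OF G]) (rule v)
  let ?V = "Inl ` {..<k} \<union> Inr ` ?U :: (nat + nat \<times> cvertex set) set"
  let ?F = "\<lambda>z :: nat + nat \<times> cvertex set \<Rightarrow> bool \<times> bool.
    complex_of_real (?W (\<lambda>i. fst (z (Inl i))) (\<lambda>p. fst (z (Inr p))) * ?W (\<lambda>i. snd (z (Inl i))) (\<lambda>p. snd (z (Inr p))))"
  \<comment> \<open>The variable at the end \<open>u\<close> of the edge \<open>e\<close>: an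
    argument if \<open>u\<close> is external, otherwise the half-edge spin belonging to this
    particular edge.\<close>
  define var where "var e = case_cvertex Inl (\<lambda>j. Inr (j, e))" for e :: "cvertex set"
  have var: "var e u \<in> ?V" if "e \<in> E" "u \<in> e" for e u
  proof -
    from that G have "u \<in> circuit_vertices k n" by (auto simp: circuit_graph_def)
    with that show ?thesis by (cases u) (auto simp: circuit_vertices_def var_def half_edges_def)
  qed
  have F: "?F = (\<lambda>z. (\<Prod>j<n. (\<Sum>e | e \<in> E \<and> Internal j \<in> e. bool_spin (fst (z (Inr (j, e))))) *
      (\<Sum>e | e \<in> E \<and> Internal j \<in> e. bool_spin (snd (z (Inr (j, e)))))) *
      (\<Prod>e\<in>E. (1 + of_real (w e) * (\<Prod>u\<in>e. bool_spin (fst (z (var e u))))) *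
        (1 + of_real (w e) * (\<Prod>u\<in>e. bool_spin (snd (z (var e u)))))))" (is "_ = ?G")
  proof
    fix z
    have "case_cvertex (\<lambda>i. g (z (Inl i))) (\<lambda>j. g (z (Inr (j, e)))) u = g (z (var e u))"
      for g :: "bool \<times> bool \<Rightarrow> bool" and e u
      by (simp add: var_def split: cvertex.split)
    then have "complex_of_real (edge_sign (case_cvertex (\<lambda>i. g (z (Inl i))) (\<lambda>j. g (z (Inr (j, e))))) e) =
        (\<Prod>u\<in>e. bool_spin (g (z (var e u))))" for g :: "bool \<times> bool \<Rightarrow> bool" and e
      by (simp add: edge_sign_def of_real_spin)
    then show "?F z = ?G z"
      by (simp add: half_edge_weight_def of_real_spin prod.distrib ac_simps)
  qed
  have "?F \<in> pos_def gray ?V"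
    unfolding F
  proof (rule pos_def_mult; rule pos_def_prod)
    fix j assume "j \<in> {..<n}"
    then show "(\<lambda>z. (\<Sum>e | e \<in> E \<and> Internal j \<in> e. bool_spin (fst (z (Inr (j, e))))) *
        (\<Sum>e | e \<in> E \<and> Internal j \<in> e. bool_spin (snd (z (Inr (j, e)))))) \<in> pos_def gray ?V"
      by (intro pos_def_gray_sum [where v = "\<lambda>e. Inr (j, e)"]) (auto simp: half_edges_def)
  next
    fix e assume e: "e \<in> E"
    then have "card e = 2" using G by (simp add: circuit_graph_def)
    then obtain a b where ab: "e = {a, b}" "a \<noteq> b" by (auto simp: card_2_iff)
    show "(\<lambda>z. (1 + of_real (w e) * (\<Prod>u\<in>e. bool_spin (fst (z (var e u))))) *
        (1 + of_real (w e) * (\<Prod>u\<in>e. bool_spin (snd (z (var e u)))))) \<in> pos_def gray ?V"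
      using pos_def_gray_edge [of "var e a" ?V "var e b" "w e"] var [OF e, of a] var [OF e, of b]
        match_circuit_weight_nonneg [OF c e] ab by simp
  qed
  from gray.pos_def_sum_out_Inr [OF finite_half_edges [OF fin] this]
  have "(\<lambda>x. \<Sum>y\<in>?U \<rightarrow>\<^sub>E UNIV. ?F (case_sum x y)) \<in> pos_def gray {..<k}" .
  then have "(\<lambda>x. of_real (1 / (?c * ?c)) * (\<Sum>y\<in>?U \<rightarrow>\<^sub>E UNIV. ?F (case_sum x y))) \<in> pos_def gray {..<k}" (is "?H \<in> _")
    by (rule pos_def_scale) (simp add: less_eq_complex_def)
  also have "?H = two_copy (asg k f)" (is "?L = ?R")
  proof
    fix x :: "nat \<Rightarrow> bool \<times> bool"
    have "(\<Sum>\<tau>\<in>?U \<rightarrow>\<^sub>E UNIV. ?W (\<lambda>i. fst (x i)) \<tau>) * (\<Sum>\<tau>\<in>?U \<rightarrow>\<^sub>E UNIV. ?W (\<lambda>i. snd (x i)) \<tau>) =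
        (\<Sum>y\<in>?U \<rightarrow>\<^sub>E UNIV. ?W (\<lambda>i. fst (x i)) (\<lambda>p. fst (y p)) * ?W (\<lambda>i. snd (x i)) (\<lambda>p. snd (y p)))"
      by (rule sum_PiE_pairs; rule half_edge_weight_cong [OF G])
    then have "two_copy (asg k f) x = of_real (1 / (?c * ?c) *
        (\<Sum>y\<in>?U \<rightarrow>\<^sub>E UNIV. ?W (\<lambda>i. fst (x i)) (\<lambda>p. fst (y p)) * ?W (\<lambda>i. snd (x i)) (\<lambda>p. snd (y p))))"
      by (simp add: two_copy_def exp)
    then show "?L x = ?R x"
      by simp
  qed
  finally have "two_copy (asg k f) \<in> pos_def gray {..<k}" .
  with f show "(k, f) \<in> \<W>" by (simp add: \<W>_def asg_class_def \<M>_def)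
qed

lemma M_omega_subset_W: "\<M>_omega \<subseteq> \<W>"
  using omega_clone_W M_subset_W by (intro omega_closure_minimal) (auto simp: omega_clone_iff)

section \<open>Hypergraph Ising functions\<close>

lemma asg_ising:
  assumes "0 < k"
  shows "asg k (snd (ising k lam)) s = lam + (1 - lam) * (of_bool (\<forall>i<k. \<not> s i) + of_bool (\<forall>i<k. s i))"
proof -
  have rep: "map s [0..<k] = replicate k False \<longleftrightarrow> (\<forall>i<k. \<not> s i)"
    "map s [0..<k] = replicate k True \<longleftrightarrow> (\<forall>i<k. s i)"
    by (simp_all add: list_eq_iff_nth_eq)
  have "asg k (snd (ising k lam)) s =
      (if map s [0..<k] = replicate k False \<or> map s [0..<k] = replicate k True then 1 else lam)"
    by (simp only: ising_def snd_conv asg_restrict) (simp only: asg_def)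
  moreover have "\<not> ((\<forall>i<k. \<not> s i) \<and> (\<forall>i<k. s i))" using assms by blast
  moreover have "(if A \<or> B then 1 else lam) = lam + (1 - lam) * (of_bool A + of_bool B)" if "\<not> (A \<and> B)" for A B
    using that by (cases A; cases B) auto
  ultimately show ?thesis unfolding rep by simp
qed

text \<open>The point mass at all-False is the product of the factors (1 + spin) / 2. Its
  symmetrisation enters with coefficient \<open>1 - lam\<close>, beside the constant
  \<open>lam\<close>.\<close>

lemma ising_in_SDP:
  assumes "0 < k" "0 \<le> lam" "lam \<le> 1" shows "ising k lam \<in> \<S>\<D>\<P>"
proof -
  let ?F = "asg k (snd (ising k lam))"
  have "(\<lambda>s. \<Prod>i<k. 1/2 * (1 + bool_spin (s i))) \<in> pos_def bool_spin {..<k}"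
    by (intro pos_def_prod pos_def_scale pos_def_add pos_def_const pos_def_gen half_nonneg)
      (simp_all add: less_eq_complex_def)
  from pos_def_symmetrize [OF this]
  have "(\<lambda>s. of_real lam + of_real (1 - lam) * ((\<Prod>i<k. 1/2 * (1 + bool_spin (s i))) + (\<Prod>i<k. 1/2 * (1 + bool_spin (\<not> s i))))) \<in> pos_def bool_spin {..<k}" (is "?H \<in> _")
    using assms by (intro pos_def_add [OF pos_def_const pos_def_scale]) (simp_all add: less_eq_complex_def)
  also have "?H =
      (\<lambda>s. complex_of_real (?F s))" (is "?L = ?R")
  proof
    fix s :: "nat \<Rightarrow> bool"
    have "1/2 * (1 + bool_spin b) = complex_of_real (of_bool (\<not> b))" for b by (simp add: bool_spin_def)
    then have p: "(\<Prod>i<k. 1/2 * (1 + bool_spin (t i))) = complex_of_real (of_bool (\<forall>i<k. \<not> t i))" for t :: "nat \<Rightarrow> bool"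
      using of_bool_ball_prod [of "{..<k}" "\<lambda>i. \<not> t i"] by (simp only: of_real_prod [symmetric]) (simp add: Ball_def)
    show "?L s = ?R s"
      unfolding p asg_ising [OF assms(1)] by simp
  qed
  finally have "(\<lambda>s. complex_of_real (?F s)) \<in> pos_def bool_spin {..<k}" .
  moreover have pair: "ising k lam = (k, snd (ising k lam))" by (simp add: ising_def)
  have "(k, snd (ising k lam)) \<in> \<S>\<D>" using ising_in_SD [OF assms(2), of k] pair by simp
  ultimately show ?thesis
    by (subst pair) (simp add: SDP_asg_class SD_eq asg_class_def)
qed

lemma H_ferro_subset_SDP: "\<H>_ferro \<subseteq> \<S>\<D>\<P>"
  unfolding \<H>_ferro_def using omega_clone_SDP nullary_subset_SDP
  by (intro omega_closure_minimal Un_least subsetI) (auto simp: omega_clone_iff intro!: ising_in_SDP)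

text \<open>If one assignment is constant on the first \<open>k\<close> arguments, join and meet
  reproduce the same two assignments there and equality holds. Otherwise the left side is
  \<open>lam\<close> squared, and \<open>lam\<close> is the minimal value.\<close>

lemma ising_in_LSM:
  assumes "0 < k" "0 \<le> lam" "lam \<le> 1" shows "ising k lam \<in> LSM"
proof -
  let ?F = "asg k (snd (ising k lam))"
  have le: "lam \<le> ?F s" and nn: "0 \<le> ?F s" and one: "(\<forall>i<k. s i = b) \<Longrightarrow> ?F s = 1" for s b
    using assms by (auto simp: asg_ising)
  have "?F s * ?F t \<le> ?F (\<lambda>i. s i \<or> t i) * ?F (\<lambda>i. s i \<and> t i)" for s t
  proof -
    have const: "?F (\<lambda>i. s i \<or> t i) * ?F (\<lambda>i. s i \<and> t i) = ?F s * ?F t" if "\<forall>i<k. s i = b" for s t b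
    proof (cases b)
      case True
      then have "?F (\<lambda>i. s i \<or> t i) = 1" "?F (\<lambda>i. s i \<and> t i) = ?F t" "?F s = 1"
        using that by (auto intro!: one [of _ True] asg_cong)
      then show ?thesis by simp
    next
      case False
      then have "?F (\<lambda>i. s i \<or> t i) = ?F t" "?F (\<lambda>i. s i \<and> t i) = 1" "?F s = 1"
        using that by (auto intro!: one [of _ False] asg_cong)
      then show ?thesis by simp
    qed
    have lam: "?F s = lam" if "\<nexists>b. \<forall>i<k. s i = b" for s
    proof -
      have "\<not> (\<forall>i<k. \<not> s i)" "\<not> (\<forall>i<k. s i)"
        using that not_ex [THEN iffD1, OF that, rule_format, of True] not_ex [THEN iffD1, OF that, rule_format, of False]
        by simp_all
      then show ?thesis unfolding asg_ising [OF assms(1)] by (simp only: of_bool_def if_False) simp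
    qed
    show ?thesis
    proof (cases "\<exists>b. \<forall>i<k. s i = b")
      case True
      then obtain b where "\<forall>i<k. s i = b" ..
      from const [OF this, of t] show ?thesis by (simp only: order_refl)
    next
      case not_s: False
      show ?thesis
      proof (cases "\<exists>b. \<forall>i<k. t i = b")
        case True
        then obtain b where "\<forall>i<k. t i = b" ..
        from const [OF this, of s] show ?thesis by (simp only: disj_commute conj_commute mult.commute order_refl)
      next
        case False
        show ?thesis unfolding lam [OF not_s] lam [OF False]
          by (intro mult_mono le assms nn)
      qed
    qed
  qed
  moreover have pair: "ising k lam = (k, snd (ising k lam))" by (simp add: ising_def)
  have "(k, snd (ising k lam)) \<in> \<B>" using ising_in_B [OF assms(2), of k] pair by simp
  ultimately show ?thesis
    by (subst pair) (simp add: LSM_def asg_class_def)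
qed

lemma H_ferro_subset_LSM: "\<H>_ferro \<subseteq> LSM"
proof -
  have "nullary \<subseteq> LSM"
    by (auto simp: nullary_def LSM_def asg_class_def \<B>_def) (simp add: asg_def)
  then show ?thesis
    unfolding \<H>_ferro_def using omega_clone_LSM
    by (intro omega_closure_minimal Un_least subsetI) (auto simp: omega_clone_iff intro!: ising_in_LSM)
qed

lemma ising_4_not_in_W: "ising 4 (1/2) \<notin> \<W>"
proof
  let ?F = "asg 4 (snd (ising 4 (1/2)))"
  assume "ising 4 (1/2) \<in> \<W>"
  then have "two_copy ?F \<in> pos_def gray {..<4}"
    by (simp add: \<W>_def asg_class_def ising_def)
  from gray.pos_def_fourier [OF this, of "\<lambda>_. 1"]
  have nonneg: "0 \<le> (\<Sum>x\<in>{..<4} \<rightarrow>\<^sub>E UNIV. two_copy ?F x * character gray {..<4} (\<lambda>_. 1) x)" by simp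
  \<comment> \<open>The function is half the sum of three products: the constant 1, all False, all
    True. In two copies the Fourier sum therefore splits into nine fourth powers
    \<open>S r r' ^ 4\<close>.\<close>
  define g :: "nat \<Rightarrow> bool \<Rightarrow> complex" where
    "g r b = (if r = 0 then 1 else if r = 1 then of_bool (\<not> b) else of_bool b)" for r b
  define S where "S r r' = (\<Sum>p\<in>UNIV. g r (fst p) * g r' (snd p) * gray p)" for r r'
  have F: "complex_of_real (?F s) = 1/2 * (\<Sum>r<3. \<Prod>i<4. g r (s i))" for s
    by (simp add: asg_ising g_def eval_nat_numeral lessThan_Suc All_less_Suc)
  have "two_copy ?F x * character gray {..<4} (\<lambda>_. 1) x =
      1/4 * (\<Sum>r<3. \<Sum>r'<3. \<Prod>i<4. g r (fst (x i)) * g r' (snd (x i)) * gray (x i))" for x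
  proof -
    have "two_copy ?F x * character gray {..<4} (\<lambda>_. 1) x = 1/4 *
        (((\<Sum>r<3. \<Prod>i<4. g r (fst (x i))) * (\<Sum>r'<3. \<Prod>i<4. g r' (snd (x i)))) * (\<Prod>i<4. gray (x i)))"
      by (simp add: two_copy_def F character_def)
    also have "\<dots> = 1/4 * (\<Sum>r<3. \<Sum>r'<3. \<Prod>i<4. g r (fst (x i)) * g r' (snd (x i)) * gray (x i))"
      by (simp only: sum_product prod.distrib) (simp only: sum_distrib_right)
    finally show ?thesis .
  qed
  then have "(\<Sum>x\<in>{..<4} \<rightarrow>\<^sub>E UNIV. two_copy ?F x * character gray {..<4} (\<lambda>_. 1) x) =
      1/4 * (\<Sum>r<3. \<Sum>r'<3. \<Sum>x\<in>{..<4::nat} \<rightarrow>\<^sub>E UNIV. \<Prod>i<4. g r (fst (x i)) * g r' (snd (x i)) * gray (x i))"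
    by (simp only: sum_distrib_left [symmetric]) (simp only: sum.swap [of _ "{..<3}" "{..<4} \<rightarrow>\<^sub>E UNIV"])
  also have "\<dots> = 1/4 * (\<Sum>r<3. \<Sum>r'<3. S r r' ^ 4)"
    by (subst prod_sum_PiE [symmetric]) (simp_all add: S_def)
  \<comment> \<open>\<open>S 0 0\<close> vanishes; the four terms with exactly one index 0 are
    fourth powers of 1 + i up to a unit and equal -4; the remaining four are fourth powers of units
    and equal 1. This gives (-16 + 4) / 4.\<close>
  also have "\<dots> = - 3"
    by (simp add: S_def g_def UNIV_bool_pair gray_def eval_nat_numeral lessThan_Suc algebra_simps)
  finally show False using nonneg by (simp add: less_eq_complex_def)
qed

lemma ising_4_in_H_ferro: "ising 4 (1/2) \<in> \<H>_ferro"
proof -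
  have "ising 4 (1/2) \<in> {ising k lam |k lam. 2 \<le> k \<and> 0 \<le> lam \<and> lam \<le> 1}"
    by (intro CollectI exI [of _ 4] exI [of _ "1/2"]) simp
  then show ?thesis
    unfolding \<H>_ferro_def by (intro subsetD [OF subset_omega_closure] insertI2 UnI1)
qed

lemma not_H_ferro_subset_M_omega: "\<not> \<H>_ferro \<subseteq> \<M>_omega"
  using ising_4_in_H_ferro ising_4_not_in_W M_omega_subset_W by blast

section \<open>Ferromagnetic Ising functions and explicit circuits\<close>

context scaled_omega_clone
begin

lemma ising_2_expressible:
  assumes "ising 2 lam \<in> C" "i < n" "j < n"
  shows "expressible C n (\<lambda>s. if s i = s j then 1 else lam)"
proof -
  have "(2, snd (ising 2 lam)) \<in> C" using assms(1) by (simp add: ising_def)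
  from expressibleI [OF this] have "expressible C 2 (\<lambda>s. if s 0 = s 1 then 1 else lam)"
    by (simp only: asg_ising_2 [abs_def])
  then show ?thesis using assms(2,3) by (rule rename2)
qed

lemma ising_2_memI:
  assumes "expressible C 2 (\<lambda>s. if s 0 = s 1 then a else b)" "0 < a" "0 \<le> b"
  shows "ising 2 (b / a) \<in> C"
proof -
  have "expressible C 2 (\<lambda>s. 1 / a * (if s 0 = s 1 then a else b))"
    using assms by (intro scale) auto
  also have "\<dots> = asg 2 (snd (ising 2 (b / a)))"
    using assms(2) by (simp add: asg_ising_2 [abs_def] fun_eq_iff)
  finally have "(2, snd (ising 2 (b / a))) \<in> C"
    using ising_in_B [of "b / a" 2] assms by (intro expressibleD [OF _ subset_B]) (auto simp: ising_def \<B>_def)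
  then show ?thesis by (simp add: ising_def)
qed

lemma ising_2_one: "ising 2 1 \<in> C"
  using ising_2_memI [of 1 1] const [of 1 2] by simp

text \<open>An edge factor is \<open>1 + w e\<close> times a binary Ising function with parameter
  \<open>(1 - w e) / (1 + w e)\<close>, which lies between 0 and 1 since the weight does. Internal
  vertices become the arguments from \<open>k\<close> on and are summed out.\<close>

lemma even_circuit_expressible:
  assumes ferro: "\<And>lam. 0 \<le> lam \<Longrightarrow> lam \<le> 1 \<Longrightarrow> ising 2 lam \<in> C"
    and c: "even_circuit k n E w"
    and f: "\<And>y. y \<in> tuples k \<Longrightarrow> fourier k f y = circuit_value even k n E w y"
  shows "expressible C k (asg k f)"
proof -
  have G: "circuit_graph k n E" using c by (simp add: even_circuit_def)
  let ?\<rho> = "\<lambda>S. case_cvertex S (\<lambda>j. S (k + j))"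
  have w: "0 \<le> w e" "w e \<le> 1" if "e \<in> E" for e
    using c that by (cases "e \<in> terminals k E"; auto simp: even_circuit_def intro: less_imp_le)+
  have "expressible C (k + n) (\<lambda>S. \<Prod>e\<in>E. 1 + w e * edge_sign (?\<rho> S) e)"
  proof (rule prod)
    fix e assume e: "e \<in> E"
    then have "card e = 2" "e \<subseteq> circuit_vertices k n" using G by (auto simp: circuit_graph_def)
    then obtain a b where ab: "e = {a, b}" "a \<noteq> b" "a \<in> circuit_vertices k n" "b \<in> circuit_vertices k n"
      by (auto simp: card_2_iff)
    define idx where "idx v = (case v of External i \<Rightarrow> i | Internal j \<Rightarrow> k + j)" for v
    have idx: "?\<rho> S v = S (idx v)" for S :: "nat \<Rightarrow> bool" and v by (simp add: idx_def split: cvertex.split)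
    have lt: "idx v < k + n" if "v \<in> circuit_vertices k n" for v
      using that by (auto simp: idx_def circuit_vertices_def)
    have lam: "0 \<le> (1 - w e) / (1 + w e)" "(1 - w e) / (1 + w e) \<le> 1"
      using w [OF e] by (simp_all add: field_simps)
    have "expressible C (k + n) (\<lambda>S. (1 + w e) * (if S (idx a) = S (idx b) then 1 else (1 - w e) / (1 + w e)))"
      using w [OF e] by (intro scale ising_2_expressible ferro lam lt ab) auto
    also have "\<dots> =
        (\<lambda>S. 1 + w e * edge_sign (?\<rho> S) e)"
      using w [OF e] ab(2) by (auto simp: fun_eq_iff edge_sign_def ab(1) idx real_spin_def)
    finally show "expressible C (k + n) (\<lambda>S. 1 + w e * edge_sign (?\<rho> S) e)" .
  qed
  from scale [OF sum_many [OF this], of "1 / 2 ^ n"]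
  have "expressible C k (\<lambda>s. 1 / 2 ^ n * (\<Sum>t\<in>{..<n} \<rightarrow>\<^sub>E UNIV. \<Prod>e\<in>E. 1 + w e *
      edge_sign (?\<rho> (\<lambda>i. if i < k then s i else t (i - k))) e))" by simp
  also have "\<dots> = asg k f" (is "?L = ?R")
  proof
    fix s
    have "asg k f s = (\<Sum>t\<in>{..<n} \<rightarrow>\<^sub>E UNIV. \<Prod>e\<in>E. 1 + w e * edge_sign (case_cvertex s t) e) / 2 ^ n"
      by (rule even_circuit_expansion [OF G]) (rule f)
    moreover have "edge_sign (?\<rho> (\<lambda>i. if i < k then s i else t (i - k))) e = edge_sign (case_cvertex s t) e"
      if "e \<in> E" for e t
    proof (rule edge_sign_cong)
      fix v assume "v \<in> e"
      then have "v \<in> circuit_vertices k n" using that G by (auto simp: circuit_graph_def)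
      then show "?\<rho> (\<lambda>i. if i < k then s i else t (i - k)) v = case_cvertex s t v"
        by (auto simp: circuit_vertices_def)
    qed
    ultimately show "?L s = ?R s"
      by (simp cong: prod.cong)
  qed
  finally show ?thesis .
qed

end

lemma I_ferro_generators: "{ising 2 lam |lam. 0 \<le> lam \<and> lam \<le> 1} \<union> nullary \<subseteq> \<B>"
  using nullary_subset_B ising_in_B by auto

lemma omega_clone_I_ferro: "omega_clone \<I>_ferro"
  unfolding \<I>_ferro_def by (rule omega_clone_omega_closure [OF I_ferro_generators])

lemma E_subset_B: "\<E> \<subseteq> \<B>"
  by (auto simp: \<E>_def \<B>_def \<B>\<^sub>a_def PiE_iff intro: mult_nonneg_nonneg)

lemma E_subset_I_ferro: "\<E> \<subseteq> \<I>_ferro"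
proof -
  have gen: "insert EQ ({ising 2 lam |lam. 0 \<le> lam \<and> lam \<le> 1} \<union> nullary) \<subseteq> \<I>_ferro"
    unfolding \<I>_ferro_def by (rule subset_omega_closure)
  interpret scaled_omega_clone \<I>_ferro
    using gen by unfold_locales (auto intro: omega_clone_I_ferro)
  show ?thesis
  proof
    fix g assume g: "g \<in> \<E>"
    then obtain k c f where f: "g = (k, \<lambda>x\<in>tuples k. c * f x)" "0 \<le> c" "even_implemented k (fourier k f)"
      by (auto simp: \<E>_def)
    then obtain n E w where c: "even_circuit k n E w"
      and v: "\<And>y. y \<in> tuples k \<Longrightarrow> fourier k f y = circuit_value even k n E w y"
      by (auto simp: even_implemented_def)
    have "expressible \<I>_ferro k (asg k f)"
      by (rule even_circuit_expressible [OF _ c v]) (use gen in auto)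
    from scale [OF this f(2)] have "expressible \<I>_ferro k (asg k (\<lambda>x\<in>tuples k. c * f x))"
      by (simp only: asg_restrict) (simp add: asg_def [abs_def])
    then show "g \<in> \<I>_ferro"
      using g E_subset_B f(1) by (auto intro!: expressibleD [OF _ subset_B] simp: \<B>_def)
  qed
qed

section \<open>Evaluation of small explicit circuits\<close>

lemma circuit_value_Pow:
  assumes "finite E"
  shows "circuit_value deg k n E w y = (\<Sum>H\<in>Pow E. if (\<forall>i<k. terminal E i \<in> H \<longleftrightarrow> y ! i) \<and>
    (\<forall>j<n. deg (\<Sum>e\<in>H. of_bool (Internal j \<in> e))) then \<Prod>e\<in>H. w e else 0)"
proof -
  have card: "card {e \<in> H. Internal j \<in> e} = (\<Sum>e\<in>H. of_bool (Internal j \<in> e))" if "H \<in> Pow E" for H j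
    using that assms finite_subset by (fastforce simp: of_bool_def sum.If_cases Int_def)
  have "circuit_value deg k n E w y = (\<Sum>H\<in>{H \<in> Pow E. (\<forall>i<k. terminal E i \<in> H \<longleftrightarrow> y ! i) \<and>
      (\<forall>j<n. deg (card {e \<in> H. Internal j \<in> e}))}. \<Prod>e\<in>H. w e)"
    by (simp add: circuit_value_def)
  also have "\<dots> = (\<Sum>H\<in>Pow E. if (\<forall>i<k. terminal E i \<in> H \<longleftrightarrow> y ! i) \<and>
      (\<forall>j<n. deg (card {e \<in> H. Internal j \<in> e})) then \<Prod>e\<in>H. w e else 0)"
    using assms by (intro sum.inter_filter) simp
  also have "\<dots> = (\<Sum>H\<in>Pow E. if (\<forall>i<k. terminal E i \<in> H \<longleftrightarrow> y ! i) \<and>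
    (\<forall>j<n. deg (\<Sum>e\<in>H. of_bool (Internal j \<in> e))) then \<Prod>e\<in>H. w e else 0)"
    by (rule sum.cong [OF refl]) (simp only: card)
  finally show ?thesis .
qed

lemma sum_Pow_empty: "(\<Sum>H\<in>Pow {}. g H) = g {}"
  by simp

text \<open>Splitting off one edge at a time lets the simplifier enumerate the edge sets of a
  concrete circuit.\<close>

lemma sum_Pow_insert:
  assumes "finite A" "a \<notin> A"
  shows "(\<Sum>H\<in>Pow (insert a A). g H) = (\<Sum>H\<in>Pow A. g H) + (\<Sum>H\<in>Pow A. g (insert a H))"
proof -
  have "inj_on (insert a) (Pow A)" using assms(2) by (auto simp: inj_on_def)
  moreover have "Pow A \<inter> insert a ` Pow A = {}" using assms(2) by auto
  ultimately show ?thesis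
    using assms(1) by (simp add: Pow_insert sum.union_disjoint sum.reindex)
qed

lemma tuples_0: "tuples 0 = {[]}"
  by (simp add: tuples_def)

lemma sum_tuples_Suc: "(\<Sum>x\<in>tuples (Suc k). g x) = (\<Sum>x\<in>tuples k. g (False # x)) + (\<Sum>x\<in>tuples k. g (True # x))"
proof -
  have "tuples (Suc k) = (#) False ` tuples k \<union> (#) True ` tuples k"
    by (auto simp: tuples_def length_Suc_conv image_iff)
  moreover have "(#) False ` tuples k \<inter> (#) True ` tuples k = {}" by auto
  ultimately show ?thesis by (simp add: sum.union_disjoint sum.reindex)
qed

lemma less_numeral_all:
  "(\<forall>i<2::nat. P i) \<longleftrightarrow> P 0 \<and> P 1"
  "(\<forall>i<3::nat. P i) \<longleftrightarrow> P 0 \<and> P 1 \<and> P 2"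
  "(\<forall>i<4::nat. P i) \<longleftrightarrow> P 0 \<and> P 1 \<and> P 2 \<and> P 3"
  by (auto simp: eval_nat_numeral All_less_Suc)

lemma card_filter_sum: "finite A \<Longrightarrow> card {e \<in> A. P e} = (\<Sum>e\<in>A. of_bool (P e))"
  by (simp add: of_bool_def sum.If_cases Int_def)

lemma terminal_eqI: "circuit_graph k n E \<Longrightarrow> i < k \<Longrightarrow> e \<in> E \<Longrightarrow> External i \<in> e \<Longrightarrow> terminal E i = e"
  using circuit_graph_terminal(3) by blast

text \<open>With weight \<open>c\<close> on the middle edge, the match-circuit gives
  \<open>c\<close> plus the product of the two spins, and the even-circuit gives 1 plus
  \<open>c\<close> times that product. Both are binary Ising functions up to a scalar.\<close>

definition path_edges :: "cvertex set set" where
  "path_edges = {{External 0, Internal 0}, {External 1, Internal 1}, {Internal 0, Internal 1}}"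

lemma circuit_graph_path: "circuit_graph 2 2 path_edges"
proof -
  have "finite path_edges" by (simp add: path_edges_def)
  then show ?thesis
    unfolding circuit_graph_def less_numeral_all card_filter_sum [OF \<open>finite path_edges\<close>]
    unfolding path_edges_def
    by (simp add: doubleton_eq_iff circuit_vertices_def)
qed

lemma path_terminals:
  "terminal path_edges 0 = {External 0, Internal 0}" "terminal path_edges (Suc 0) = {External 1, Internal 1}"
  by (rule terminal_eqI [OF circuit_graph_path]; simp add: path_edges_def)+

lemma path_circuit_value:
  assumes "w {External 0, Internal 0} = 1" "w {External 1, Internal 1} = 1"
  shows "circuit_value deg 2 2 path_edges w [p, q] = of_bool (deg (of_bool p) \<and> deg (of_bool q)) +
    of_bool (deg (Suc (of_bool p)) \<and> deg (Suc (of_bool q))) * w {Internal 0, Internal 1}"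
proof -
  have "finite path_edges" by (simp add: path_edges_def)
  then show ?thesis
    using assms unfolding circuit_value_Pow [OF \<open>finite path_edges\<close>] less_numeral_all One_nat_def path_terminals
    by (cases p; cases q; simp add: path_edges_def sum_Pow_insert sum_Pow_empty doubleton_eq_iff)
qed

definition binary_fun :: "real \<Rightarrow> real \<Rightarrow> bool list \<Rightarrow> real" where
  "binary_fun a b = (\<lambda>x\<in>tuples 2. if x ! 0 = x ! 1 then a else b)"

lemma asg_binary_fun: "asg 2 (binary_fun a b) = (\<lambda>s. if s 0 = s 1 then a else b)"
  unfolding binary_fun_def by (simp add: asg_restrict) (simp add: asg_def fun_eq_iff numeral_2_eq_2)

lemma binary_fun_in_B: "0 \<le> a \<Longrightarrow> 0 \<le> b \<Longrightarrow> (2, binary_fun a b) \<in> \<B>"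
  by (auto simp: binary_fun_def \<B>_def intro: tuple_fun_in_B)

lemma fourier_binary_fun:
  "fourier 2 (binary_fun a b) [p, q] = (if p \<noteq> q then 0 else if p then (a - b) / 2 else (a + b) / 2)"
  by (cases p; cases q; simp add: fourier_def numeral_2_eq_2 sum_tuples_Suc tuples_0 hweight_def binary_fun_def)

lemma ball_tuples_2: "(\<forall>y\<in>tuples 2. P y) \<longleftrightarrow> (\<forall>p q. P [p, q])"
  by (auto simp: tuples_def numeral_2_eq_2 length_Suc_conv)

lemma path_terminal_set: "terminals 2 path_edges = {{External 0, Internal 0}, {External 1, Internal 1}}"
proof -
  have "{..<2::nat} = {0, Suc 0}" by auto
  then show ?thesis by (simp add: terminals_def path_terminals)
qed

definition last_edge_weight :: "real \<Rightarrow> cvertex set \<Rightarrow> real" where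
  "last_edge_weight c e = (if e = {Internal 0, Internal 1} then c else 1)"

lemma binary_fun_match:
  assumes "0 < c" shows "match_implemented 2 (fourier 2 (binary_fun (c + 1) (c - 1)))"
  unfolding match_implemented_def ball_tuples_2 fourier_binary_fun
proof (intro exI [of _ 2] exI [of _ path_edges] exI [of _ "last_edge_weight c"] conjI allI)
  show "match_circuit 2 2 path_edges (last_edge_weight c)"
    using assms circuit_graph_path unfolding match_circuit_def path_terminal_set
    by (simp add: last_edge_weight_def doubleton_eq_iff)
next
  fix p q
  have "last_edge_weight c {External i, Internal j} = 1" for i j
    by (simp add: last_edge_weight_def doubleton_eq_iff)
  then show "(if p \<noteq> q then 0 else if p then (c + 1 - (c - 1)) / 2 else (c + 1 + (c - 1)) / 2) =
      circuit_value (\<lambda>d. d = 1) 2 2 path_edges (last_edge_weight c) [p, q]"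
    by (simp add: path_circuit_value last_edge_weight_def)
qed

lemma binary_fun_even:
  assumes "0 < c" "c \<le> 1" shows "even_implemented 2 (fourier 2 (binary_fun (1 + c) (1 - c)))"
  unfolding even_implemented_def ball_tuples_2 fourier_binary_fun
proof (intro exI [of _ 2] exI [of _ path_edges] exI [of _ "last_edge_weight c"] conjI allI)
  show "even_circuit 2 2 path_edges (last_edge_weight c)"
    using assms circuit_graph_path unfolding even_circuit_def path_terminal_set
    by (simp add: last_edge_weight_def doubleton_eq_iff)
next
  fix p q
  have "last_edge_weight c {External i, Internal j} = 1" for i j
    by (simp add: last_edge_weight_def doubleton_eq_iff)
  then show "(if p \<noteq> q then 0 else if p then (1 + c - (1 - c)) / 2 else (1 + c + (1 - c)) / 2) =
      circuit_value even 2 2 path_edges (last_edge_weight c) [p, q]"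
    by (simp add: path_circuit_value last_edge_weight_def)
qed

lemma nullary_cases:
  assumes "g \<in> nullary"
  obtains c where "0 \<le> c" "g = (0, \<lambda>x\<in>tuples 0. c)"
proof -
  obtain f where f: "g = (0, f)" "f \<in> \<B>\<^sub>a 0" using assms by (auto simp: nullary_def)
  then have "f = (\<lambda>x\<in>tuples 0. f [])"
    by (intro PiE_ext [of _ "tuples 0" "\<lambda>_. {0..}"]) (auto simp: \<B>\<^sub>a_def tuples_0 PiE_iff)
  moreover have "0 \<le> f []" using f by (auto simp: \<B>\<^sub>a_def tuples_0 PiE_iff)
  ultimately show ?thesis using that f by blast
qed

lemma fourier_nullary: "fourier 0 (\<lambda>x\<in>tuples 0. c) [] = c"
  by (simp add: fourier_def tuples_0 hweight_def)

lemma nullary_subset_M: "nullary \<subseteq> \<M>"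
proof
  fix g assume "g \<in> nullary"
  then obtain c where c: "0 \<le> c" "g = (0, \<lambda>x\<in>tuples 0. c)" by (rule nullary_cases)
  have "\<exists>n E w. match_circuit 0 n E w \<and> c = circuit_value (\<lambda>d. d = 1) 0 n E w []"
  proof (cases "c = 0")
    case True
    \<comment> \<open>An isolated internal vertex can never be covered, which gives the value 0. In
      the other case a single internal edge is forced and contributes its weight.\<close>
    have "match_circuit 0 1 {} (\<lambda>_. 1)" by (simp add: match_circuit_def circuit_graph_def)
    moreover have "circuit_value (\<lambda>d. d = 1) 0 1 {} (\<lambda>_. 1) [] = 0" by (simp add: circuit_value_Pow sum_Pow_empty)
    ultimately show ?thesis using True by metis
  next
    case False
    let ?E = "{{Internal 0, Internal 1}}"
    have "match_circuit 0 2 ?E (\<lambda>_. c)"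
      using False c by (simp add: match_circuit_def circuit_graph_def circuit_vertices_def terminals_def)
    moreover have "circuit_value (\<lambda>d. d = 1) 0 2 ?E (\<lambda>_. c) [] = c"
      by (simp add: circuit_value_Pow less_numeral_all sum_Pow_insert sum_Pow_empty)
    ultimately show ?thesis by metis
  qed
  moreover have "g \<in> \<B>" using \<open>g \<in> nullary\<close> nullary_subset_B by blast
  ultimately show "g \<in> \<M>"
    by (simp add: c(2) \<M>_def match_implemented_def tuples_0 fourier_nullary [unfolded tuples_0])
qed

lemma nullary_subset_E: "nullary \<subseteq> \<E>"
proof
  fix g assume "g \<in> nullary"
  then obtain c where c: "0 \<le> c" "g = (0, \<lambda>x\<in>tuples 0. c)" by (rule nullary_cases)
  have "even_circuit 0 0 {} (\<lambda>_. 1)" by (simp add: even_circuit_def circuit_graph_def)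
  moreover have "circuit_value even 0 0 {} (\<lambda>_. 1) [] = 1" by (simp add: circuit_value_Pow sum_Pow_empty)
  ultimately have "even_implemented 0 (fourier 0 (\<lambda>x\<in>tuples 0. 1))"
    unfolding even_implemented_def tuples_0 by (metis fourier_nullary singletonD tuples_0)
  moreover have "g = (0, \<lambda>x\<in>tuples 0. c * (\<lambda>x\<in>tuples 0. 1) x)"
    unfolding c(2) by (simp add: restrict_def fun_eq_iff)
  moreover have "(0, \<lambda>x\<in>tuples 0. 1) \<in> \<B>" by (auto simp: \<B>_def intro: tuple_fun_in_B)
  ultimately show "g \<in> \<E>" using c(1) unfolding \<E>_def by blast
qed

lemma omega_clone_M_omega: "omega_clone \<M>_omega"
  by (rule omega_clone_omega_closure [OF M_subset_B])

lemma I_ferro_subset_M_omega: "\<I>_ferro \<subseteq> \<M>_omega"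
proof -
  have M: "insert EQ \<M> \<subseteq> \<M>_omega" by (rule subset_omega_closure)
  interpret scaled_omega_clone \<M>_omega
    using M nullary_subset_M by unfold_locales (auto intro: omega_clone_M_omega)
  have "ising 2 lam \<in> \<M>_omega" if lam: "0 \<le> lam" "lam \<le> 1" for lam
  proof (cases "lam = 1")
    case False
    \<comment> \<open>Solves \<open>(c - 1) / (c + 1) = lam\<close>. No finite weight does so for
      \<open>lam = 1\<close>, where the function is constant.\<close>
    define c where "c = (1 + lam) / (1 - lam)"
    have c: "1 \<le> c" using lam False by (simp add: c_def)
    have "(2, binary_fun (c + 1) (c - 1)) \<in> \<M>"
      using c binary_fun_match [of c] by (simp add: \<M>_def binary_fun_in_B)
    then have "expressible \<M>_omega 2 (asg 2 (binary_fun (c + 1) (c - 1)))"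
      using M by (intro expressibleI) blast
    from ising_2_memI [OF this [unfolded asg_binary_fun]] have "ising 2 ((c - 1) / (c + 1)) \<in> \<M>_omega"
      using c by simp
    moreover have "(c - 1) / (c + 1) = lam" using lam False by (simp add: c_def field_simps)
    ultimately show ?thesis by simp
  qed (use ising_2_one in simp)
  then show ?thesis
    unfolding \<I>_ferro_def using closed M nullary_subset_M omega_clone_M_omega
    by (intro omega_closure_minimal Un_least subsetI) (auto simp: omega_clone_iff)
qed

lemma I_ferro_eq: "\<I>_ferro = omega_closure \<E>"
proof
  show "omega_closure \<E> \<subseteq> \<I>_ferro"
    using omega_clone_I_ferro E_subset_I_ferro by (intro omega_closure_minimal) (auto simp: omega_clone_iff)
  have E: "insert EQ \<E> \<subseteq> omega_closure \<E>" by (rule subset_omega_closure)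
  note clone = omega_clone_omega_closure [OF E_subset_B]
  interpret scaled_omega_clone "omega_closure \<E>"
    using E nullary_subset_E by unfold_locales (auto intro: clone)
  have "ising 2 lam \<in> omega_closure \<E>" if lam: "0 \<le> lam" "lam \<le> 1" for lam
  proof (cases "lam = 1")
    case False
    \<comment> \<open>Solves \<open>(1 - c) / (1 + c) = lam\<close>; at \<open>lam = 1\<close> this
      would be weight 0, which no edge has.\<close>
    define c where "c = (1 - lam) / (1 + lam)"
    have c: "0 < c" "c \<le> 1" using lam False by (simp_all add: c_def)
    have "(2, binary_fun (1 + c) (1 - c)) \<in> \<B>" using c by (intro binary_fun_in_B) auto
    moreover have "binary_fun (1 + c) (1 - c) = (\<lambda>x\<in>tuples 2. 1 * binary_fun (1 + c) (1 - c) x)"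
      by (simp add: binary_fun_def restrict_def fun_eq_iff)
    ultimately have "(2, binary_fun (1 + c) (1 - c)) \<in> \<E>"
      using binary_fun_even [OF c] unfolding \<E>_def
      by (intro CollectI exI [of _ "2::nat"] exI [of _ "1::real"] exI [of _ "binary_fun (1 + c) (1 - c)"]) simp
    then have "expressible (omega_closure \<E>) 2 (asg 2 (binary_fun (1 + c) (1 - c)))"
      using E by (intro expressibleI) blast
    from ising_2_memI [OF this [unfolded asg_binary_fun]] have "ising 2 ((1 - c) / (1 + c)) \<in> omega_closure \<E>"
      using c by simp
    moreover have "(1 - c) / (1 + c) = lam" using lam False by (simp add: c_def field_simps)
    ultimately show ?thesis by simp
  qed (use ising_2_one in simp)
  then show "\<I>_ferro \<subseteq> omega_closure \<E>"
    unfolding \<I>_ferro_def using E nullary_subset_E clone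
    by (intro omega_closure_minimal Un_least subsetI) (auto simp: omega_clone_iff)
qed

text \<open>The detached last edge lies in every admissible edge set. It supplies the required
  number of internal vertices without leaving one that cannot be covered.\<close>

definition star_edges :: "cvertex set set" where
  "star_edges = {{External 0, Internal 0}, {External 1, Internal 0}, {External 2, Internal 1},
     {Internal 0, Internal 1}, {Internal 2, Internal 3}}"

lemma circuit_graph_star: "circuit_graph 3 4 star_edges"
proof -
  have "finite star_edges" by (simp add: star_edges_def)
  then show ?thesis
    unfolding circuit_graph_def less_numeral_all card_filter_sum [OF \<open>finite star_edges\<close>]
    unfolding star_edges_def
    by (simp add: doubleton_eq_iff circuit_vertices_def)
qed

lemma star_terminals:
  "terminal star_edges 0 = {External 0, Internal 0}" "terminal star_edges (Suc 0) = {External 1, Internal 0}"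
  "terminal star_edges 2 = {External 2, Internal 1}"
  by (rule terminal_eqI [OF circuit_graph_star]; simp add: star_edges_def)+

lemma star_terminal_set:
  "terminals 3 star_edges = {{External 0, Internal 0}, {External 1, Internal 0}, {External 2, Internal 1}}"
proof -
  have "{..<3::nat} = {0, Suc 0, 2}" by auto
  then show ?thesis by (simp add: terminals_def star_terminals)
qed

definition star_fun :: "bool list \<Rightarrow> real" where
  "star_fun = (\<lambda>x\<in>tuples 3. 2 + (real_spin (x ! 0) + real_spin (x ! 1)) * real_spin (x ! 2))"

lemma asg_star_fun: "asg 3 star_fun s = 2 + (real_spin (s 0) + real_spin (s 1)) * real_spin (s 2)"
  unfolding star_fun_def by (simp add: asg_restrict) (simp add: asg_def eval_nat_numeral)

lemma star_fun_in_B: "(3, star_fun) \<in> \<B>"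
  by (auto simp: star_fun_def \<B>_def real_spin_def intro!: tuple_fun_in_B)

lemma ball_tuples_3: "(\<forall>y\<in>tuples 3. P y) \<longleftrightarrow> (\<forall>p q r. P [p, q, r])"
  by (auto simp: tuples_def eval_nat_numeral length_Suc_conv)

lemma fourier_star_fun:
  "fourier 3 star_fun [p, q, r] = (if r then of_bool (p \<noteq> q) else if p \<or> q then 0 else 2)"
  by (cases p; cases q; cases r; simp add: fourier_def eval_nat_numeral sum_tuples_Suc tuples_0 hweight_def star_fun_def)
     (simp_all add: tuples_def real_spin_def)

lemma star_circuit_value:
  "circuit_value (\<lambda>d. d = 1) 3 4 star_edges (last_edge_weight 2) [p, q, r] =
    (if r then of_bool (p \<noteq> q) else if p \<or> q then 0 else 2)"
proof -
  have "finite star_edges" by (simp add: star_edges_def)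
  then show ?thesis
    unfolding circuit_value_Pow [OF \<open>finite star_edges\<close>] less_numeral_all One_nat_def star_terminals
    by (cases p; cases q; cases r; simp add: star_edges_def sum_Pow_insert sum_Pow_empty doubleton_eq_iff last_edge_weight_def)
qed

lemma star_fun_in_M: "(3, star_fun) \<in> \<M>"
proof -
  have "match_circuit 3 4 star_edges (last_edge_weight 2)"
    using circuit_graph_star unfolding match_circuit_def star_terminal_set
    by (simp add: last_edge_weight_def doubleton_eq_iff)
  then have "match_implemented 3 (fourier 3 star_fun)"
    unfolding match_implemented_def ball_tuples_3 using fourier_star_fun star_circuit_value by metis
  then show ?thesis by (simp add: \<M>_def star_fun_in_B)
qed

lemma not_M_omega_subset_H_ferro: "\<not> \<M>_omega \<subseteq> \<H>_ferro"
proof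
  assume "\<M>_omega \<subseteq> \<H>_ferro"
  then have "(3, star_fun) \<in> LSM"
    using star_fun_in_M subset_omega_closure [of \<M>] H_ferro_subset_LSM by blast
  then have lsm: "asg 3 star_fun s * asg 3 star_fun t \<le> asg 3 star_fun (\<lambda>i. s i \<or> t i) * asg 3 star_fun (\<lambda>i. s i \<and> t i)" for s t
    by (simp add: LSM_def asg_class_def)
  \<comment> \<open>The value is 2 at both assignments, 0 at their join and 4 at their meet, so the
    inequality would read 4 <= 0.\<close>
  show False
    using lsm [of "\<lambda>i. i = 0" "\<lambda>i. i = 1"] by (simp add: asg_star_fun real_spin_def)
qed

section \<open>The sublattice\<close>

text \<open>The coefficient at the tuple 1 is 1/2 or -1/2 depending on \<open>c\<close>, so the two
  pins separate \<open>\<P>\<close> and \<open>\<P>\<N>\<close>, and both from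
  \<open>\<S>\<D>\<close>.\<close>

definition delta_fun :: "bool \<Rightarrow> bool list \<Rightarrow> real" where
  "delta_fun c = (\<lambda>x\<in>tuples 1. of_bool (x ! 0 = c))"

lemma delta_fun_in_B: "(1, delta_fun c) \<in> \<B>"
  by (auto simp: delta_fun_def \<B>_def intro!: tuple_fun_in_B)

lemma fourier_delta_fun: "fourier 1 (delta_fun c) [p] = (if c \<and> p then - 1 / 2 else 1 / 2)"
  unfolding One_nat_def delta_fun_def
  by (cases c; cases p; simp add: fourier_def sum_tuples_Suc tuples_0 hweight_def; simp add: tuples_def)

lemma ball_tuples_1: "(\<forall>y\<in>tuples 1. P y) \<longleftrightarrow> (\<forall>p. P [p])"
  by (auto simp: tuples_def length_Suc_conv)

lemma delta_fun_not_SD: "(1, delta_fun c) \<notin> \<S>\<D>"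
proof -
  have "delta_fun c [True] \<noteq> delta_fun c (map Not [True])" "[True] \<in> tuples 1"
    by (simp_all add: delta_fun_def tuples_def)
  then show ?thesis unfolding \<S>\<D>_def by blast
qed

lemma delta_fun_False: "(1, delta_fun False) \<in> \<P>" "(1, delta_fun False) \<notin> \<P>\<N>"
  unfolding \<P>_def \<P>\<N>_def mem_Collect_eq case_prod_conv ball_tuples_1 fourier_delta_fun
  by (auto simp: delta_fun_in_B [simplified] hweight_def intro!: exI [of _ True])

lemma delta_fun_True: "(1, delta_fun True) \<in> \<P>\<N>" "(1, delta_fun True) \<notin> \<P>"
  unfolding \<P>_def \<P>\<N>_def mem_Collect_eq case_prod_conv ball_tuples_1 fourier_delta_fun
  by (auto simp: delta_fun_in_B [simplified] hweight_def intro!: exI [of _ True])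

text \<open>This is disequality, whose coefficient at the even tuple (1,1) is -1/2.\<close>

lemma binary_fun_SD: "(2, binary_fun 0 1) \<in> \<S>\<D>" "(2, binary_fun 0 1) \<notin> \<P>" "(2, binary_fun 0 1) \<notin> \<P>\<N>"
proof -
  show "(2, binary_fun 0 1) \<in> \<S>\<D>"
    by (simp add: SD_eq asg_class_def binary_fun_in_B asg_binary_fun)
  have "[True, True] \<in> tuples 2" "even (hweight [True, True])" "fourier 2 (binary_fun 0 1) [True, True] < 0"
    by (simp_all add: tuples_def hweight_def fourier_binary_fun)
  then show "(2, binary_fun 0 1) \<notin> \<P>" "(2, binary_fun 0 1) \<notin> \<P>\<N>"
    unfolding \<P>_def \<P>\<N>_def by (auto simp: not_le [symmetric] simp del: not_le)
qed

section \<open>Joins and meets in the sublattice\<close>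

lemma omega_join_maximal:
  assumes "maximal_in F \<B>" "omega_clone G" "\<not> G \<subseteq> F"
  shows "omega_join F G = \<B>"
proof -
  have F: "omega_clone F" using assms(1) by (simp add: maximal_in_def)
  note lub = omega_join_lub [OF F assms(2)]
  have "F \<subset> omega_join F G" using lub(2,3) assms(3) by blast
  then have "\<not> omega_join F G \<subset> \<B>" using assms(1) lub(1) unfolding maximal_in_def by blast
  moreover have "omega_join F G \<subseteq> \<B>" using lub(1) by (simp add: omega_clone_iff)
  ultimately show ?thesis by blast
qed

lemma omega_join_subset: "omega_clone F \<Longrightarrow> omega_clone G \<Longrightarrow> F \<subseteq> G \<Longrightarrow> omega_join F G = G"
  using omega_join_lub by (meson order_refl subset_antisym)

lemma omega_join_commute: "omega_join F G = omega_join G F"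
  by (simp add: omega_join_def Un_commute)

lemma omega_sublatticeI:
  assumes "L \<noteq> {}" "\<And>F. F \<in> L \<Longrightarrow> omega_clone F"
    and "\<And>F G. F \<in> L \<Longrightarrow> G \<in> L \<Longrightarrow> F \<subseteq> G \<or> G \<subseteq> F \<or> omega_join F G \<in> L \<and> omega_meet F G \<in> L"
  shows "omega_sublattice L"
  unfolding omega_sublattice_def
proof (intro conjI ballI)
  fix F G assume FG: "F \<in> L" "G \<in> L"
  consider "F \<subseteq> G" | "G \<subseteq> F" | "omega_join F G \<in> L" "omega_meet F G \<in> L" using assms(3) [OF FG] by blast
  then have "omega_join F G \<in> L \<and> omega_meet F G \<in> L"
  proof cases
    case 1
    then show ?thesis using FG assms(2) by (simp add: omega_join_subset omega_meet_def Int_absorb2)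
  next
    case 2
    then show ?thesis using FG assms(2)
      by (simp add: omega_join_commute [of F] omega_join_subset omega_meet_def Int_absorb1)
  qed blast
  then show "omega_join F G \<in> L" "omega_meet F G \<in> L" by simp_all
qed (use assms in auto)

lemma H_ferro_generators: "{ising k lam |k lam. 2 \<le> k \<and> 0 \<le> lam \<and> lam \<le> 1} \<union> nullary \<subseteq> \<B>"
  using nullary_subset_B ising_in_B by auto

lemma omega_clone_H_ferro: "omega_clone \<H>_ferro"
  unfolding \<H>_ferro_def by (rule omega_clone_omega_closure [OF H_ferro_generators])

lemma I_ferro_subset_H_ferro: "\<I>_ferro \<subseteq> \<H>_ferro"
proof -
  have "insert EQ ({ising k lam |k lam. 2 \<le> k \<and> 0 \<le> lam \<and> lam \<le> 1} \<union> nullary) \<subseteq> \<H>_ferro"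
    unfolding \<H>_ferro_def by (rule subset_omega_closure)
  then show ?thesis
    unfolding \<I>_ferro_def using omega_clone_H_ferro
    by (intro omega_closure_minimal) (auto simp: omega_clone_iff)
qed

lemma omega_clone_B: "omega_clone \<B>"
  using closed_under_ops_B closed_under_limits_B EQ_in_B by (simp add: omega_clone_iff)

theorem theorem3p1:
  fixes Ls :: "bfun set list"
  assumes "Ls = [\<B>, \<S>\<D>, \<P>, \<P>\<N>, \<S>\<D>\<P>, omega_closure (\<M>_omega \<union> \<H>_ferro),
                 \<M>_omega, \<H>_ferro, \<M>_omega \<inter> \<H>_ferro, \<I>_ferro]"
  shows
    \<comment> \<open>(a)\<close>
    "((\<forall>F\<in>set Ls. omega_clone F) \<and> omega_sublattice (set Ls)) \<and>
    \<comment> \<open>(b)\<close>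
    (\<forall>i<10. \<forall>j<10. i < j \<and> (i, j) \<noteq> (4, 5) \<and> (i, j) \<noteq> (8, 9) \<longrightarrow> Ls ! i \<noteq> Ls ! j) \<and>
    \<comment> \<open>(c)\<close>
    (\<S>\<D> \<subseteq> \<B> \<and> \<P> \<subseteq> \<B> \<and> \<P>\<N> \<subseteq> \<B> \<and>
     incomparable \<S>\<D> \<P> \<and> incomparable \<S>\<D> \<P>\<N> \<and> incomparable \<P> \<P>\<N> \<and>
     omega_join \<S>\<D> \<P> = \<B> \<and> omega_join \<S>\<D> \<P>\<N> = \<B> \<and> omega_join \<P> \<P>\<N> = \<B> \<and>
     omega_meet \<S>\<D> \<P> = \<S>\<D>\<P> \<and> omega_meet \<S>\<D> \<P>\<N> = \<S>\<D>\<P> \<and> omega_meet \<P> \<P>\<N> = \<S>\<D>\<P> \<and>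
     omega_closure (\<M>_omega \<union> \<H>_ferro) \<subseteq> \<S>\<D>\<P> \<and>
     incomparable \<M>_omega \<H>_ferro \<and>
     \<M>_omega \<subseteq> omega_closure (\<M>_omega \<union> \<H>_ferro) \<and>
     \<H>_ferro \<subseteq> omega_closure (\<M>_omega \<union> \<H>_ferro) \<and>
     omega_join \<M>_omega \<H>_ferro = omega_closure (\<M>_omega \<union> \<H>_ferro) \<and>
     \<M>_omega \<inter> \<H>_ferro \<subseteq> \<M>_omega \<and> \<M>_omega \<inter> \<H>_ferro \<subseteq> \<H>_ferro \<and>
     omega_meet \<M>_omega \<H>_ferro = \<M>_omega \<inter> \<H>_ferro \<and>
     \<I>_ferro \<subseteq> \<M>_omega \<inter> \<H>_ferro) \<and>
    \<comment> \<open>(d)\<close>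
    (\<S>\<D> = \<I>_anti \<and>
     \<I>_ferro = omega_closure \<E> \<and>
     maximal_in \<S>\<D> \<B> \<and> maximal_in \<P> \<B> \<and> maximal_in \<P>\<N> \<B> \<and>
     maximal_in \<S>\<D>\<P> \<S>\<D>)"
proof -
  define J where "J = omega_closure (\<M>_omega \<union> \<H>_ferro)"
  have clones: "omega_clone \<B>" "omega_clone \<S>\<D>" "omega_clone \<P>" "omega_clone \<P>\<N>" "omega_clone \<S>\<D>\<P>"
    "omega_clone \<M>_omega" "omega_clone \<H>_ferro" "omega_clone \<I>_ferro"
    by (simp_all only: omega_clone_B omega_clone_SD omega_clone_P omega_clone_PN omega_clone_SDP
        omega_clone_M_omega omega_clone_H_ferro omega_clone_I_ferro)
  let ?MH = "\<M>_omega \<inter> \<H>_ferro"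
  have J_join: "omega_join \<M>_omega \<H>_ferro = J" by (simp add: J_def omega_join_def)
  have clone_J: "omega_clone J" using omega_join_lub(1) [OF clones(6,7)] J_join by simp
  have meet: "omega_meet \<M>_omega \<H>_ferro = ?MH" by (simp add: omega_meet_def)
  have clone_meet: "omega_clone (?MH)" using omega_meet_glb(1) [OF clones(6,7)] meet by simp
  have sub_B: "\<S>\<D> \<subseteq> \<B>" "\<P> \<subseteq> \<B>" "\<P>\<N> \<subseteq> \<B>" using clones by (simp_all only: omega_clone_iff)
  have SDP_sub: "\<S>\<D>\<P> \<subseteq> \<S>\<D>" "\<S>\<D>\<P> \<subseteq> \<P>" "\<S>\<D>\<P> \<subseteq> \<P>\<N>" by (auto simp: \<S>\<D>\<P>_def)
  have J_sub: "J \<subseteq> \<S>\<D>\<P>"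
    using omega_join_lub(4) [OF clones(6,7,5) M_omega_subset_SDP H_ferro_subset_SDP] J_join by simp
  have sub_J: "\<M>_omega \<subseteq> J" "\<H>_ferro \<subseteq> J"
    using omega_join_lub(2,3) [OF clones(6,7)] J_join by simp_all
  have I_sub: "\<I>_ferro \<subseteq> ?MH"
    using I_ferro_subset_M_omega I_ferro_subset_H_ferro by blast
  have incomp: "\<not> \<S>\<D> \<subseteq> \<P>" "\<not> \<S>\<D> \<subseteq> \<P>\<N>" "\<not> \<P> \<subseteq> \<S>\<D>" "\<not> \<P> \<subseteq> \<P>\<N>" "\<not> \<P>\<N> \<subseteq> \<S>\<D>" "\<not> \<P>\<N> \<subseteq> \<P>"
    using binary_fun_SD delta_fun_False delta_fun_True delta_fun_not_SD by blast+
  note incomp_MH = not_M_omega_subset_H_ferro not_H_ferro_subset_M_omega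
  have max: "maximal_in \<S>\<D> \<B>" "maximal_in \<P> \<B>" "maximal_in \<P>\<N> \<B>"
    by (simp_all only: maximal_in_SD_B P_eq PN_eq maximal_in_flipped_P_B)
  have joins: "omega_join \<S>\<D> \<P> = \<B>" "omega_join \<S>\<D> \<P>\<N> = \<B>" "omega_join \<P> \<P>\<N> = \<B>"
    using max clones incomp by (simp_all add: omega_join_maximal)
  have meets: "omega_meet \<S>\<D> \<P> = \<S>\<D>\<P>" "omega_meet \<S>\<D> \<P>\<N> = \<S>\<D>\<P>" "omega_meet \<P> \<P>\<N> = \<S>\<D>\<P>"
    by (simp_all only: omega_meet_def SDP_eq [symmetric])
  have set_Ls: "set Ls = {\<B>, \<S>\<D>, \<P>, \<P>\<N>, \<S>\<D>\<P>, J, \<M>_omega, \<H>_ferro, ?MH, \<I>_ferro}"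
    using assms by (simp add: J_def)
  have all_clones: "\<forall>F\<in>set Ls. omega_clone F"
    unfolding set_Ls using clones clone_J clone_meet by blast
  have sublattice: "omega_sublattice (set Ls)"
  proof (rule omega_sublatticeI)
    fix F G assume "F \<in> set Ls" "G \<in> set Ls"
    \<comment> \<open>The ordered pairs whose join and meet have to be computed; all other pairs
      turn out to be comparable.\<close>
    let ?I = "{(\<S>\<D>, \<P>), (\<P>, \<S>\<D>), (\<S>\<D>, \<P>\<N>), (\<P>\<N>, \<S>\<D>), (\<P>, \<P>\<N>), (\<P>\<N>, \<P>), (\<M>_omega, \<H>_ferro), (\<H>_ferro, \<M>_omega)}"
    note comm = omega_join_commute [of \<P> \<S>\<D>] omega_join_commute [of \<P>\<N> \<S>\<D>] omega_join_commute [of \<P>\<N> \<P>]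
      omega_join_commute [of \<H>_ferro \<M>_omega] Int_commute [of \<P> \<S>\<D>] Int_commute [of \<P>\<N> \<S>\<D>]
      Int_commute [of \<P>\<N> \<P>] Int_commute [of \<H>_ferro \<M>_omega]
    have ops: "omega_join A B \<in> set Ls \<and> omega_meet A B \<in> set Ls"
      if "(A, B) \<in> ?I" for A B
      using that joins meets J_join unfolding set_Ls omega_meet_def
      by (elim insertE emptyE; simp add: comm)
    have sub_J': "\<M>_omega \<subseteq> \<S>\<D>\<P>" "\<H>_ferro \<subseteq> \<S>\<D>\<P>" using J_sub sub_J by blast+
    have meet_sub: "?MH \<subseteq> \<M>_omega" "?MH \<subseteq> \<H>_ferro" by blast+
    show "F \<subseteq> G \<or> G \<subseteq> F \<or> omega_join F G \<in> set Ls \<and> omega_meet F G \<in> set Ls"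
    proof (cases "(F, G) \<in> ?I")
      case True
      show ?thesis by (intro disjI2 ops [OF True])
    next
      case False
      have chain: "X \<subseteq> Y" if "X \<subseteq> \<S>\<D>\<P>" "Y \<in> {\<B>, \<S>\<D>, \<P>, \<P>\<N>, \<S>\<D>\<P>}" for X Y
        using that(2) subset_trans [OF that(1)] SDP_sub subset_trans [OF SDP_sub(1) sub_B(1)]
        by (elim insertE emptyE) (simp_all only: that(1))
      have low: "X \<subseteq> \<S>\<D>\<P>" if "X \<in> {\<S>\<D>\<P>, J, \<M>_omega, \<H>_ferro, ?MH, \<I>_ferro}" for X
        using that J_sub sub_J' le_infI1 [OF sub_J'(1)] subset_trans [OF I_sub le_infI1 [OF sub_J'(1)]]
        by (elim insertE emptyE; simp)
      let ?top = "{\<B>, \<S>\<D>, \<P>, \<P>\<N>, \<S>\<D>\<P>}" and ?bot = "{J, \<M>_omega, \<H>_ferro, ?MH, \<I>_ferro}"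
      have "F \<in> ?top \<or> F \<in> ?bot" "G \<in> ?top \<or> G \<in> ?bot"
        using \<open>F \<in> set Ls\<close> \<open>G \<in> set Ls\<close> unfolding set_Ls insert_iff empty_iff by argo+
      then consider "F \<in> ?top" "G \<in> ?top" | "F \<in> ?top" "G \<in> ?bot" | "F \<in> ?bot" "G \<in> ?top" | "F \<in> ?bot" "G \<in> ?bot"
        by (elim disjE) (rule that; assumption)+
      then have "F \<subseteq> G \<or> G \<subseteq> F"
      proof cases
        case 1
        then show ?thesis using False SDP_sub sub_B subset_trans [OF SDP_sub(1) sub_B(1)] by (elim insertE emptyE; simp)
      next
        case 2
        from 2(2) have "G \<subseteq> \<S>\<D>\<P>" by (rule low [OF insertI2])
        from chain [OF this 2(1)] show ?thesis ..
      next
        case 3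
        from 3(1) have "F \<subseteq> \<S>\<D>\<P>" by (rule low [OF insertI2])
        from chain [OF this 3(2)] show ?thesis ..
      next
        case 4
        then show ?thesis using False sub_J I_sub subset_trans [OF I_sub meet_sub(1)] subset_trans [OF I_sub meet_sub(2)]
            subset_trans [OF meet_sub(1) sub_J(1)] subset_trans [OF subset_trans [OF I_sub meet_sub(1)] sub_J(1)] meet_sub
          by (elim insertE emptyE; simp)
      qed
      then show ?thesis by argo
    qed
  next
    show "set Ls \<noteq> {}" by (simp add: set_Ls)
  qed (rule all_clones [rule_format])
  have neq: "\<B> \<noteq> \<S>\<D>" "\<B> \<noteq> \<P>" "\<B> \<noteq> \<P>\<N>" "\<S>\<D> \<noteq> \<P>" "\<S>\<D> \<noteq> \<P>\<N>" "\<P> \<noteq> \<P>\<N>"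
    using incomp sub_B by blast+
  have not_top: "X \<noteq> \<B>" "X \<noteq> \<S>\<D>" "X \<noteq> \<P>" "X \<noteq> \<P>\<N>" if "X \<subseteq> \<S>\<D>\<P>" for X
    using that incomp sub_B SDP_sub by blast+
  have not_J: "X \<noteq> J" "X \<noteq> \<S>\<D>\<P>" if "X \<subseteq> \<M>_omega \<or> X \<subseteq> \<H>_ferro" for X
    using that incomp_MH sub_J J_sub by blast+
  have not_MH: "X \<noteq> \<M>_omega" "X \<noteq> \<H>_ferro" if "X \<subseteq> ?MH" for X
    using that incomp_MH by blast+
  have "\<M>_omega \<noteq> \<H>_ferro" using incomp_MH by blast
  have low: "J \<subseteq> \<S>\<D>\<P>" "\<M>_omega \<subseteq> \<S>\<D>\<P>" "\<H>_ferro \<subseteq> \<S>\<D>\<P>" "?MH \<subseteq> \<S>\<D>\<P>" "\<I>_ferro \<subseteq> \<S>\<D>\<P>"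
    using J_sub sub_J I_sub by blast+
  have distinct: "\<forall>i<10. \<forall>j<10. i < j \<and> (i, j) \<noteq> (4, 5) \<and> (i, j) \<noteq> (8, 9) \<longrightarrow> Ls ! i \<noteq> Ls ! j"
  proof -
    \<comment> \<open>The list is cut into the blocks 0-3, 4-5, 6-7 and 8-9, and members of
      different blocks are separated wholesale. The undecided pairs (4,5) and (8,9) each fill one
      block.\<close>
    have top: "A \<noteq> X" if "A \<in> {\<B>, \<S>\<D>, \<P>, \<P>\<N>}" "X \<in> {\<S>\<D>\<P>, J, \<M>_omega, \<H>_ferro, ?MH, \<I>_ferro}" for A X
    proof -
      have "X \<subseteq> \<S>\<D>\<P>" using that(2) low by (elim insertE emptyE; simp)
      from not_top [OF this, symmetric] show ?thesis using that(1) by (elim insertE emptyE; simp)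
    qed
    have mid: "A \<noteq> X" if "A \<in> {\<S>\<D>\<P>, J}" "X \<in> {\<M>_omega, \<H>_ferro, ?MH, \<I>_ferro}" for A X
    proof -
      have "X \<subseteq> \<M>_omega \<or> X \<subseteq> \<H>_ferro" using that(2) I_sub by (elim insertE emptyE; simp)
      from not_J [OF this, symmetric] show ?thesis using that(1) by (elim insertE emptyE; simp)
    qed
    have bot: "A \<noteq> X" if "A \<in> {\<M>_omega, \<H>_ferro}" "X \<in> {?MH, \<I>_ferro}" for A X
    proof -
      have "X \<subseteq> ?MH" using that(2) I_sub by (elim insertE emptyE; simp)
      from not_MH [OF this, symmetric] show ?thesis using that(1) by (elim insertE emptyE; simp)
    qed
    have Ls: "Ls ! 0 = \<B>" "Ls ! 1 = \<S>\<D>" "Ls ! 2 = \<P>" "Ls ! 3 = \<P>\<N>" "Ls ! 4 = \<S>\<D>\<P>" "Ls ! 5 = J"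
      "Ls ! 6 = \<M>_omega" "Ls ! 7 = \<H>_ferro" "Ls ! 8 = ?MH" "Ls ! 9 = \<I>_ferro"
      by (simp_all add: assms J_def)
    have lt4: "i = 0 \<or> i = 1 \<or> i = 2 \<or> i = 3" if "i < 4" for i :: nat using that by arith
    have ge4: "i = 4 \<or> i = 5 \<or> i = 6 \<or> i = 7 \<or> i = 8 \<or> i = 9" if "\<not> i < 4" "i < 10" for i :: nat
      using that by arith
    have in_top: "Ls ! i \<in> {\<B>, \<S>\<D>, \<P>, \<P>\<N>}" if "i < 4" for i
      using lt4 [OF that] by (elim disjE; simp only: Ls insert_iff simp_thms)
    have in_low: "Ls ! i \<in> {\<S>\<D>\<P>, J, \<M>_omega, \<H>_ferro, ?MH, \<I>_ferro}" if "\<not> i < 4" "i < 10" for i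
      using ge4 [OF that] by (elim disjE; simp only: Ls insert_iff simp_thms)
    show ?thesis
    proof (intro allI impI)
      fix i j :: nat
      assume ij: "i < 10" "j < 10" "i < j \<and> (i, j) \<noteq> (4, 5) \<and> (i, j) \<noteq> (8, 9)"
      consider "i < 4" "j < 4" | "i < 4" "\<not> j < 4" | "\<not> i < 4" "i < 6" "\<not> j < 6" | "\<not> i < 6" "i < 8" "\<not> j < 8"
        | "i = 6" "j = 7"
        using ij by force
      then show "Ls ! i \<noteq> Ls ! j"
      proof cases
        case 1
        then show ?thesis using lt4 [OF 1(1)] lt4 [OF 1(2)] ij(3) neq by (elim disjE) (simp_all only: Ls; simp)+
      next
        case 2
        show ?thesis by (rule top [OF in_top [OF 2(1)] in_low [OF 2(2) ij(2)]])
      next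
        case 3
        then have "i = 4 \<or> i = 5" "j = 6 \<or> j = 7 \<or> j = 8 \<or> j = 9" using ij by arith+
        then have "Ls ! i \<in> {\<S>\<D>\<P>, J}" "Ls ! j \<in> {\<M>_omega, \<H>_ferro, ?MH, \<I>_ferro}"
          by (elim disjE; simp only: Ls insert_iff simp_thms)+
        then show ?thesis by (rule mid)
      next
        case 4
        then have "i = 6 \<or> i = 7" "j = 8 \<or> j = 9" using ij by arith+
        then have "Ls ! i \<in> {\<M>_omega, \<H>_ferro}" "Ls ! j \<in> {?MH, \<I>_ferro}"
          by (elim disjE; simp only: Ls insert_iff simp_thms)+
        then show ?thesis by (rule bot)
      next
        case 5
        then show ?thesis using \<open>\<M>_omega \<noteq> \<H>_ferro\<close> by (simp only: Ls not_False_eq_True)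
      qed
    qed
  qed
  have incomparables: "incomparable \<S>\<D> \<P>" "incomparable \<S>\<D> \<P>\<N>" "incomparable \<P> \<P>\<N>" "incomparable \<M>_omega \<H>_ferro"
    using incomp incomp_MH by (simp_all add: incomparable_def)
  show ?thesis
    using all_clones sublattice distinct sub_B incomparables joins meets J_sub sub_J J_join meet I_sub
      SD_eq_I_anti I_ferro_eq max maximal_in_SDP_SD
    unfolding J_def by (intro conjI) (assumption | blast)+
qed

end
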